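(* Let $\mathscr{J}$ be a system of arities in a symmetric monoidal closed category $\mathscr{V}$ such that $\mathscr{V}_0$ has pullbacks, and let $\mathscr{C}$ be a $\mathscr{J}$-admissible $\mathscr{V}$-category. The idempotent adjunction $\mathsf{Com}\dashv\mathsf{Com}^{\mathrm{op}}:\mathrm{Alg}^{\mathrm{s}}(\mathscr{C})^{\mathrm{op}}\to\mathrm{Alg}^{\mathrm{s}}(\mathscr{C})$ restricts to an idempotent adjunction $$(-)^\perp\dashv((-)^\perp)^{\mathrm{op}}:\mathrm{CoCAlg}^{\mathrm{s}}(\mathscr{C})^{\mathrm{op}}\to\mathrm{CAlg}^{\mathrm{s}}(\mathscr{C}),\qquad(-)^\perp:\mathrm{CAlg}^{\mathrm{s}}(\mathscr{C})\to\mathrm{CoCAlg}^{\mathrm{s}}(\mathscr{C})^{\mathrm{op}},$$ between the categories of commutative and of contracommutative algebras in $\mathscr{C}$. This adjunction restricts to an equivalence $$\mathrm{SatCAlg}^{\mathrm{s}}(\mathscr{C})\simeq\mathrm{SatCoCAlg}^{\mathrm{s}}(\mathscr{C})^{\mathrm{op}}.$$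
   Context: Base setting. $\mathscr{V}$ is a symmetric monoidal closed category with unit object $I$ and underlying ordinary category $\mathscr{V}_0$. By universe enlargement, $\mathscr{V}$ is a full subcategory of a symmetric monoidal closed category $\mathscr{V}'$ that is complete and cocomplete relative to a universe in which everything considered is small, with $\mathscr{V}\hookrightarrow\mathscr{V}'$ preserving all limits that exist in $\mathscr{V}$; $\mathscr{V}$-functor categories exist as $\mathscr{V}'$-categories. A system of arities is a fully faithful symmetric strong monoidal $\mathscr{V}$-functor $\mathscr{J}\to\mathscr{V}$, written as the inclusion of a full sub-$\mathscr{V}$-category containing $I$ and closed under $\otimes$ ($\mathscr{J}$ need not be small). A $\mathscr{J}$-cotensor in a $\mathscr{V}$-category is a cotensor $[J,C]$ with $J\in\mathrm{ob}\,\mathscr{J}$; $\mathscr{V}$-categories with $\mathscr{J}$-cotensors are equipped with designated ones, with $[I,C]=C$ (and identity counit). A $\mathscr{J}$-theory is a $\mathscr{V}$-category $\mathscr{T}$ equipped with an identity-on-objects $\mathscr{V}$-functor $\tau:\mathscr{J}^{\mathrm{op}}\to\mathscr{T}$ that preserves $\mathscr{J}$-cotensors; equivalently, $\mathrm{ob}\,\mathscr{T}=\mathrm{ob}\,\mathscr{J}$ and each object $J$ is equipped with a morphism $J\to\mathscr{T}(J,I)$ exhibiting $J$ as a cotensor $[J,I]$ in $\mathscr{T}$, which for $J=I$ is the identity on $I$. A morphism of $\mathscr{J}$-theories is a $\mathscr{V}$-functor commuting with the structure $\mathscr{V}$-functors $\tau$. For a $\mathscr{V}$-category $\mathscr{C}$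 with $\mathscr{J}$-cotensors, a $\mathscr{T}$-algebra in $\mathscr{C}$ is a $\mathscr{V}$-functor $A:\mathscr{T}\to\mathscr{C}$ preserving $\mathscr{J}$-cotensors; its carrier is $|A|=A(I)$. $\mathscr{T}\text{-}\mathrm{Alg}(\mathscr{C})$ is the full sub-$\mathscr{V}'$-category of $[\mathscr{T},\mathscr{C}]$ on the $\mathscr{T}$-algebras; for a morphism $f$ in it, $|f|=f_I$. $\mathscr{C}$ is $\mathscr{J}$-admissible if it has $\mathscr{J}$-cotensors and for every $\mathscr{J}$-theory $\mathscr{T}$ the ends defining the hom-objects of $\mathscr{T}\text{-}\mathrm{Alg}(\mathscr{C})$ exist in $\mathscr{V}$ (so it is a $\mathscr{V}$-category). $\mathscr{J}$-cotensors in $\mathscr{T}\text{-}\mathrm{Alg}(\mathscr{C})$ are pointwise, with designated ones chosen so that evaluation at $I$ sends them to the designated ones in $\mathscr{C}$. Strong morphisms. An algebra in $\mathscr{C}$ is a pair $(\mathscr{T},A)$ (also written $A$) with $\mathscr{T}$ a $\mathscr{J}$-theory and $A$ a $\mathscr{T}$-algebra in $\mathscr{C}$. $\mathrm{Alg}^{\mathrm{s}}(\mathscr{C})$ is the category of algebras, where a (strong) morphism $(M,f):(\mathscr{T},A)\to(\mathscr{U},B)$ consists of a morphism of $\mathscr{J}$-theories $M:\mathscr{T}\to\mathscr{U}$ and an isomorphism $f:A\to BM$ of $\mathscr{T}$-algebras; $(N,g)(M,f)=(NM,(gM)\cdot f)$. The underlying isomorphism of $(M,f)$ is $|f|:|A|\to|B|$.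 For an object $C$ of $\mathscr{C}$, $\mathrm{Alg}(C)$ is the (non-full) subcategory of algebras with carrier $C$ and morphisms $(M,f)$ with $|f|=1_C$. Commutants. The commutant of $(\mathscr{T},A)$ is the algebra $A^\perp=(\mathscr{T}^\perp_A,A^\perp)$, where $\mathscr{T}^\perp_A$ is the $\mathscr{J}$-theory with $\mathscr{T}^\perp_A(J,K)=\mathscr{T}\text{-}\mathrm{Alg}(\mathscr{C})([J,A],[K,A])$ ($J,K\in\mathrm{ob}\,\mathscr{J}$), with composition and identities as in $\mathscr{T}\text{-}\mathrm{Alg}(\mathscr{C})$ and structure morphisms $J\to\mathscr{T}\text{-}\mathrm{Alg}(\mathscr{C})([J,A],A)$ the cotensor counits, and $A^\perp:\mathscr{T}^\perp_A\to\mathscr{C}$ is the algebra on $|A|$ given by $J\mapsto[J,|A|]$ and on homs by evaluation at $I$. There is a functor $\mathsf{Com}=(-)^\perp:\mathrm{Alg}^{\mathrm{s}}(\mathscr{C})\to\mathrm{Alg}^{\mathrm{s}}(\mathscr{C})^{\mathrm{op}}$ sending each algebra to its commutant and each strong morphism $f:A\to B$ to the unique strong morphism $f^\perp:B^\perp\to A^\perp$ whose underlying isomorphism is $|f|^{-1}$; it is left adjoint to its opposite, with unit the unique morphisms $u_A:A\to A^{\perp\perp}$ in $\mathrm{Alg}(C)$ ($C=|A|$) and counit $u^{\mathrm{op}}$, and this adjunction is idempotent (an adjunction $F\dashv G$ with unit $\eta$ is idempotent if $F\eta$ is an isomorphism). Classes of algebras. Given algebras $A,B$ on $C$, $A$ commutes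 with $B$ if there is a (necessarily unique) morphism $B\to A^\perp$ in $\mathrm{Alg}(C)$. $A$ is commutative if $A$ commutes with itself, contracommutative if $A^\perp$ is commutative, and saturated if $u_A$ is an isomorphism. $\mathrm{CAlg}^{\mathrm{s}}(\mathscr{C})$, $\mathrm{CoCAlg}^{\mathrm{s}}(\mathscr{C})$, $\mathrm{SatCAlg}^{\mathrm{s}}(\mathscr{C})$, $\mathrm{SatCoCAlg}^{\mathrm{s}}(\mathscr{C})$ are the full subcategories of $\mathrm{Alg}^{\mathrm{s}}(\mathscr{C})$ on the commutative, contracommutative, saturated commutative, and saturated contracommutative algebras, respectively. *)

theory Defs
  imports Main "HOL-Library.FuncSet"
begin

section \<open>Ordinary categories\<close>

record ('a, 'f) cat =
  Obj :: "'a set"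
  Arr :: "'f set"
  Dom :: "'f \<Rightarrow> 'a"
  Cod :: "'f \<Rightarrow> 'a"
  Id :: "'a \<Rightarrow> 'f"
  Comp :: "'f \<Rightarrow> 'f \<Rightarrow> 'f"  (infixr "\<cdot>\<index>" 55)

definition hom :: "('a, 'f, 'z) cat_scheme \<Rightarrow> 'a \<Rightarrow> 'a \<Rightarrow> 'f set" where
  "hom X a b = {f \<in> Arr X. Dom X f = a \<and> Cod X f = b}"

definition category :: "('a, 'f, 'z) cat_scheme \<Rightarrow> bool" where
  "category X \<longleftrightarrow>
     (\<forall>f\<in>Arr X. Dom X f \<in> Obj X \<and> Cod X f \<in> Obj X) \<and>
     (\<forall>a\<in>Obj X. Id X a \<in> hom X a a) \<and>
     (\<forall>a b c f g. f \<in> hom X a b \<longrightarrow> g \<in> hom X b c \<longrightarrow> g \<cdot>\<^bsub>X\<^esub> f \<in> hom X a c) \<and>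
     (\<forall>a b f. f \<in> hom X a b \<longrightarrow> f \<cdot>\<^bsub>X\<^esub> Id X a = f \<and> Id X b \<cdot>\<^bsub>X\<^esub> f = f) \<and>
     (\<forall>a b c d f g h. f \<in> hom X a b \<longrightarrow> g \<in> hom X b c \<longrightarrow> h \<in> hom X c d \<longrightarrow>
        h \<cdot>\<^bsub>X\<^esub> (g \<cdot>\<^bsub>X\<^esub> f) = (h \<cdot>\<^bsub>X\<^esub> g) \<cdot>\<^bsub>X\<^esub> f)"

definition inverse_arrows :: "('a, 'f, 'z) cat_scheme \<Rightarrow> 'f \<Rightarrow> 'f \<Rightarrow> bool" where
  "inverse_arrows X f g \<longleftrightarrow> f \<in> Arr X \<and> g \<in> hom X (Cod X f) (Dom X f) \<and>
     g \<cdot>\<^bsub>X\<^esub> f = Id X (Dom X f) \<and> f \<cdot>\<^bsub>X\<^esub> g = Id X (Cod X f)"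

definition iso :: "('a, 'f, 'z) cat_scheme \<Rightarrow> 'f \<Rightarrow> bool" where
  "iso X f \<longleftrightarrow> (\<exists>g. inverse_arrows X f g)"

definition inv_arr :: "('a, 'f, 'z) cat_scheme \<Rightarrow> 'f \<Rightarrow> 'f" where
  "inv_arr X f = (THE g. inverse_arrows X f g)"

definition has_pullbacks :: "('a, 'f, 'z) cat_scheme \<Rightarrow> bool" where
  "has_pullbacks X \<longleftrightarrow>
     (\<forall>a b c f g. f \<in> hom X a c \<longrightarrow> g \<in> hom X b c \<longrightarrow>
       (\<exists>p\<in>Obj X. \<exists>p1\<in>hom X p a. \<exists>p2\<in>hom X p b. f \<cdot>\<^bsub>X\<^esub> p1 = g \<cdot>\<^bsub>X\<^esub> p2 \<and>
         (\<forall>q. \<forall>q1\<in>hom X q a. \<forall>q2\<in>hom X q b. f \<cdot>\<^bsub>X\<^esub> q1 = g \<cdot>\<^bsub>X\<^esub> q2 \<longrightarrow>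
           (\<exists>!h. h \<in> hom X q p \<and> p1 \<cdot>\<^bsub>X\<^esub> h = q1 \<and> p2 \<cdot>\<^bsub>X\<^esub> h = q2))))"

definition op_cat :: "('a, 'f) cat \<Rightarrow> ('a, 'f) cat" where
  "op_cat X = \<lparr>Obj = Obj X, Arr = Arr X, Dom = Cod X, Cod = Dom X, Id = Id X,
               Comp = (\<lambda>g f. f \<cdot>\<^bsub>X\<^esub> g)\<rparr>"

definition full_subcat :: "('a, 'f) cat \<Rightarrow> ('a \<Rightarrow> bool) \<Rightarrow> ('a, 'f) cat" where
  "full_subcat X P = X\<lparr>Obj := {a \<in> Obj X. P a},
                       Arr := {f \<in> Arr X. P (Dom X f) \<and> P (Cod X f)}\<rparr>"

text \<open>
  A functor \<open>F\<close> is recorded by its action on objects and on arrows, its source and target being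
  arguments of \<open>is_functor\<close>. Hence the opposite functor, and the restriction of a functor to full
  subcategories, are given by the very same record.
\<close>

record ('a, 'f, 'b, 'g) ofun =
  OFO :: "'a \<Rightarrow> 'b"
  OFA :: "'f \<Rightarrow> 'g"

definition is_functor :: "('a, 'f) cat \<Rightarrow> ('b, 'g) cat \<Rightarrow> ('a, 'f, 'b, 'g) ofun \<Rightarrow> bool" where
  "is_functor X Y F \<longleftrightarrow> category X \<and> category Y \<and>
     (\<forall>a\<in>Obj X. OFO F a \<in> Obj Y) \<and>
     (\<forall>a b. \<forall>f\<in>hom X a b. OFA F f \<in> hom Y (OFO F a) (OFO F b)) \<and>
     (\<forall>a\<in>Obj X. OFA F (Id X a) = Id Y (OFO F a)) \<and>
     (\<forall>a b c. \<forall>f\<in>hom X a b. \<forall>g\<in>hom X b c. OFA F (g \<cdot>\<^bsub>X\<^esub> f) = OFA F g \<cdot>\<^bsub>Y\<^esub> OFA F f)"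

text \<open>\<open>F \<stileturn> G\<close> with \<open>F : X \<rightarrow> Y\<close>, unit \<open>\<eta>\<close> and counit \<open>\<epsilon>\<close>.\<close>

definition adjunction ::
  "('a, 'f) cat \<Rightarrow> ('b, 'g) cat \<Rightarrow> ('a, 'f, 'b, 'g) ofun \<Rightarrow> ('b, 'g, 'a, 'f) ofun \<Rightarrow>
   ('a \<Rightarrow> 'f) \<Rightarrow> ('b \<Rightarrow> 'g) \<Rightarrow> bool" where
  "adjunction X Y F G \<eta> \<epsilon> \<longleftrightarrow> is_functor X Y F \<and> is_functor Y X G \<and>
     (\<forall>a\<in>Obj X. \<eta> a \<in> hom X a (OFO G (OFO F a))) \<and>
     (\<forall>a b. \<forall>f\<in>hom X a b. \<eta> b \<cdot>\<^bsub>X\<^esub> f = OFA G (OFA F f) \<cdot>\<^bsub>X\<^esub> \<eta> a) \<and>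
     (\<forall>y\<in>Obj Y. \<epsilon> y \<in> hom Y (OFO F (OFO G y)) y) \<and>
     (\<forall>y z. \<forall>g\<in>hom Y y z. \<epsilon> z \<cdot>\<^bsub>Y\<^esub> OFA F (OFA G g) = g \<cdot>\<^bsub>Y\<^esub> \<epsilon> y) \<and>
     (\<forall>a\<in>Obj X. \<epsilon> (OFO F a) \<cdot>\<^bsub>Y\<^esub> OFA F (\<eta> a) = Id Y (OFO F a)) \<and>
     (\<forall>y\<in>Obj Y. OFA G (\<epsilon> y) \<cdot>\<^bsub>X\<^esub> \<eta> (OFO G y) = Id X (OFO G y))"

definition idempotent_adjunction ::
  "('a, 'f) cat \<Rightarrow> ('b, 'g) cat \<Rightarrow> ('a, 'f, 'b, 'g) ofun \<Rightarrow> ('b, 'g, 'a, 'f) ofun \<Rightarrow>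
   ('a \<Rightarrow> 'f) \<Rightarrow> ('b \<Rightarrow> 'g) \<Rightarrow> bool" where
  "idempotent_adjunction X Y F G \<eta> \<epsilon> \<longleftrightarrow> adjunction X Y F G \<eta> \<epsilon> \<and>
     (\<forall>a\<in>Obj X. iso Y (OFA F (\<eta> a)))"

definition adjoint_equivalence ::
  "('a, 'f) cat \<Rightarrow> ('b, 'g) cat \<Rightarrow> ('a, 'f, 'b, 'g) ofun \<Rightarrow> ('b, 'g, 'a, 'f) ofun \<Rightarrow>
   ('a \<Rightarrow> 'f) \<Rightarrow> ('b \<Rightarrow> 'g) \<Rightarrow> bool" where
  "adjoint_equivalence X Y F G \<eta> \<epsilon> \<longleftrightarrow> adjunction X Y F G \<eta> \<epsilon> \<and>
     (\<forall>a\<in>Obj X. iso X (\<eta> a)) \<and> (\<forall>y\<in>Obj Y. iso Y (\<epsilon> y))"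


section \<open>Symmetric monoidal closed categories\<close>

record ('o, 'm) smc = "('o, 'm) cat" +
  Ten :: "'o \<Rightarrow> 'o \<Rightarrow> 'o"  (infixr "\<otimes>\<index>" 70)
  TenA :: "'m \<Rightarrow> 'm \<Rightarrow> 'm"  (infixr "\<boxtimes>\<index>" 70)
  Unit :: 'o
  Assoc :: "'o \<Rightarrow> 'o \<Rightarrow> 'o \<Rightarrow> 'm"  \<comment> \<open>\<open>(a \<otimes> b) \<otimes> c \<rightarrow> a \<otimes> (b \<otimes> c)\<close>\<close>
  LUnit :: "'o \<Rightarrow> 'm"  \<comment> \<open>\<open>I \<otimes> a \<rightarrow> a\<close>\<close>
  RUnit :: "'o \<Rightarrow> 'm"  \<comment> \<open>\<open>a \<otimes> I \<rightarrow> a\<close>\<close>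
  Sym :: "'o \<Rightarrow> 'o \<Rightarrow> 'm"  \<comment> \<open>\<open>a \<otimes> b \<rightarrow> b \<otimes> a\<close>\<close>
  IHom :: "'o \<Rightarrow> 'o \<Rightarrow> 'o"
  Ev :: "'o \<Rightarrow> 'o \<Rightarrow> 'm"  \<comment> \<open>\<open>IHom a b \<otimes> a \<rightarrow> b\<close>\<close>

definition symmetric_monoidal :: "('o, 'm) smc \<Rightarrow> bool" where
  "symmetric_monoidal V \<longleftrightarrow> category V \<and>
     Unit V \<in> Obj V \<and>
     (\<forall>a\<in>Obj V. \<forall>b\<in>Obj V. a \<otimes>\<^bsub>V\<^esub> b \<in> Obj V) \<and>
     (\<forall>a b c d. \<forall>f\<in>hom V a b. \<forall>g\<in>hom V c d. f \<boxtimes>\<^bsub>V\<^esub> g \<in> hom V (a \<otimes>\<^bsub>V\<^esub> c) (b \<otimes>\<^bsub>V\<^esub> d)) \<and>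
     (\<forall>a\<in>Obj V. \<forall>b\<in>Obj V. Id V a \<boxtimes>\<^bsub>V\<^esub> Id V b = Id V (a \<otimes>\<^bsub>V\<^esub> b)) \<and>
     (\<forall>a b c a' b' c'. \<forall>f\<in>hom V a b. \<forall>g\<in>hom V b c. \<forall>f'\<in>hom V a' b'. \<forall>g'\<in>hom V b' c'.
        (g \<cdot>\<^bsub>V\<^esub> f) \<boxtimes>\<^bsub>V\<^esub> (g' \<cdot>\<^bsub>V\<^esub> f') = (g \<boxtimes>\<^bsub>V\<^esub> g') \<cdot>\<^bsub>V\<^esub> (f \<boxtimes>\<^bsub>V\<^esub> f')) \<and>
     (\<forall>a\<in>Obj V. \<forall>b\<in>Obj V. \<forall>c\<in>Obj V.
        Assoc V a b c \<in> hom V ((a \<otimes>\<^bsub>V\<^esub> b) \<otimes>\<^bsub>V\<^esub> c) (a \<otimes>\<^bsub>V\<^esub> (b \<otimes>\<^bsub>V\<^esub> c)) \<and> iso V (Assoc V a b c)) \<and>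
     (\<forall>a\<in>Obj V. LUnit V a \<in> hom V (Unit V \<otimes>\<^bsub>V\<^esub> a) a \<and> iso V (LUnit V a)) \<and>
     (\<forall>a\<in>Obj V. RUnit V a \<in> hom V (a \<otimes>\<^bsub>V\<^esub> Unit V) a \<and> iso V (RUnit V a)) \<and>
     (\<forall>a\<in>Obj V. \<forall>b\<in>Obj V. Sym V a b \<in> hom V (a \<otimes>\<^bsub>V\<^esub> b) (b \<otimes>\<^bsub>V\<^esub> a)) \<and>
     \<comment> \<open>naturality\<close>
     (\<forall>a b c a' b' c'. \<forall>f\<in>hom V a a'. \<forall>g\<in>hom V b b'. \<forall>h\<in>hom V c c'.
        Assoc V a' b' c' \<cdot>\<^bsub>V\<^esub> ((f \<boxtimes>\<^bsub>V\<^esub> g) \<boxtimes>\<^bsub>V\<^esub> h) = (f \<boxtimes>\<^bsub>V\<^esub> (g \<boxtimes>\<^bsub>V\<^esub> h)) \<cdot>\<^bsub>V\<^esub> Assoc V a b c) \<and>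
     (\<forall>a b. \<forall>f\<in>hom V a b. LUnit V b \<cdot>\<^bsub>V\<^esub> (Id V (Unit V) \<boxtimes>\<^bsub>V\<^esub> f) = f \<cdot>\<^bsub>V\<^esub> LUnit V a) \<and>
     (\<forall>a b. \<forall>f\<in>hom V a b. RUnit V b \<cdot>\<^bsub>V\<^esub> (f \<boxtimes>\<^bsub>V\<^esub> Id V (Unit V)) = f \<cdot>\<^bsub>V\<^esub> RUnit V a) \<and>
     (\<forall>a b a' b'. \<forall>f\<in>hom V a a'. \<forall>g\<in>hom V b b'.
        Sym V a' b' \<cdot>\<^bsub>V\<^esub> (f \<boxtimes>\<^bsub>V\<^esub> g) = (g \<boxtimes>\<^bsub>V\<^esub> f) \<cdot>\<^bsub>V\<^esub> Sym V a b) \<and>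
     \<comment> \<open>coherence\<close>
     (\<forall>a\<in>Obj V. \<forall>b\<in>Obj V. \<forall>c\<in>Obj V. \<forall>d\<in>Obj V.
        Assoc V a b (c \<otimes>\<^bsub>V\<^esub> d) \<cdot>\<^bsub>V\<^esub> Assoc V (a \<otimes>\<^bsub>V\<^esub> b) c d =
        (Id V a \<boxtimes>\<^bsub>V\<^esub> Assoc V b c d) \<cdot>\<^bsub>V\<^esub> Assoc V a (b \<otimes>\<^bsub>V\<^esub> c) d \<cdot>\<^bsub>V\<^esub> (Assoc V a b c \<boxtimes>\<^bsub>V\<^esub> Id V d)) \<and>
     (\<forall>a\<in>Obj V. \<forall>b\<in>Obj V.
        (Id V a \<boxtimes>\<^bsub>V\<^esub> LUnit V b) \<cdot>\<^bsub>V\<^esub> Assoc V a (Unit V) b = RUnit V a \<boxtimes>\<^bsub>V\<^esub> Id V b) \<and>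
     (\<forall>a\<in>Obj V. \<forall>b\<in>Obj V. Sym V b a \<cdot>\<^bsub>V\<^esub> Sym V a b = Id V (a \<otimes>\<^bsub>V\<^esub> b)) \<and>
     (\<forall>a\<in>Obj V. \<forall>b\<in>Obj V. \<forall>c\<in>Obj V.
        Assoc V b c a \<cdot>\<^bsub>V\<^esub> Sym V a (b \<otimes>\<^bsub>V\<^esub> c) \<cdot>\<^bsub>V\<^esub> Assoc V a b c =
        (Id V b \<boxtimes>\<^bsub>V\<^esub> Sym V a c) \<cdot>\<^bsub>V\<^esub> Assoc V b a c \<cdot>\<^bsub>V\<^esub> (Sym V a b \<boxtimes>\<^bsub>V\<^esub> Id V c))"

definition symmetric_monoidal_closed :: "('o, 'm) smc \<Rightarrow> bool" where
  "symmetric_monoidal_closed V \<longleftrightarrow> symmetric_monoidal V \<and>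
     (\<forall>a\<in>Obj V. \<forall>b\<in>Obj V. IHom V a b \<in> Obj V \<and> Ev V a b \<in> hom V (IHom V a b \<otimes>\<^bsub>V\<^esub> a) b \<and>
        (\<forall>x\<in>Obj V. \<forall>f\<in>hom V (x \<otimes>\<^bsub>V\<^esub> a) b.
           \<exists>!g. g \<in> hom V x (IHom V a b) \<and> Ev V a b \<cdot>\<^bsub>V\<^esub> (g \<boxtimes>\<^bsub>V\<^esub> Id V a) = f))"

text \<open>The transpose \<open>x \<rightarrow> IHom a b\<close> of \<open>f : x \<otimes> a \<rightarrow> b\<close>.\<close>

definition curr :: "('o, 'm) smc \<Rightarrow> 'o \<Rightarrow> 'o \<Rightarrow> 'o \<Rightarrow> 'm \<Rightarrow> 'm" where
  "curr V x a b f = (THE g. g \<in> hom V x (IHom V a b) \<and> Ev V a b \<cdot>\<^bsub>V\<^esub> (g \<boxtimes>\<^bsub>V\<^esub> Id V a) = f)"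


section \<open>Enriched categories\<close>

text \<open>
  Families indexed by objects are made to take the value \<open>undefined\<close> outside the relevant set of
  objects, so that equality of records is equality of the structures they describe.
\<close>

definition ext2 :: "'a set \<Rightarrow> ('a \<Rightarrow> 'a \<Rightarrow> 'b) \<Rightarrow> ('a \<Rightarrow> 'a \<Rightarrow> 'b)" where
  "ext2 S f = (\<lambda>a b. if a \<in> S \<and> b \<in> S then f a b else undefined)"

definition ext3 :: "'a set \<Rightarrow> ('a \<Rightarrow> 'a \<Rightarrow> 'a \<Rightarrow> 'b) \<Rightarrow> ('a \<Rightarrow> 'a \<Rightarrow> 'a \<Rightarrow> 'b)" where
  "ext3 S f = (\<lambda>a b c. if a \<in> S \<and> b \<in> S \<and> c \<in> S then f a b c else undefined)"

record ('c, 'o, 'm) vcat =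
  VObj :: "'c set"
  VHom :: "'c \<Rightarrow> 'c \<Rightarrow> 'o"
  VComp :: "'c \<Rightarrow> 'c \<Rightarrow> 'c \<Rightarrow> 'm"  \<comment> \<open>\<open>VComp a b c : VHom b c \<otimes> VHom a b \<rightarrow> VHom a c\<close>\<close>
  VId :: "'c \<Rightarrow> 'm"  \<comment> \<open>\<open>I \<rightarrow> VHom a a\<close>\<close>

definition vcategory :: "('o, 'm) smc \<Rightarrow> ('c, 'o, 'm, 'z) vcat_scheme \<Rightarrow> bool" where
  "vcategory V C \<longleftrightarrow>
     (\<forall>a\<in>VObj C. \<forall>b\<in>VObj C. VHom C a b \<in> Obj V) \<and>
     (\<forall>a\<in>VObj C. \<forall>b\<in>VObj C. \<forall>c\<in>VObj C.
        VComp C a b c \<in> hom V (VHom C b c \<otimes>\<^bsub>V\<^esub> VHom C a b) (VHom C a c)) \<and>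
     (\<forall>a\<in>VObj C. VId C a \<in> hom V (Unit V) (VHom C a a)) \<and>
     (\<forall>a\<in>VObj C. \<forall>b\<in>VObj C. \<forall>c\<in>VObj C. \<forall>d\<in>VObj C.
        VComp C a b d \<cdot>\<^bsub>V\<^esub> (VComp C b c d \<boxtimes>\<^bsub>V\<^esub> Id V (VHom C a b)) =
        VComp C a c d \<cdot>\<^bsub>V\<^esub> (Id V (VHom C c d) \<boxtimes>\<^bsub>V\<^esub> VComp C a b c)
          \<cdot>\<^bsub>V\<^esub> Assoc V (VHom C c d) (VHom C b c) (VHom C a b)) \<and>
     (\<forall>a\<in>VObj C. \<forall>b\<in>VObj C.
        VComp C a b b \<cdot>\<^bsub>V\<^esub> (VId C b \<boxtimes>\<^bsub>V\<^esub> Id V (VHom C a b)) = LUnit V (VHom C a b) \<and>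
        VComp C a a b \<cdot>\<^bsub>V\<^esub> (Id V (VHom C a b) \<boxtimes>\<^bsub>V\<^esub> VId C a) = RUnit V (VHom C a b))"

definition self_vcat :: "('o, 'm) smc \<Rightarrow> ('o, 'o, 'm) vcat" where
  "self_vcat V = \<lparr>
     VObj = Obj V,
     VHom = IHom V,
     VComp = (\<lambda>a b c. curr V (IHom V b c \<otimes>\<^bsub>V\<^esub> IHom V a b) a c
       (Ev V b c \<cdot>\<^bsub>V\<^esub> (Id V (IHom V b c) \<boxtimes>\<^bsub>V\<^esub> Ev V a b) \<cdot>\<^bsub>V\<^esub> Assoc V (IHom V b c) (IHom V a b) a)),
     VId = (\<lambda>a. curr V (Unit V) a a (LUnit V a))\<rparr>"

definition op_vcat :: "('o, 'm) smc \<Rightarrow> ('c, 'o, 'm) vcat \<Rightarrow> ('c, 'o, 'm) vcat" where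
  "op_vcat V C = \<lparr>
     VObj = VObj C,
     VHom = (\<lambda>a b. VHom C b a),
     VComp = (\<lambda>a b c. VComp C c b a \<cdot>\<^bsub>V\<^esub> Sym V (VHom C c b) (VHom C b a)),
     VId = VId C\<rparr>"

definition full_sub_vcat :: "('c, 'o, 'm) vcat \<Rightarrow> 'c set \<Rightarrow> ('c, 'o, 'm) vcat" where
  "full_sub_vcat C S = C\<lparr>VObj := S\<rparr>"

text \<open>Composition \<open>g \<cdot> f\<close> in the underlying ordinary category, whose arrows \<open>a \<rightarrow> b\<close> are the arrows
  \<open>I \<rightarrow> VHom C a b\<close> of \<open>V\<close>.\<close>

definition ucomp ::
  "('o, 'm) smc \<Rightarrow> ('c, 'o, 'm, 'z) vcat_scheme \<Rightarrow> 'c \<Rightarrow> 'c \<Rightarrow> 'c \<Rightarrow> 'm \<Rightarrow> 'm \<Rightarrow> 'm" where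
  "ucomp V C a b c g f = VComp C a b c \<cdot>\<^bsub>V\<^esub> (g \<boxtimes>\<^bsub>V\<^esub> f) \<cdot>\<^bsub>V\<^esub> inv_arr V (LUnit V (Unit V))"

definition uinverse ::
  "('o, 'm) smc \<Rightarrow> ('c, 'o, 'm, 'z) vcat_scheme \<Rightarrow> 'c \<Rightarrow> 'c \<Rightarrow> 'm \<Rightarrow> 'm \<Rightarrow> bool" where
  "uinverse V C a b f g \<longleftrightarrow>
     f \<in> hom V (Unit V) (VHom C a b) \<and> g \<in> hom V (Unit V) (VHom C b a) \<and>
     ucomp V C a b a g f = VId C a \<and> ucomp V C b a b f g = VId C b"

record ('c, 'd, 'm) vfun =
  FO :: "'c \<Rightarrow> 'd"
  FA :: "'c \<Rightarrow> 'c \<Rightarrow> 'm"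

definition vfunctor ::
  "('o, 'm) smc \<Rightarrow> ('c, 'o, 'm, 'y) vcat_scheme \<Rightarrow> ('d, 'o, 'm, 'z) vcat_scheme \<Rightarrow>
   ('c, 'd, 'm) vfun \<Rightarrow> bool" where
  "vfunctor V C D F \<longleftrightarrow>
     FO F \<in> VObj C \<rightarrow>\<^sub>E VObj D \<and> ext2 (VObj C) (FA F) = FA F \<and>
     (\<forall>a\<in>VObj C. \<forall>b\<in>VObj C. FA F a b \<in> hom V (VHom C a b) (VHom D (FO F a) (FO F b))) \<and>
     (\<forall>a\<in>VObj C. FA F a a \<cdot>\<^bsub>V\<^esub> VId C a = VId D (FO F a)) \<and>
     (\<forall>a\<in>VObj C. \<forall>b\<in>VObj C. \<forall>c\<in>VObj C.
        FA F a c \<cdot>\<^bsub>V\<^esub> VComp C a b c =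
        VComp D (FO F a) (FO F b) (FO F c) \<cdot>\<^bsub>V\<^esub> (FA F b c \<boxtimes>\<^bsub>V\<^esub> FA F a b))"

definition vfun_id :: "('o, 'm) smc \<Rightarrow> ('c, 'o, 'm, 'z) vcat_scheme \<Rightarrow> ('c, 'c, 'm) vfun" where
  "vfun_id V C = \<lparr>FO = (\<lambda>a\<in>VObj C. a), FA = ext2 (VObj C) (\<lambda>a b. Id V (VHom C a b))\<rparr>"

text \<open>The composite \<open>G F\<close>, where \<open>S\<close> is the set of objects of the source of \<open>F\<close>.\<close>

definition vfun_comp ::
  "('o, 'm) smc \<Rightarrow> 'c set \<Rightarrow> ('d, 'e, 'm) vfun \<Rightarrow> ('c, 'd, 'm) vfun \<Rightarrow> ('c, 'e, 'm) vfun" where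
  "vfun_comp V S G F = \<lparr>FO = (\<lambda>a\<in>S. FO G (FO F a)),
                        FA = ext2 S (\<lambda>a b. FA G (FO F a) (FO F b) \<cdot>\<^bsub>V\<^esub> FA F a b)\<rparr>"

definition vnat ::
  "('o, 'm) smc \<Rightarrow> ('c, 'o, 'm, 'y) vcat_scheme \<Rightarrow> ('d, 'o, 'm, 'z) vcat_scheme \<Rightarrow>
   ('c, 'd, 'm) vfun \<Rightarrow> ('c, 'd, 'm) vfun \<Rightarrow> ('c \<Rightarrow> 'm) \<Rightarrow> bool" where
  "vnat V C D F G t \<longleftrightarrow>
     t \<in> extensional (VObj C) \<and>
     (\<forall>a\<in>VObj C. t a \<in> hom V (Unit V) (VHom D (FO F a) (FO G a))) \<and>
     (\<forall>a\<in>VObj C. \<forall>b\<in>VObj C.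
        VComp D (FO F a) (FO F b) (FO G b) \<cdot>\<^bsub>V\<^esub> (t b \<boxtimes>\<^bsub>V\<^esub> FA F a b) \<cdot>\<^bsub>V\<^esub> inv_arr V (LUnit V (VHom C a b)) =
        VComp D (FO F a) (FO G a) (FO G b) \<cdot>\<^bsub>V\<^esub> (FA G a b \<boxtimes>\<^bsub>V\<^esub> t a) \<cdot>\<^bsub>V\<^esub> inv_arr V (RUnit V (VHom C a b)))"

definition vnat_iso ::
  "('o, 'm) smc \<Rightarrow> ('c, 'o, 'm, 'y) vcat_scheme \<Rightarrow> ('d, 'o, 'm, 'z) vcat_scheme \<Rightarrow>
   ('c, 'd, 'm) vfun \<Rightarrow> ('c, 'd, 'm) vfun \<Rightarrow> ('c \<Rightarrow> 'm) \<Rightarrow> bool" where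
  "vnat_iso V C D F G t \<longleftrightarrow> vnat V C D F G t \<and>
     (\<exists>s. vnat V C D G F s \<and> (\<forall>a\<in>VObj C. uinverse V D (FO F a) (FO G a) (t a) (s a)))"


section \<open>Cotensors\<close>

text \<open>The morphism \<open>VHom C d l \<rightarrow> IHom j (VHom C d c)\<close> induced by \<open>\<kappa> : j \<rightarrow> VHom C l c\<close>.\<close>

definition cot_cmp ::
  "('o, 'm) smc \<Rightarrow> ('c, 'o, 'm, 'z) vcat_scheme \<Rightarrow> 'o \<Rightarrow> 'c \<Rightarrow> 'c \<Rightarrow> 'm \<Rightarrow> 'c \<Rightarrow> 'm" where
  "cot_cmp V C j c l \<kappa> d = curr V (VHom C d l) j (VHom C d c)
     (VComp C d l c \<cdot>\<^bsub>V\<^esub> (\<kappa> \<boxtimes>\<^bsub>V\<^esub> Id V (VHom C d l)) \<cdot>\<^bsub>V\<^esub> Sym V (VHom C d l) j)"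

text \<open>\<open>\<kappa>\<close> exhibits \<open>l\<close> as a cotensor \<open>[j, c]\<close>.\<close>

definition is_cotensor ::
  "('o, 'm) smc \<Rightarrow> ('c, 'o, 'm, 'z) vcat_scheme \<Rightarrow> 'o \<Rightarrow> 'c \<Rightarrow> 'c \<Rightarrow> 'm \<Rightarrow> bool" where
  "is_cotensor V C j c l \<kappa> \<longleftrightarrow> c \<in> VObj C \<and> l \<in> VObj C \<and> \<kappa> \<in> hom V j (VHom C l c) \<and>
     (\<forall>d\<in>VObj C. iso V (cot_cmp V C j c l \<kappa> d))"

definition preserves_cotensors ::
  "('o, 'm) smc \<Rightarrow> 'o set \<Rightarrow> ('c, 'o, 'm, 'y) vcat_scheme \<Rightarrow> ('d, 'o, 'm, 'z) vcat_scheme \<Rightarrow>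
   ('c, 'd, 'm) vfun \<Rightarrow> bool" where
  "preserves_cotensors V \<J> C D F \<longleftrightarrow>
     (\<forall>j\<in>\<J>. \<forall>c l \<kappa>. is_cotensor V C j c l \<kappa> \<longrightarrow>
        is_cotensor V D j (FO F c) (FO F l) (FA F l c \<cdot>\<^bsub>V\<^esub> \<kappa>))"

text \<open>Enriched categories with designated cotensors \<open>Cot j c\<close> and counits \<open>Cnt j c\<close>.\<close>

record ('c, 'o, 'm) cvcat = "('c, 'o, 'm) vcat" +
  Cot :: "'o \<Rightarrow> 'c \<Rightarrow> 'c"
  Cnt :: "'o \<Rightarrow> 'c \<Rightarrow> 'm"

definition has_designated_cotensors ::
  "('o, 'm) smc \<Rightarrow> 'o set \<Rightarrow> ('c, 'o, 'm, 'z) cvcat_scheme \<Rightarrow> bool" where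
  "has_designated_cotensors V \<J> C \<longleftrightarrow>
     (\<forall>j\<in>\<J>. \<forall>c\<in>VObj C. is_cotensor V C j c (Cot C j c) (Cnt C j c)) \<and>
     (\<forall>c\<in>VObj C. Cot C (Unit V) c = c \<and> Cnt C (Unit V) c = VId C c)"

text \<open>The action \<open>VHom C c d \<rightarrow> VHom C [j,c] [j,d]\<close> of the enriched functor \<open>[j, -]\<close>.\<close>

definition cot_arr ::
  "('o, 'm) smc \<Rightarrow> ('c, 'o, 'm, 'z) cvcat_scheme \<Rightarrow> 'o \<Rightarrow> 'c \<Rightarrow> 'c \<Rightarrow> 'm" where
  "cot_arr V C j c d =
     inv_arr V (cot_cmp V C j d (Cot C j d) (Cnt C j d) (Cot C j c)) \<cdot>\<^bsub>V\<^esub>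
     curr V (VHom C c d) j (VHom C (Cot C j c) d)
       (VComp C (Cot C j c) c d \<cdot>\<^bsub>V\<^esub> (Id V (VHom C c d) \<boxtimes>\<^bsub>V\<^esub> Cnt C j c))"


section \<open>Theories and algebras\<close>

definition system_of_arities :: "('o, 'm) smc \<Rightarrow> 'o set \<Rightarrow> bool" where
  "system_of_arities V \<J> \<longleftrightarrow> \<J> \<subseteq> Obj V \<and> Unit V \<in> \<J> \<and> (\<forall>j\<in>\<J>. \<forall>k\<in>\<J>. j \<otimes>\<^bsub>V\<^esub> k \<in> \<J>)"

definition op_arities :: "('o, 'm) smc \<Rightarrow> 'o set \<Rightarrow> ('o, 'o, 'm) vcat" where
  "op_arities V \<J> = op_vcat V (full_sub_vcat (self_vcat V) \<J>)"

record ('o, 'm) thy = "('o, 'o, 'm) vcat" +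
  Str :: "('o, 'o, 'm) vfun"

definition is_theory :: "('o, 'm) smc \<Rightarrow> 'o set \<Rightarrow> ('o, 'm) thy \<Rightarrow> bool" where
  "is_theory V \<J> T \<longleftrightarrow> vcategory V T \<and>
     VObj T = \<J> \<and> ext2 \<J> (VHom T) = VHom T \<and> ext3 \<J> (VComp T) = VComp T \<and> VId T \<in> extensional \<J> \<and>
     vfunctor V (op_arities V \<J>) T (Str T) \<and> (\<forall>j\<in>\<J>. FO (Str T) j = j) \<and>
     preserves_cotensors V \<J> (op_arities V \<J>) T (Str T)"

definition theory_morphism ::
  "('o, 'm) smc \<Rightarrow> 'o set \<Rightarrow> ('o, 'm) thy \<Rightarrow> ('o, 'm) thy \<Rightarrow> ('o, 'o, 'm) vfun \<Rightarrow> bool" where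
  "theory_morphism V \<J> T U M \<longleftrightarrow> vfunctor V T U M \<and> vfun_comp V \<J> M (Str T) = Str U"

definition is_algebra ::
  "('o, 'm) smc \<Rightarrow> 'o set \<Rightarrow> ('c, 'o, 'm, 'z) vcat_scheme \<Rightarrow> ('o, 'm) thy \<Rightarrow> ('o, 'c, 'm) vfun \<Rightarrow> bool" where
  "is_algebra V \<J> C T A \<longleftrightarrow> vfunctor V T C A \<and> preserves_cotensors V \<J> T C A"

text \<open>
  The end of \<open>C(A-, B-) : T\<^sup>o\<^sup>p \<otimes> T \<rightarrow> V\<close>. The wedge condition equates two arrows
  \<open>E \<rightarrow> IHom (VHom T j k) (VHom C (A j) (B k))\<close>, written here in terms of their transposes
  \<open>VHom T j k \<otimes> E \<rightarrow> VHom C (A j) (B k)\<close>.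
\<close>

definition hom_wedge ::
  "('o, 'm) smc \<Rightarrow> ('t, 'o, 'm, 'y) vcat_scheme \<Rightarrow> ('c, 'o, 'm, 'z) vcat_scheme \<Rightarrow>
   ('t, 'c, 'm) vfun \<Rightarrow> ('t, 'c, 'm) vfun \<Rightarrow> 'o \<Rightarrow> ('t \<Rightarrow> 'm) \<Rightarrow> bool" where
  "hom_wedge V T C A B E p \<longleftrightarrow> E \<in> Obj V \<and>
     (\<forall>j\<in>VObj T. p j \<in> hom V E (VHom C (FO A j) (FO B j))) \<and>
     (\<forall>j\<in>VObj T. \<forall>k\<in>VObj T.
        VComp C (FO A j) (FO B j) (FO B k) \<cdot>\<^bsub>V\<^esub> (FA B j k \<boxtimes>\<^bsub>V\<^esub> p j) =
        VComp C (FO A j) (FO A k) (FO B k) \<cdot>\<^bsub>V\<^esub> (p k \<boxtimes>\<^bsub>V\<^esub> FA A j k) \<cdot>\<^bsub>V\<^esub> Sym V (VHom T j k) E)"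

definition is_hom_end ::
  "('o, 'm) smc \<Rightarrow> ('t, 'o, 'm, 'y) vcat_scheme \<Rightarrow> ('c, 'o, 'm, 'z) vcat_scheme \<Rightarrow>
   ('t, 'c, 'm) vfun \<Rightarrow> ('t, 'c, 'm) vfun \<Rightarrow> 'o \<Rightarrow> ('t \<Rightarrow> 'm) \<Rightarrow> bool" where
  "is_hom_end V T C A B E p \<longleftrightarrow> hom_wedge V T C A B E p \<and>
     (\<forall>X q. hom_wedge V T C A B X q \<longrightarrow>
        (\<exists>!h. h \<in> hom V X E \<and> (\<forall>j\<in>VObj T. p j \<cdot>\<^bsub>V\<^esub> h = q j)))"

definition hom_end ::
  "('o, 'm) smc \<Rightarrow> ('t, 'o, 'm, 'y) vcat_scheme \<Rightarrow> ('c, 'o, 'm, 'z) vcat_scheme \<Rightarrow>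
   ('t, 'c, 'm) vfun \<Rightarrow> ('t, 'c, 'm) vfun \<Rightarrow> 'o \<times> ('t \<Rightarrow> 'm)" where
  "hom_end V T C A B = (SOME (E, p). is_hom_end V T C A B E p)"

definition end_obj where "end_obj V T C A B = fst (hom_end V T C A B)"
definition end_proj where "end_proj V T C A B = snd (hom_end V T C A B)"

text \<open>The unique arrow \<open>X \<rightarrow> end_obj V T C A B\<close> with components \<open>q\<close>.\<close>

definition end_lift ::
  "('o, 'm) smc \<Rightarrow> ('t, 'o, 'm, 'y) vcat_scheme \<Rightarrow> ('c, 'o, 'm, 'z) vcat_scheme \<Rightarrow>
   ('t, 'c, 'm) vfun \<Rightarrow> ('t, 'c, 'm) vfun \<Rightarrow> 'o \<Rightarrow> ('t \<Rightarrow> 'm) \<Rightarrow> 'm" where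
  "end_lift V T C A B X q = (THE h. h \<in> hom V X (end_obj V T C A B) \<and>
     (\<forall>j\<in>VObj T. end_proj V T C A B j \<cdot>\<^bsub>V\<^esub> h = q j))"

definition admissible :: "('o, 'm) smc \<Rightarrow> 'o set \<Rightarrow> ('c, 'o, 'm) cvcat \<Rightarrow> bool" where
  "admissible V \<J> C \<longleftrightarrow> has_designated_cotensors V \<J> C \<and>
     (\<forall>T A B. is_theory V \<J> T \<longrightarrow> is_algebra V \<J> C T A \<longrightarrow> is_algebra V \<J> C T B \<longrightarrow>
        (\<exists>E p. is_hom_end V T C A B E p))"

text \<open>The pointwise cotensor \<open>[j, A]\<close>.\<close>

definition alg_cot ::
  "('o, 'm) smc \<Rightarrow> 'o set \<Rightarrow> ('c, 'o, 'm) cvcat \<Rightarrow> 'o \<Rightarrow> ('o, 'c, 'm) vfun \<Rightarrow> ('o, 'c, 'm) vfun" where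
  "alg_cot V \<J> C j A = \<lparr>FO = (\<lambda>k\<in>\<J>. Cot C j (FO A k)),
                        FA = ext2 \<J> (\<lambda>k l. cot_arr V C j (FO A k) (FO A l) \<cdot>\<^bsub>V\<^esub> FA A k l)\<rparr>"

definition TAlg ::
  "('o, 'm) smc \<Rightarrow> 'o set \<Rightarrow> ('c, 'o, 'm) cvcat \<Rightarrow> ('o, 'm) thy \<Rightarrow> (('o, 'c, 'm) vfun, 'o, 'm) cvcat" where
  "TAlg V \<J> C T = \<lparr>
     VObj = {A. is_algebra V \<J> C T A},
     VHom = end_obj V T C,
     VComp = (\<lambda>A B D. end_lift V T C A D (end_obj V T C B D \<otimes>\<^bsub>V\<^esub> end_obj V T C A B)
        (\<lambda>j. VComp C (FO A j) (FO B j) (FO D j) \<cdot>\<^bsub>V\<^esub> (end_proj V T C B D j \<boxtimes>\<^bsub>V\<^esub> end_proj V T C A B j))),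
     VId = (\<lambda>A. end_lift V T C A A (Unit V) (\<lambda>j. VId C (FO A j))),
     Cot = alg_cot V \<J> C,
     Cnt = (\<lambda>j A. end_lift V T C (alg_cot V \<J> C j A) A j (\<lambda>k. Cnt C j (FO A k)))\<rparr>"


section \<open>The category of algebras and strong morphisms\<close>

type_synonym ('o, 'c, 'm) alg = "('o, 'm) thy \<times> ('o, 'c, 'm) vfun"

record ('o, 'c, 'm) strong =
  Src :: "('o, 'c, 'm) alg"
  Tgt :: "('o, 'c, 'm) alg"
  MFun :: "('o, 'o, 'm) vfun"
  MNat :: "'o \<Rightarrow> 'm"

definition algebras :: "('o, 'm) smc \<Rightarrow> 'o set \<Rightarrow> ('c, 'o, 'm) cvcat \<Rightarrow> ('o, 'c, 'm) alg set" where
  "algebras V \<J> C = {(T, A). is_theory V \<J> T \<and> is_algebra V \<J> C T A}"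

definition alg_carrier :: "('o, 'm) smc \<Rightarrow> ('o, 'c, 'm) alg \<Rightarrow> 'c" where
  "alg_carrier V X = FO (snd X) (Unit V)"

definition strong_morphism ::
  "('o, 'm) smc \<Rightarrow> 'o set \<Rightarrow> ('c, 'o, 'm) cvcat \<Rightarrow> ('o, 'c, 'm) strong \<Rightarrow> bool" where
  "strong_morphism V \<J> C f \<longleftrightarrow> Src f \<in> algebras V \<J> C \<and> Tgt f \<in> algebras V \<J> C \<and>
     theory_morphism V \<J> (fst (Src f)) (fst (Tgt f)) (MFun f) \<and>
     vnat_iso V (fst (Src f)) C (snd (Src f)) (vfun_comp V \<J> (snd (Tgt f)) (MFun f)) (MNat f)"

definition under :: "('o, 'm) smc \<Rightarrow> ('o, 'c, 'm) strong \<Rightarrow> 'm" where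
  "under V f = MNat f (Unit V)"

text \<open>In the composite, the component at \<open>j\<close> of \<open>(g M) \<cdot> f\<close> is \<open>g\<^sub>M\<^sub>j \<cdot> f\<^sub>j\<close>, and \<open>M j = j\<close>.\<close>

definition Alg_s ::
  "('o, 'm) smc \<Rightarrow> 'o set \<Rightarrow> ('c, 'o, 'm) cvcat \<Rightarrow> (('o, 'c, 'm) alg, ('o, 'c, 'm) strong) cat" where
  "Alg_s V \<J> C = \<lparr>
     Obj = algebras V \<J> C,
     Arr = {f. strong_morphism V \<J> C f},
     Dom = Src,
     Cod = Tgt,
     Id = (\<lambda>X. \<lparr>Src = X, Tgt = X, MFun = vfun_id V (fst X), MNat = (\<lambda>j\<in>\<J>. VId C (FO (snd X) j))\<rparr>),
     Comp = (\<lambda>g f. \<lparr>Src = Src f, Tgt = Tgt g, MFun = vfun_comp V \<J> (MFun g) (MFun f),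
        MNat = (\<lambda>j\<in>\<J>. ucomp V C (FO (snd (Src f)) j) (FO (snd (Tgt f)) j) (FO (snd (Tgt g)) j)
                          (MNat g (FO (MFun f) j)) (MNat f j))\<rparr>)\<rparr>"

text \<open>The non-full subcategory on the algebras with carrier \<open>c\<close>.\<close>

definition Alg_on ::
  "('o, 'm) smc \<Rightarrow> 'o set \<Rightarrow> ('c, 'o, 'm) cvcat \<Rightarrow> 'c \<Rightarrow> (('o, 'c, 'm) alg, ('o, 'c, 'm) strong) cat" where
  "Alg_on V \<J> C c = (Alg_s V \<J> C)\<lparr>
     Obj := {X \<in> algebras V \<J> C. alg_carrier V X = c},
     Arr := {f \<in> Arr (Alg_s V \<J> C). alg_carrier V (Src f) = c \<and> alg_carrier V (Tgt f) = c \<and>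
                                      under V f = VId C c}\<rparr>"


section \<open>Commutants\<close>

text \<open>
  The theory with homs \<open>D([j,x], [k,x])\<close>. Its structure functor is \<open>[-, x]\<close>, whose action
  \<open>IHom k j \<rightarrow> D([j,x], [k,x])\<close> corresponds under \<open>D([j,x], [k,x]) \<cong> IHom k (D([j,x], x))\<close> to
  composition with the counit \<open>j \<rightarrow> D([j,x], x)\<close>.
\<close>

definition object_theory ::
  "('o, 'm) smc \<Rightarrow> 'o set \<Rightarrow> ('d, 'o, 'm) cvcat \<Rightarrow> 'd \<Rightarrow> ('o, 'm) thy" where
  "object_theory V \<J> D x = \<lparr>
     VObj = \<J>,
     VHom = ext2 \<J> (\<lambda>j k. VHom D (Cot D j x) (Cot D k x)),
     VComp = ext3 \<J> (\<lambda>j k l. VComp D (Cot D j x) (Cot D k x) (Cot D l x)),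
     VId = (\<lambda>j\<in>\<J>. VId D (Cot D j x)),
     Str = \<lparr>FO = (\<lambda>j\<in>\<J>. j),
            FA = ext2 \<J> (\<lambda>j k.
              inv_arr V (cot_cmp V D k x (Cot D k x) (Cnt D k x) (Cot D j x)) \<cdot>\<^bsub>V\<^esub>
              curr V (IHom V k j) k (VHom D (Cot D j x) x) (Cnt D j x \<cdot>\<^bsub>V\<^esub> Ev V k j))\<rparr>\<rparr>"

definition commutant ::
  "('o, 'm) smc \<Rightarrow> 'o set \<Rightarrow> ('c, 'o, 'm) cvcat \<Rightarrow> ('o, 'c, 'm) alg \<Rightarrow> ('o, 'c, 'm) alg" where
  "commutant V \<J> C X = (let T = fst X; A = snd X in
     (object_theory V \<J> (TAlg V \<J> C T) A,
      \<lparr>FO = (\<lambda>j\<in>\<J>. Cot C j (alg_carrier V X)),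
       FA = ext2 \<J> (\<lambda>j k. end_proj V T C (alg_cot V \<J> C j A) (alg_cot V \<J> C k A) (Unit V))\<rparr>))"

definition Com ::
  "('o, 'm) smc \<Rightarrow> 'o set \<Rightarrow> ('c, 'o, 'm) cvcat \<Rightarrow>
   (('o, 'c, 'm) alg, ('o, 'c, 'm) strong, ('o, 'c, 'm) alg, ('o, 'c, 'm) strong) ofun" where
  "Com V \<J> C = \<lparr>
     OFO = commutant V \<J> C,
     OFA = (\<lambda>f. THE g. g \<in> hom (Alg_s V \<J> C) (commutant V \<J> C (Tgt f)) (commutant V \<J> C (Src f)) \<and>
        uinverse V C (alg_carrier V (Src f)) (alg_carrier V (Tgt f)) (under V f) (under V g))\<rparr>"

definition com_unit ::
  "('o, 'm) smc \<Rightarrow> 'o set \<Rightarrow> ('c, 'o, 'm) cvcat \<Rightarrow> ('o, 'c, 'm) alg \<Rightarrow> ('o, 'c, 'm) strong" where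
  "com_unit V \<J> C X =
     (THE u. u \<in> hom (Alg_on V \<J> C (alg_carrier V X)) X (commutant V \<J> C (commutant V \<J> C X)))"

definition commutes_with ::
  "('o, 'm) smc \<Rightarrow> 'o set \<Rightarrow> ('c, 'o, 'm) cvcat \<Rightarrow> ('o, 'c, 'm) alg \<Rightarrow> ('o, 'c, 'm) alg \<Rightarrow> bool" where
  "commutes_with V \<J> C X Y \<longleftrightarrow>
     X \<in> Obj (Alg_on V \<J> C (alg_carrier V X)) \<and> Y \<in> Obj (Alg_on V \<J> C (alg_carrier V X)) \<and>
     (\<exists>f. f \<in> hom (Alg_on V \<J> C (alg_carrier V X)) Y (commutant V \<J> C X))"

definition commutative ::
  "('o, 'm) smc \<Rightarrow> 'o set \<Rightarrow> ('c, 'o, 'm) cvcat \<Rightarrow> ('o, 'c, 'm) alg \<Rightarrow> bool" where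
  "commutative V \<J> C X \<longleftrightarrow> commutes_with V \<J> C X X"

definition contracommutative ::
  "('o, 'm) smc \<Rightarrow> 'o set \<Rightarrow> ('c, 'o, 'm) cvcat \<Rightarrow> ('o, 'c, 'm) alg \<Rightarrow> bool" where
  "contracommutative V \<J> C X \<longleftrightarrow> commutative V \<J> C (commutant V \<J> C X)"

definition saturated ::
  "('o, 'm) smc \<Rightarrow> 'o set \<Rightarrow> ('c, 'o, 'm) cvcat \<Rightarrow> ('o, 'c, 'm) alg \<Rightarrow> bool" where
  "saturated V \<J> C X \<longleftrightarrow> iso (Alg_s V \<J> C) (com_unit V \<J> C X)"

definition CAlg_s where
  "CAlg_s V \<J> C = full_subcat (Alg_s V \<J> C) (commutative V \<J> C)"

definition CoCAlg_s where
  "CoCAlg_s V \<J> C = full_subcat (Alg_s V \<J> C) (contracommutative V \<J> C)"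

definition SatCAlg_s where
  "SatCAlg_s V \<J> C = full_subcat (Alg_s V \<J> C) (\<lambda>X. saturated V \<J> C X \<and> commutative V \<J> C X)"

definition SatCoCAlg_s where
  "SatCoCAlg_s V \<J> C = full_subcat (Alg_s V \<J> C) (\<lambda>X. saturated V \<J> C X \<and> contracommutative V \<J> C X)"

end

theory Submission imports Defs begin

text \<open>
  A strong morphism into a commutant is determined by its underlying isomorphism, because homomorphisms
  of algebras are determined by their component at \<open>I\<close>. So all equations between such morphisms hold
  as soon as they hold for the underlying isomorphisms, and only existence is at stake. Everything needed
  follows from one symmetry: a morphism \<open>X \<rightarrow> Y\<^sup>\<bottom>\<close> over \<open>\<phi>\<close> yields a morphism \<open>Y \<rightarrow> X\<^sup>\<bottom>\<close> over the inverse of \<open>\<phi>\<close>.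
  Applied to the identity of \<open>X\<^sup>\<bottom>\<close> it gives the unit \<open>u\<close>, and applied to the composite of \<open>f : X \<rightarrow> Y\<close> and \<open>u\<close>
  it gives \<open>f\<^sup>\<bottom>\<close>. The restrictions to commutative and saturated algebras are then formal.
\<close>

section \<open>Coherence in a symmetric monoidal closed category\<close>

text \<open>Commutation is a family of squares with two independent gradings, one by the operations
  of each theory. The symmetry is true because the two gradings can be exchanged: the symmetry
  constraint of V is involutive. Two obstacles shape the proof. Hom-objects are objects of V without
  elements, so equations are tested on arrows from an arbitrary object into a hom-object, and
  cotensors are restated as unique factorisation of such arrows; Yoneda arguments then replace most
  manipulations of transposes. Further, an algebra preserves cotensors only up to isomorphism,
  whereas a commutant is built from designated ones: \<open>FO A j\<close> is merely some cotensor
  \<open>[j, A I]\<close>. Comparison isomorphisms between iterated cotensors over two different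
  algebras therefore have to be constructed and proved natural. The interchange of
  \<open>[j, [n, c]]\<close> and \<open>[n, [j, c]]\<close> behind them enters as the statement that
  \<open>[j, -]\<close> preserves cotensors.\<close>

locale smcc =
  fixes V :: "('o, 'm) smc" (structure)
  assumes smcc: "symmetric_monoidal_closed V"
begin

lemma sm: "symmetric_monoidal V"
  using smcc by (simp add: symmetric_monoidal_closed_def)

lemma cat_V: "category V"
  using sm by (simp add: symmetric_monoidal_def)

lemma hom_V [simp]: "f \<in> hom V a b \<longleftrightarrow> f \<in> Arr V \<and> Dom V f = a \<and> Cod V f = b"
  by (simp add: hom_def)

lemma dom_cod_obj [simp]: "f \<in> Arr V \<Longrightarrow> Dom V f \<in> Obj V" "f \<in> Arr V \<Longrightarrow> Cod V f \<in> Obj V"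
  using cat_V by (auto simp: category_def)

lemma id_V [simp]:
  assumes "a \<in> Obj V"
  shows "Id V a \<in> Arr V" "Dom V (Id V a) = a" "Cod V (Id V a) = a"
  using cat_V assms by (auto simp: category_def)

lemma comp_V [simp]:
  assumes "f \<in> Arr V" "g \<in> Arr V" "Dom V g = Cod V f"
  shows "g \<cdot> f \<in> Arr V" "Dom V (g \<cdot> f) = Dom V f" "Cod V (g \<cdot> f) = Cod V g"
  using cat_V assms unfolding category_def hom_V by blast+

lemma comp_ide [simp]: "f \<in> Arr V \<Longrightarrow> Dom V f = a \<Longrightarrow> f \<cdot> Id V a = f"
  using cat_V unfolding category_def hom_V by blast

lemma ide_comp [simp]: "f \<in> Arr V \<Longrightarrow> Cod V f = a \<Longrightarrow> Id V a \<cdot> f = f"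
  using cat_V unfolding category_def hom_V by blast

lemma comp_assoc [simp]:
  assumes "f \<in> Arr V" "g \<in> Arr V" "h \<in> Arr V" "Dom V g = Cod V f" "Dom V h = Cod V g"
  shows "(h \<cdot> g) \<cdot> f = h \<cdot> g \<cdot> f"
  using cat_V[unfolded category_def, THEN conjunct2, THEN conjunct2, THEN conjunct2, THEN conjunct2,
    rule_format, of f "Dom V f" "Cod V f" g "Cod V g" h "Cod V h"] assms
  by simp

text \<open>\<open>comp_assoc\<close> nests composites to the right, which hides
  \<open>g \<cdot> f\<close> as soon as a further arrow comes before it. This form lets an equation
  for the pair act at the head of a longer composite.\<close>

lemma comp_ext:
  assumes "g \<cdot> f = k" "f \<in> Arr V" "g \<in> Arr V" "z \<in> Arr V" "Dom V g = Cod V f" "Dom V f = Cod V z"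
  shows "g \<cdot> f \<cdot> z = k \<cdot> z"
  using assms comp_assoc by metis

lemma inverse_arrows_unique:
  assumes "inverse_arrows V f g" "inverse_arrows V f h"
  shows "g = h"
proof -
  have "(g \<cdot> f) \<cdot> h = g \<cdot> f \<cdot> h"
    using assms unfolding inverse_arrows_def hom_V by (intro comp_assoc) auto
  thus ?thesis using assms by (simp add: inverse_arrows_def del: comp_assoc)
qed

lemma inv_arr:
  assumes "iso V f"
  shows "inverse_arrows V f (inv_arr V f)"
  using assms inverse_arrows_unique unfolding iso_def inv_arr_def by (metis theI)

lemma iso_arr: "iso V f \<Longrightarrow> f \<in> Arr V"
  by (auto simp: iso_def inverse_arrows_def)

lemma inv_arr_V [simp]:
  assumes "iso V f"
  shows "inv_arr V f \<in> Arr V" "Dom V (inv_arr V f) = Cod V f" "Cod V (inv_arr V f) = Dom V f"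
    "inv_arr V f \<cdot> f = Id V (Dom V f)" "f \<cdot> inv_arr V f = Id V (Cod V f)"
  using inv_arr[OF assms] by (auto simp: inverse_arrows_def)

lemma inv_arr_ext [simp]:
  assumes "iso V f" "z \<in> Arr V"
  shows "Cod V z = Dom V f \<Longrightarrow> inv_arr V f \<cdot> f \<cdot> z = z" "Cod V z = Cod V f \<Longrightarrow> f \<cdot> inv_arr V f \<cdot> z = z"
  using assms iso_arr comp_ext inv_arr_V by (metis ide_comp)+

lemma isoI:
  assumes "f \<in> Arr V" "g \<in> Arr V" "Dom V g = Cod V f" "Cod V g = Dom V f"
    "g \<cdot> f = Id V (Dom V f)" "f \<cdot> g = Id V (Cod V f)"
  shows "iso V f"
  using assms by (auto simp: iso_def inverse_arrows_def)

lemma iso_monic: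
  assumes "iso V h" "h \<cdot> f = h \<cdot> g" "f \<in> Arr V" "g \<in> Arr V" "Dom V h = Cod V f" "Dom V h = Cod V g"
  shows "f = g"
  by (metis assms inv_arr_ext(1))

lemma iso_epic:
  assumes "iso V h" "f \<cdot> h = g \<cdot> h" "f \<in> Arr V" "g \<in> Arr V" "Dom V f = Cod V h" "Dom V g = Cod V h"
  shows "f = g"
proof -
  have "f = (f \<cdot> h) \<cdot> inv_arr V h" using assms(1,3,5) iso_arr by simp
  also have "\<dots> = (g \<cdot> h) \<cdot> inv_arr V h" by (simp only: assms(2))
  also have "\<dots> = g" using assms(1,4,6) iso_arr by simp
  finally show ?thesis .
qed

lemma unit_obj [simp]: "Unit V \<in> Obj V"
  using sm by (simp add: symmetric_monoidal_def)

lemma ten_obj [simp]: "a \<in> Obj V \<Longrightarrow> b \<in> Obj V \<Longrightarrow> a \<otimes> b \<in> Obj V"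
  using sm by (simp add: symmetric_monoidal_def)

lemma ten_arr [simp]:
  assumes "f \<in> Arr V" "g \<in> Arr V"
  shows "f \<boxtimes> g \<in> Arr V" "Dom V (f \<boxtimes> g) = Dom V f \<otimes> Dom V g" "Cod V (f \<boxtimes> g) = Cod V f \<otimes> Cod V g"
  using sm[unfolded symmetric_monoidal_def, THEN conjunct2, THEN conjunct2, THEN conjunct2, THEN conjunct1,
      rule_format, of f "Dom V f" "Cod V f" g "Dom V g" "Cod V g"] assms
  by auto

lemma ten_id [simp]: "a \<in> Obj V \<Longrightarrow> b \<in> Obj V \<Longrightarrow> Id V a \<boxtimes> Id V b = Id V (a \<otimes> b)"
  using sm by (simp add: symmetric_monoidal_def)

lemma ten_comp:
  assumes "f \<in> Arr V" "g \<in> Arr V" "Dom V g = Cod V f" "f' \<in> Arr V" "g' \<in> Arr V" "Dom V g' = Cod V f'"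
  shows "(g \<boxtimes> g') \<cdot> (f \<boxtimes> f') = (g \<cdot> f) \<boxtimes> (g' \<cdot> f')"
  using assms sm[unfolded symmetric_monoidal_def, THEN conjunct2, THEN conjunct2, THEN conjunct2, THEN conjunct2, THEN conjunct2, THEN conjunct1, rule_format, of f "Dom V f" "Cod V f" g "Cod V g" f' "Dom V f'" "Cod V f'" g' "Cod V g'"]
  by simp

lemma ten_comp_ext:
  assumes "f \<in> Arr V" "g \<in> Arr V" "Dom V g = Cod V f" "f' \<in> Arr V" "g' \<in> Arr V" "Dom V g' = Cod V f'"
    "z \<in> Arr V" "Cod V z = Dom V f \<otimes> Dom V f'"
  shows "(g \<boxtimes> g') \<cdot> (f \<boxtimes> f') \<cdot> z = ((g \<cdot> f) \<boxtimes> (g' \<cdot> f')) \<cdot> z"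
  using assms by (intro comp_ext ten_comp) auto

lemma assoc_V [simp]:
  assumes "a \<in> Obj V" "b \<in> Obj V" "c \<in> Obj V"
  shows "Assoc V a b c \<in> Arr V" "Dom V (Assoc V a b c) = (a \<otimes> b) \<otimes> c"
    "Cod V (Assoc V a b c) = a \<otimes> b \<otimes> c" "iso V (Assoc V a b c)"
  using sm assms by (simp_all add: symmetric_monoidal_def)

lemma lunit_V [simp]:
  assumes "a \<in> Obj V"
  shows "LUnit V a \<in> Arr V" "Dom V (LUnit V a) = Unit V \<otimes> a" "Cod V (LUnit V a) = a" "iso V (LUnit V a)"
  using sm assms by (simp_all add: symmetric_monoidal_def)

lemma runit_V [simp]:
  assumes "a \<in> Obj V"
  shows "RUnit V a \<in> Arr V" "Dom V (RUnit V a) = a \<otimes> Unit V" "Cod V (RUnit V a) = a" "iso V (RUnit V a)"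
  using sm assms by (simp_all add: symmetric_monoidal_def)

lemma sym_V [simp]:
  assumes "a \<in> Obj V" "b \<in> Obj V"
  shows "Sym V a b \<in> Arr V" "Dom V (Sym V a b) = a \<otimes> b" "Cod V (Sym V a b) = b \<otimes> a"
    "Sym V b a \<cdot> Sym V a b = Id V (a \<otimes> b)"
  using sm assms by (simp_all add: symmetric_monoidal_def)

lemma sym_iso [simp]: "a \<in> Obj V \<Longrightarrow> b \<in> Obj V \<Longrightarrow> iso V (Sym V a b)"
  by (rule isoI[of _ "Sym V b a"]) auto

lemma sym_ext [simp]:
  "a \<in> Obj V \<Longrightarrow> b \<in> Obj V \<Longrightarrow> z \<in> Arr V \<Longrightarrow> Cod V z = a \<otimes> b \<Longrightarrow> Sym V b a \<cdot> Sym V a b \<cdot> z = z"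
  using comp_ext[OF sym_V(4)] by simp

lemma assoc_nat:
  assumes "f \<in> Arr V" "g \<in> Arr V" "h \<in> Arr V" "a' = Cod V f" "b' = Cod V g" "c' = Cod V h"
  shows "Assoc V a' b' c' \<cdot> ((f \<boxtimes> g) \<boxtimes> h) = (f \<boxtimes> (g \<boxtimes> h)) \<cdot> Assoc V (Dom V f) (Dom V g) (Dom V h)"
  using assms sm[unfolded symmetric_monoidal_def, THEN conjunct2, THEN conjunct2, THEN conjunct2, THEN conjunct2, THEN conjunct2, THEN conjunct2, THEN conjunct2, THEN conjunct2, THEN conjunct2, THEN conjunct2, THEN conjunct1, rule_format, of f "Dom V f" a' g "Dom V g" b' h "Dom V h" c']
  by simp

lemma lunit_nat:
  assumes "f \<in> Arr V" "b = Cod V f"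
  shows "LUnit V b \<cdot> (Id V (Unit V) \<boxtimes> f) = f \<cdot> LUnit V (Dom V f)"
  using assms sm[unfolded symmetric_monoidal_def, THEN conjunct2, THEN conjunct2, THEN conjunct2, THEN conjunct2, THEN conjunct2, THEN conjunct2, THEN conjunct2, THEN conjunct2, THEN conjunct2, THEN conjunct2, THEN conjunct2, THEN conjunct1, rule_format, of f "Dom V f" b]
  by simp

lemma runit_nat:
  assumes "f \<in> Arr V" "b = Cod V f"
  shows "RUnit V b \<cdot> (f \<boxtimes> Id V (Unit V)) = f \<cdot> RUnit V (Dom V f)"
  using assms sm[unfolded symmetric_monoidal_def, THEN conjunct2, THEN conjunct2, THEN conjunct2, THEN conjunct2, THEN conjunct2, THEN conjunct2, THEN conjunct2, THEN conjunct2, THEN conjunct2, THEN conjunct2, THEN conjunct2, THEN conjunct2, THEN conjunct1, rule_format, of f "Dom V f" b]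
  by simp

lemma sym_nat:
  assumes "f \<in> Arr V" "g \<in> Arr V" "a' = Cod V f" "b' = Cod V g"
  shows "Sym V a' b' \<cdot> (f \<boxtimes> g) = (g \<boxtimes> f) \<cdot> Sym V (Dom V f) (Dom V g)"
  using assms sm[unfolded symmetric_monoidal_def, THEN conjunct2, THEN conjunct2, THEN conjunct2, THEN conjunct2, THEN conjunct2, THEN conjunct2, THEN conjunct2, THEN conjunct2, THEN conjunct2, THEN conjunct2, THEN conjunct2, THEN conjunct2, THEN conjunct2, THEN conjunct1, rule_format, of f "Dom V f" a' g "Dom V g" b']
  by simp

lemma pentagon:
  assumes "a \<in> Obj V" "b \<in> Obj V" "c \<in> Obj V" "d \<in> Obj V"
  shows "Assoc V a b (c \<otimes> d) \<cdot> Assoc V (a \<otimes> b) c d =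
    (Id V a \<boxtimes> Assoc V b c d) \<cdot> Assoc V a (b \<otimes> c) d \<cdot> (Assoc V a b c \<boxtimes> Id V d)"
  using sm assms by (simp add: symmetric_monoidal_def)

lemma triangle:
  assumes "a \<in> Obj V" "b \<in> Obj V"
  shows "(Id V a \<boxtimes> LUnit V b) \<cdot> Assoc V a (Unit V) b = RUnit V a \<boxtimes> Id V b"
  using sm assms by (simp add: symmetric_monoidal_def)

lemma hexagon:
  assumes "a \<in> Obj V" "b \<in> Obj V" "c \<in> Obj V"
  shows "Assoc V b c a \<cdot> Sym V a (b \<otimes> c) \<cdot> Assoc V a b c =
    (Id V b \<boxtimes> Sym V a c) \<cdot> Assoc V b a c \<cdot> (Sym V a b \<boxtimes> Id V c)"
  using sm assms by (simp add: symmetric_monoidal_def)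

section \<open>Unit coherence derived from the pentagon, the triangle and the hexagon\<close>

lemma ten_unit_faithful:
  assumes "f \<boxtimes> Id V (Unit V) = g \<boxtimes> Id V (Unit V)" "f \<in> Arr V" "g \<in> Arr V" "Cod V f = Cod V g"
    "Dom V f = Dom V g"
  shows "f = g"
proof (rule iso_epic)
  show "iso V (RUnit V (Dom V f))" using assms by simp
  show "f \<cdot> RUnit V (Dom V f) = g \<cdot> RUnit V (Dom V f)"
    using assms runit_nat[of f "Cod V f"] runit_nat[of g "Cod V f"] by metis
qed (use assms in auto)

lemma unit_ten_faithful:
  assumes "Id V (Unit V) \<boxtimes> f = Id V (Unit V) \<boxtimes> g" "f \<in> Arr V" "g \<in> Arr V" "Cod V f = Cod V g"
    "Dom V f = Dom V g"
  shows "f = g"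
proof (rule iso_epic)
  show "iso V (LUnit V (Dom V f))" using assms by simp
  show "f \<cdot> LUnit V (Dom V f) = g \<cdot> LUnit V (Dom V f)"
    using assms lunit_nat[of f "Cod V f"] lunit_nat[of g "Cod V f"] by metis
qed (use assms in auto)

lemma ten_iso [simp]:
  assumes "iso V f" "iso V g"
  shows "iso V (f \<boxtimes> g)"
  by (rule isoI[of _ "inv_arr V f \<boxtimes> inv_arr V g"]) (use assms iso_arr in \<open>auto simp: ten_comp\<close>)

lemma ide_iso [simp]: "a \<in> Obj V \<Longrightarrow> iso V (Id V a)"
  by (rule isoI[of _ "Id V a"]) auto

text \<open>\<open>RUnit\<close> is a natural isomorphism, so tensoring with \<open>I\<close> is
  faithful and the equation may be tested there. The pentagon for \<open>a\<close>,
  \<open>b\<close>, \<open>I\<close>, \<open>I\<close> and two triangles then give it; this is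
  Kelly's argument.\<close>

lemma runit_ten:
  assumes [simp]: "a \<in> Obj V" "b \<in> Obj V"
  shows "(Id V a \<boxtimes> RUnit V b) \<cdot> Assoc V a b (Unit V) = RUnit V (a \<otimes> b)"
proof (rule ten_unit_faithful)
  let ?I = "Unit V" and ?r = "(Id V a \<boxtimes> RUnit V b) \<cdot> Assoc V a b (Unit V)"
  have "Assoc V a b ?I \<cdot> (?r \<boxtimes> Id V ?I)
      = (Assoc V a b ?I \<cdot> ((Id V a \<boxtimes> RUnit V b) \<boxtimes> Id V ?I)) \<cdot> (Assoc V a b ?I \<boxtimes> Id V ?I)"
    by (simp add: ten_comp)
  also have "\<dots> = (Id V a \<boxtimes> (RUnit V b \<boxtimes> Id V ?I)) \<cdot> Assoc V a (b \<otimes> ?I) ?I \<cdot> (Assoc V a b ?I \<boxtimes> Id V ?I)"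
    by (subst assoc_nat) auto
  also have "\<dots> = (Id V a \<boxtimes> (Id V b \<boxtimes> LUnit V ?I)) \<cdot> (Id V a \<boxtimes> Assoc V b ?I ?I) \<cdot> Assoc V a (b \<otimes> ?I) ?I
      \<cdot> (Assoc V a b ?I \<boxtimes> Id V ?I)"
    by (subst triangle[symmetric]) (simp_all add: ten_comp_ext)
  also have "\<dots> = (Id V a \<boxtimes> (Id V b \<boxtimes> LUnit V ?I)) \<cdot> Assoc V a b (?I \<otimes> ?I) \<cdot> Assoc V (a \<otimes> b) ?I ?I"
    by (subst pentagon) auto
  also have "\<dots> = (Assoc V a b ?I \<cdot> ((Id V a \<boxtimes> Id V b) \<boxtimes> LUnit V ?I)) \<cdot> Assoc V (a \<otimes> b) ?I ?I"
    by (subst assoc_nat) auto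
  also have "\<dots> = Assoc V a b ?I \<cdot> (RUnit V (a \<otimes> b) \<boxtimes> Id V ?I)"
    by (subst triangle[symmetric]) auto
  finally show "?r \<boxtimes> Id V ?I = RUnit V (a \<otimes> b) \<boxtimes> Id V ?I"
    by (rule iso_monic[rotated]) auto
qed auto

text \<open>The mirror image, with the pentagon for \<open>I\<close>, \<open>I\<close>,
  \<open>a\<close>, \<open>b\<close>. The invertible arrow \<open>?w\<close> of associators is
  carried along on the right and cancelled at the end.\<close>

lemma lunit_ten:
  assumes [simp]: "a \<in> Obj V" "b \<in> Obj V"
  shows "LUnit V (a \<otimes> b) \<cdot> Assoc V (Unit V) a b = LUnit V a \<boxtimes> Id V b"
proof (rule unit_ten_faithful)
  let ?I = "Unit V" and ?l = "LUnit V (a \<otimes> b) \<cdot> Assoc V (Unit V) a b"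
  let ?w = "Assoc V ?I (?I \<otimes> a) b \<cdot> (Assoc V ?I ?I a \<boxtimes> Id V b)"
  have "(Id V ?I \<boxtimes> ?l) \<cdot> ?w = (Id V ?I \<boxtimes> LUnit V (a \<otimes> b)) \<cdot> (Id V ?I \<boxtimes> Assoc V ?I a b) \<cdot> ?w"
    by (simp add: ten_comp_ext)
  also have "\<dots> = (Id V ?I \<boxtimes> LUnit V (a \<otimes> b)) \<cdot> Assoc V ?I ?I (a \<otimes> b) \<cdot> Assoc V (?I \<otimes> ?I) a b"
    by (subst pentagon) auto
  also have "\<dots> = (RUnit V ?I \<boxtimes> (Id V a \<boxtimes> Id V b)) \<cdot> Assoc V (?I \<otimes> ?I) a b"
    by (subst comp_ext[OF triangle]) auto
  also have "\<dots> = Assoc V ?I a b \<cdot> ((RUnit V ?I \<boxtimes> Id V a) \<boxtimes> Id V b)"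
    by (subst assoc_nat) auto
  also have "\<dots> = (Assoc V ?I a b \<cdot> ((Id V ?I \<boxtimes> LUnit V a) \<boxtimes> Id V b)) \<cdot> (Assoc V ?I ?I a \<boxtimes> Id V b)"
    by (subst triangle[symmetric]) (auto simp: ten_comp)
  also have "\<dots> = (Id V ?I \<boxtimes> (LUnit V a \<boxtimes> Id V b)) \<cdot> ?w"
    by (subst assoc_nat) auto
  finally show "Id V ?I \<boxtimes> ?l = Id V ?I \<boxtimes> (LUnit V a \<boxtimes> Id V b)"
  proof (rule iso_epic[rotated])
    show "iso V ?w"
      by (rule isoI[of _ "(inv_arr V (Assoc V ?I ?I a) \<boxtimes> Id V b) \<cdot> inv_arr V (Assoc V ?I (?I \<otimes> a) b)"])
        (auto simp: ten_comp ten_comp_ext)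
  qed auto
qed auto

text \<open>Naturality of \<open>LUnit\<close> at itself, with \<open>LUnit\<close> cancelled, gives
  \<open>LUnit V (I \<otimes> I) = Id V I \<boxtimes> LUnit V I\<close>. Then
  \<open>lunit_ten\<close> and the triangle describe the same composite with the associator.\<close>

lemma lunit_unit: "LUnit V (Unit V) = RUnit V (Unit V)"
proof (rule ten_unit_faithful)
  let ?I = "Unit V"
  have eq: "LUnit V ?I \<cdot> (Id V ?I \<boxtimes> LUnit V ?I) = LUnit V ?I \<cdot> LUnit V (?I \<otimes> ?I)"
    using lunit_nat[of "LUnit V ?I" ?I] by simp
  have "LUnit V (?I \<otimes> ?I) = Id V ?I \<boxtimes> LUnit V ?I"
    by (rule iso_monic[OF _ eq[symmetric]]) auto
  thus "LUnit V ?I \<boxtimes> Id V ?I = RUnit V ?I \<boxtimes> Id V ?I"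
    using lunit_ten[of ?I ?I] triangle[of ?I ?I] by simp
qed auto

text \<open>The hexagon for \<open>a\<close>, \<open>I\<close>, \<open>I\<close> reduces the
  comparison to left unit constraints, where \<open>lunit_ten\<close> and the triangle apply. Both
  sides appear behind \<open>Sym V a I\<close>, which is cancelled.\<close>

lemma lunit_sym:
  assumes [simp]: "a \<in> Obj V"
  shows "LUnit V a \<cdot> Sym V a (Unit V) = RUnit V a"
proof (rule ten_unit_faithful)
  let ?I = "Unit V"
  have "Sym V a ?I \<cdot> (RUnit V a \<boxtimes> Id V ?I) = (Sym V a ?I \<cdot> (Id V a \<boxtimes> LUnit V ?I)) \<cdot> Assoc V a ?I ?I"
    by (subst triangle[symmetric]) auto
  also have "\<dots> = (LUnit V ?I \<boxtimes> Id V a) \<cdot> Sym V a (?I \<otimes> ?I) \<cdot> Assoc V a ?I ?I"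
    by (subst sym_nat) auto
  also have "\<dots> = LUnit V (?I \<otimes> a) \<cdot> Assoc V ?I ?I a \<cdot> Sym V a (?I \<otimes> ?I) \<cdot> Assoc V a ?I ?I"
    by (subst lunit_ten[symmetric]) auto
  also have "\<dots> = (LUnit V (?I \<otimes> a) \<cdot> (Id V ?I \<boxtimes> Sym V a ?I)) \<cdot> Assoc V ?I a ?I \<cdot> (Sym V a ?I \<boxtimes> Id V ?I)"
    by (subst hexagon) auto
  also have "\<dots> = Sym V a ?I \<cdot> (LUnit V (a \<otimes> ?I) \<cdot> Assoc V ?I a ?I) \<cdot> (Sym V a ?I \<boxtimes> Id V ?I)"
    by (subst lunit_nat) auto
  also have "\<dots> = Sym V a ?I \<cdot> ((LUnit V a \<cdot> Sym V a ?I) \<boxtimes> Id V ?I)"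
    by (subst lunit_ten) (auto simp: ten_comp)
  finally have eq: "Sym V a ?I \<cdot> (RUnit V a \<boxtimes> Id V ?I)
    = Sym V a ?I \<cdot> ((LUnit V a \<cdot> Sym V a ?I) \<boxtimes> Id V ?I)" .
  show "(LUnit V a \<cdot> Sym V a ?I) \<boxtimes> Id V ?I = RUnit V a \<boxtimes> Id V ?I"
    by (rule iso_monic[OF _ eq[symmetric]]) auto
qed auto

lemma runit_sym:
  assumes [simp]: "a \<in> Obj V"
  shows "RUnit V a \<cdot> Sym V (Unit V) a = LUnit V a"
  by (subst lunit_sym[symmetric]) auto

section \<open>The closed structure: transposes and their uniqueness\<close>

lemma closed:
  assumes "a \<in> Obj V" "b \<in> Obj V"
  shows "IHom V a b \<in> Obj V" "Ev V a b \<in> Arr V" "Dom V (Ev V a b) = IHom V a b \<otimes> a" "Cod V (Ev V a b) = b"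
    "x \<in> Obj V \<Longrightarrow> f \<in> Arr V \<Longrightarrow> Dom V f = x \<otimes> a \<Longrightarrow> Cod V f = b \<Longrightarrow>
      \<exists>!g. g \<in> hom V x (IHom V a b) \<and> Ev V a b \<cdot> (g \<boxtimes> Id V a) = f"
  using smcc[unfolded symmetric_monoidal_closed_def, THEN conjunct2, rule_format, OF assms]
  unfolding hom_V by simp_all

declare closed(1-4) [simp]

lemma curr:
  assumes "x \<in> Obj V" "a \<in> Obj V" "f \<in> Arr V" "Dom V f = x \<otimes> a" "Cod V f = b"
  shows "curr V x a b f \<in> Arr V" "Dom V (curr V x a b f) = x" "Cod V (curr V x a b f) = IHom V a b"
    "Ev V a b \<cdot> (curr V x a b f \<boxtimes> Id V a) = f"
proof -
  have "b \<in> Obj V" using assms dom_cod_obj by blast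
  from theI'[OF closed(5)[OF assms(2) this assms(1,3-5)]]
  show "curr V x a b f \<in> Arr V" "Dom V (curr V x a b f) = x" "Cod V (curr V x a b f) = IHom V a b"
    "Ev V a b \<cdot> (curr V x a b f \<boxtimes> Id V a) = f"
    unfolding curr_def hom_V by auto
qed

declare curr [simp]

lemma ev_inject:
  assumes "Ev V a b \<cdot> (g \<boxtimes> Id V a) = Ev V a b \<cdot> (h \<boxtimes> Id V a)" "a \<in> Obj V" "b \<in> Obj V"
    "g \<in> Arr V" "h \<in> Arr V" "Cod V g = IHom V a b" "Cod V h = IHom V a b" "Dom V g = Dom V h"
  shows "g = h"
proof -
  let ?P = "\<lambda>k. k \<in> hom V (Dom V g) (IHom V a b) \<and> Ev V a b \<cdot> (k \<boxtimes> Id V a) = Ev V a b \<cdot> (g \<boxtimes> Id V a)"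
  have "\<exists>!k. ?P k" using assms by (intro closed(5)) simp_all
  moreover have "?P g" "?P h" using assms by simp_all
  ultimately show ?thesis by blast
qed

lemma curr_comp:
  assumes "x \<in> Obj V" "a \<in> Obj V" "f \<in> Arr V" "Dom V f = x \<otimes> a" "Cod V f = b" "v \<in> Arr V" "Cod V v = x"
  shows "curr V x a b f \<cdot> v = curr V (Dom V v) a b (f \<cdot> (v \<boxtimes> Id V a))"
proof (rule ev_inject)
  have "Ev V a b \<cdot> ((curr V x a b f \<cdot> v) \<boxtimes> Id V a) = Ev V a b \<cdot> (curr V x a b f \<boxtimes> Id V a) \<cdot> (v \<boxtimes> Id V a)"
    using assms by (auto simp: ten_comp)
  also have "\<dots> = f \<cdot> (v \<boxtimes> Id V a)"
    using assms by (subst comp_ext[OF curr(4)]) auto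
  finally show "Ev V a b \<cdot> ((curr V x a b f \<cdot> v) \<boxtimes> Id V a) = Ev V a b \<cdot> (curr V (Dom V v) a b (f \<cdot> (v \<boxtimes> Id V a)) \<boxtimes> Id V a)"
    using assms by auto
qed (use assms in auto)

section \<open>Unit coherence for the inverse constraints\<close>

lemma lunit_ten_inv:
  assumes [simp]: "a \<in> Obj V" "b \<in> Obj V"
  shows "Assoc V (Unit V) a b \<cdot> (inv_arr V (LUnit V a) \<boxtimes> Id V b) = inv_arr V (LUnit V (a \<otimes> b))"
proof (rule iso_monic)
  show "LUnit V (a \<otimes> b) \<cdot> Assoc V (Unit V) a b \<cdot> (inv_arr V (LUnit V a) \<boxtimes> Id V b)
      = LUnit V (a \<otimes> b) \<cdot> inv_arr V (LUnit V (a \<otimes> b))"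
    by (subst comp_ext[OF lunit_ten]) (auto simp: ten_comp)
qed auto

lemma runit_ten_inv:
  assumes [simp]: "a \<in> Obj V" "b \<in> Obj V"
  shows "Assoc V a b (Unit V) \<cdot> inv_arr V (RUnit V (a \<otimes> b)) = Id V a \<boxtimes> inv_arr V (RUnit V b)"
proof (rule iso_monic)
  show "(Id V a \<boxtimes> RUnit V b) \<cdot> Assoc V a b (Unit V) \<cdot> inv_arr V (RUnit V (a \<otimes> b))
      = (Id V a \<boxtimes> RUnit V b) \<cdot> (Id V a \<boxtimes> inv_arr V (RUnit V b))"
    by (subst comp_ext[OF runit_ten]) (auto simp: ten_comp)
qed auto

lemma triangle_inv:
  assumes [simp]: "a \<in> Obj V" "b \<in> Obj V"
  shows "Assoc V a (Unit V) b \<cdot> (inv_arr V (RUnit V a) \<boxtimes> Id V b) = Id V a \<boxtimes> inv_arr V (LUnit V b)"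
proof (rule iso_monic)
  show "(Id V a \<boxtimes> LUnit V b) \<cdot> Assoc V a (Unit V) b \<cdot> (inv_arr V (RUnit V a) \<boxtimes> Id V b)
      = (Id V a \<boxtimes> LUnit V b) \<cdot> (Id V a \<boxtimes> inv_arr V (LUnit V b))"
    by (subst comp_ext[OF triangle]) (auto simp: ten_comp)
qed auto

lemma lunit_inv_nat:
  assumes "v \<in> Arr V" "b = Cod V v"
  shows "inv_arr V (LUnit V b) \<cdot> v = (Id V (Unit V) \<boxtimes> v) \<cdot> inv_arr V (LUnit V (Dom V v))"
proof (rule iso_monic)
  show "LUnit V b \<cdot> inv_arr V (LUnit V b) \<cdot> v
      = LUnit V b \<cdot> (Id V (Unit V) \<boxtimes> v) \<cdot> inv_arr V (LUnit V (Dom V v))"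
    using assms by (subst comp_ext[OF lunit_nat]) auto
qed (use assms in auto)

lemma runit_inv_nat:
  assumes "v \<in> Arr V" "b = Cod V v"
  shows "inv_arr V (RUnit V b) \<cdot> v = (v \<boxtimes> Id V (Unit V)) \<cdot> inv_arr V (RUnit V (Dom V v))"
proof (rule iso_monic)
  show "RUnit V b \<cdot> inv_arr V (RUnit V b) \<cdot> v
      = RUnit V b \<cdot> (v \<boxtimes> Id V (Unit V)) \<cdot> inv_arr V (RUnit V (Dom V v))"
    using assms by (subst comp_ext[OF runit_nat]) auto
qed (use assms in auto)

lemma sym_runit_inv:
  assumes [simp]: "a \<in> Obj V"
  shows "Sym V a (Unit V) \<cdot> inv_arr V (RUnit V a) = inv_arr V (LUnit V a)"
proof (rule iso_monic)
  show "LUnit V a \<cdot> Sym V a (Unit V) \<cdot> inv_arr V (RUnit V a) = LUnit V a \<cdot> inv_arr V (LUnit V a)"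
    by (subst comp_ext[OF lunit_sym]) auto
qed auto

end

section \<open>Graded elements of enriched categories\<close>

text \<open>
  An arrow \<open>x : X \<rightarrow> VHom C a b\<close> of \<open>V\<close> is treated as an arrow \<open>a \<rightarrow> b\<close> of grade \<open>X\<close>. Composition
  multiplies grades, and arrows of grade \<open>I\<close> act on both sides without changing the grade.
\<close>

context smcc
begin

definition gc :: "('c, 'o, 'm, 'z) vcat_scheme \<Rightarrow> 'c \<Rightarrow> 'c \<Rightarrow> 'c \<Rightarrow> 'm \<Rightarrow> 'm \<Rightarrow> 'm" where
  "gc C a b c y x = VComp C a b c \<cdot> (y \<boxtimes> x)"

definition lact :: "('c, 'o, 'm, 'z) vcat_scheme \<Rightarrow> 'c \<Rightarrow> 'c \<Rightarrow> 'c \<Rightarrow> 'm \<Rightarrow> 'm \<Rightarrow> 'm" where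
  "lact C a b c t x = gc C a b c t x \<cdot> inv_arr V (LUnit V (Dom V x))"

definition ract :: "('c, 'o, 'm, 'z) vcat_scheme \<Rightarrow> 'c \<Rightarrow> 'c \<Rightarrow> 'c \<Rightarrow> 'm \<Rightarrow> 'm \<Rightarrow> 'm" where
  "ract C a b c x t = gc C a b c x t \<cdot> inv_arr V (RUnit V (Dom V x))"

context
  fixes C :: "('c, 'o, 'm, 'z) vcat_scheme"
  assumes C: "vcategory V C"
begin

lemma vhom_obj [simp]: "a \<in> VObj C \<Longrightarrow> b \<in> VObj C \<Longrightarrow> VHom C a b \<in> Obj V"
  using C by (simp add: vcategory_def)

lemma vcomp [simp]:
  assumes "a \<in> VObj C" "b \<in> VObj C" "c \<in> VObj C"
  shows "VComp C a b c \<in> Arr V" "Dom V (VComp C a b c) = VHom C b c \<otimes> VHom C a b"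
    "Cod V (VComp C a b c) = VHom C a c"
  using C assms unfolding vcategory_def by simp_all

lemma vid [simp]:
  assumes "a \<in> VObj C"
  shows "VId C a \<in> Arr V" "Dom V (VId C a) = Unit V" "Cod V (VId C a) = VHom C a a"
  using C assms unfolding vcategory_def by simp_all

lemma gc_V [simp]:
  assumes "a \<in> VObj C" "b \<in> VObj C" "c \<in> VObj C"
    "y \<in> Arr V" "Cod V y = VHom C b c" "x \<in> Arr V" "Cod V x = VHom C a b"
  shows "gc C a b c y x \<in> Arr V" "Dom V (gc C a b c y x) = Dom V y \<otimes> Dom V x"
    "Cod V (gc C a b c y x) = VHom C a c"
  using assms by (simp_all add: gc_def)

lemma gc_assoc:
  assumes "a \<in> VObj C" "b \<in> VObj C" "c \<in> VObj C" "d \<in> VObj C"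
    "z \<in> Arr V" "Cod V z = VHom C c d"
    "y \<in> Arr V" "Cod V y = VHom C b c" "x \<in> Arr V" "Cod V x = VHom C a b"
  shows "gc C a b d (gc C b c d z y) x = gc C a c d z (gc C a b c y x) \<cdot> Assoc V (Dom V z) (Dom V y) (Dom V x)"
proof -
  have ax: "VComp C a b d \<cdot> (VComp C b c d \<boxtimes> Id V (VHom C a b)) =
      VComp C a c d \<cdot> (Id V (VHom C c d) \<boxtimes> VComp C a b c) \<cdot> Assoc V (VHom C c d) (VHom C b c) (VHom C a b)"
    using C assms unfolding vcategory_def by blast
  have "gc C a b d (gc C b c d z y) x = (VComp C a b d \<cdot> (VComp C b c d \<boxtimes> Id V (VHom C a b))) \<cdot> ((z \<boxtimes> y) \<boxtimes> x)"
    using assms by (simp add: gc_def ten_comp)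
  also have "\<dots> = VComp C a c d \<cdot> (Id V (VHom C c d) \<boxtimes> VComp C a b c)
      \<cdot> Assoc V (VHom C c d) (VHom C b c) (VHom C a b) \<cdot> ((z \<boxtimes> y) \<boxtimes> x)"
    unfolding ax using assms by simp
  also have "\<dots> = VComp C a c d \<cdot> (Id V (VHom C c d) \<boxtimes> VComp C a b c)
      \<cdot> (z \<boxtimes> (y \<boxtimes> x)) \<cdot> Assoc V (Dom V z) (Dom V y) (Dom V x)"
    using assms by (subst assoc_nat) auto
  also have "\<dots> = gc C a c d z (gc C a b c y x) \<cdot> Assoc V (Dom V z) (Dom V y) (Dom V x)"
    using assms by (simp add: gc_def ten_comp_ext)
  finally show ?thesis .
qed

lemma gc_reindex:
  assumes "a \<in> VObj C" "b \<in> VObj C" "c \<in> VObj C"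
    "y \<in> Arr V" "Cod V y = VHom C b c" "x \<in> Arr V" "Cod V x = VHom C a b"
    "v \<in> Arr V" "Cod V v = Dom V y" "w \<in> Arr V" "Cod V w = Dom V x"
  shows "gc C a b c (y \<cdot> v) (x \<cdot> w) = gc C a b c y x \<cdot> (v \<boxtimes> w)"
  using assms by (simp add: gc_def ten_comp)

lemma gc_reindex1:
  assumes "a \<in> VObj C" "b \<in> VObj C" "c \<in> VObj C"
    "y \<in> Arr V" "Cod V y = VHom C b c" "x \<in> Arr V" "Cod V x = VHom C a b"
    "v \<in> Arr V" "Cod V v = Dom V y"
  shows "gc C a b c (y \<cdot> v) x = gc C a b c y x \<cdot> (v \<boxtimes> Id V (Dom V x))"
  using gc_reindex[of a b c y x v "Id V (Dom V x)"] assms by simp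

lemma gc_reindex2:
  assumes "a \<in> VObj C" "b \<in> VObj C" "c \<in> VObj C"
    "y \<in> Arr V" "Cod V y = VHom C b c" "x \<in> Arr V" "Cod V x = VHom C a b"
    "w \<in> Arr V" "Cod V w = Dom V x"
  shows "gc C a b c y (x \<cdot> w) = gc C a b c y x \<cdot> (Id V (Dom V y) \<boxtimes> w)"
  using gc_reindex[of a b c y x "Id V (Dom V y)" w] assms by simp

lemma gc_id:
  assumes "a \<in> VObj C" "b \<in> VObj C" "x \<in> Arr V" "Cod V x = VHom C a b"
  shows "gc C a b b (VId C b) x = x \<cdot> LUnit V (Dom V x)" "gc C a a b x (VId C a) = x \<cdot> RUnit V (Dom V x)"
proof -
  have ax: "VComp C a b b \<cdot> (VId C b \<boxtimes> Id V (VHom C a b)) = LUnit V (VHom C a b)"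
    "VComp C a a b \<cdot> (Id V (VHom C a b) \<boxtimes> VId C a) = RUnit V (VHom C a b)"
    using C assms unfolding vcategory_def by simp_all
  have "gc C a b b (VId C b) x = VComp C a b b \<cdot> (VId C b \<boxtimes> Id V (VHom C a b)) \<cdot> (Id V (Unit V) \<boxtimes> x)"
    using assms by (simp add: gc_def ten_comp)
  also have "\<dots> = x \<cdot> LUnit V (Dom V x)"
    using assms by (subst comp_ext[OF ax(1)]) (auto simp: lunit_nat)
  finally show "gc C a b b (VId C b) x = x \<cdot> LUnit V (Dom V x)" .
  have "gc C a a b x (VId C a) = VComp C a a b \<cdot> (Id V (VHom C a b) \<boxtimes> VId C a) \<cdot> (x \<boxtimes> Id V (Unit V))"
    using assms by (simp add: gc_def ten_comp)
  also have "\<dots> = x \<cdot> RUnit V (Dom V x)"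
    using assms by (subst comp_ext[OF ax(2)]) (auto simp: runit_nat)
  finally show "gc C a a b x (VId C a) = x \<cdot> RUnit V (Dom V x)" .
qed

lemma lact_V [simp]:
  assumes "a \<in> VObj C" "b \<in> VObj C" "c \<in> VObj C"
    "t \<in> Arr V" "Dom V t = Unit V" "Cod V t = VHom C b c" "x \<in> Arr V" "Cod V x = VHom C a b"
  shows "lact C a b c t x \<in> Arr V" "Dom V (lact C a b c t x) = Dom V x" "Cod V (lact C a b c t x) = VHom C a c"
  using assms by (simp_all add: lact_def)

lemma ract_V [simp]:
  assumes "a \<in> VObj C" "b \<in> VObj C" "c \<in> VObj C"
    "t \<in> Arr V" "Dom V t = Unit V" "Cod V t = VHom C a b" "x \<in> Arr V" "Cod V x = VHom C b c"
  shows "ract C a b c x t \<in> Arr V" "Dom V (ract C a b c x t) = Dom V x" "Cod V (ract C a b c x t) = VHom C a c"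
  using assms by (simp_all add: ract_def)

text \<open>In a triple composite an arrow of grade \<open>I\<close> can stand on the left, in the
  middle or on the right. Each time the associator of \<open>gc_assoc\<close> meets an inverse unit
  constraint and is absorbed: by \<open>lunit_ten_inv\<close> here, by \<open>triangle_inv\<close>
  and \<open>runit_ten_inv\<close> in the next two lemmas.\<close>

lemma lact_gc:
  assumes [simp]: "a \<in> VObj C" "b \<in> VObj C" "c \<in> VObj C" "d \<in> VObj C"
    "t \<in> Arr V" "Dom V t = Unit V" "Cod V t = VHom C c d"
    "y \<in> Arr V" "Cod V y = VHom C b c" "x \<in> Arr V" "Cod V x = VHom C a b"
  shows "lact C a c d t (gc C a b c y x) = gc C a b d (lact C b c d t y) x"
  by (simp add: lact_def gc_reindex1 gc_assoc lunit_ten_inv)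

lemma gc_ract_lact:
  assumes [simp]: "a \<in> VObj C" "b \<in> VObj C" "c \<in> VObj C" "d \<in> VObj C"
    "t \<in> Arr V" "Dom V t = Unit V" "Cod V t = VHom C b c"
    "y \<in> Arr V" "Cod V y = VHom C c d" "x \<in> Arr V" "Cod V x = VHom C a b"
  shows "gc C a b d (ract C b c d y t) x = gc C a c d y (lact C a b c t x)"
  by (simp add: lact_def ract_def gc_reindex1 gc_reindex2 gc_assoc triangle_inv)

lemma ract_gc:
  assumes [simp]: "a \<in> VObj C" "b \<in> VObj C" "c \<in> VObj C" "d \<in> VObj C"
    "t \<in> Arr V" "Dom V t = Unit V" "Cod V t = VHom C a b"
    "y \<in> Arr V" "Cod V y = VHom C c d" "x \<in> Arr V" "Cod V x = VHom C b c"
  shows "ract C a b d (gc C b c d y x) t = gc C a c d y (ract C a b c x t)"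
  by (simp add: ract_def gc_reindex2 gc_assoc runit_ten_inv)

lemma lact_reindex:
  assumes [simp]: "a \<in> VObj C" "b \<in> VObj C" "c \<in> VObj C"
    "t \<in> Arr V" "Dom V t = Unit V" "Cod V t = VHom C b c" "x \<in> Arr V" "Cod V x = VHom C a b"
    "v \<in> Arr V" "Dom V x = Cod V v"
  shows "lact C a b c t (x \<cdot> v) = lact C a b c t x \<cdot> v"
  by (simp add: lact_def gc_reindex2 lunit_inv_nat)

lemma ract_reindex:
  assumes [simp]: "a \<in> VObj C" "b \<in> VObj C" "c \<in> VObj C"
    "t \<in> Arr V" "Dom V t = Unit V" "Cod V t = VHom C a b" "x \<in> Arr V" "Cod V x = VHom C b c"
    "v \<in> Arr V" "Dom V x = Cod V v"
  shows "ract C a b c (x \<cdot> v) t = ract C a b c x t \<cdot> v"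
  by (simp add: ract_def gc_reindex1 runit_inv_nat)

lemma lact_lact:
  assumes [simp]: "a \<in> VObj C" "b \<in> VObj C" "c \<in> VObj C" "d \<in> VObj C"
    "s \<in> Arr V" "Dom V s = Unit V" "Cod V s = VHom C c d"
    "t \<in> Arr V" "Dom V t = Unit V" "Cod V t = VHom C b c" "x \<in> Arr V" "Cod V x = VHom C a b"
  shows "lact C a c d s (lact C a b c t x) = lact C a b d (lact C b c d s t) x"
proof -
  have "lact C a c d s (lact C a b c t x) = lact C a c d s (gc C a b c t x) \<cdot> inv_arr V (LUnit V (Dom V x))"
    unfolding lact_def[of C a b c] by (subst lact_reindex) auto
  also have "\<dots> = lact C a b d (lact C b c d s t) x"
    by (simp add: lact_gc) (simp add: lact_def[of _ a b])
  finally show ?thesis .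
qed

lemma lact_ract:
  assumes [simp]: "a \<in> VObj C" "b \<in> VObj C" "c \<in> VObj C" "d \<in> VObj C"
    "s \<in> Arr V" "Dom V s = Unit V" "Cod V s = VHom C c d"
    "t \<in> Arr V" "Dom V t = Unit V" "Cod V t = VHom C a b" "x \<in> Arr V" "Cod V x = VHom C b c"
  shows "lact C a c d s (ract C a b c x t) = ract C a b d (lact C b c d s x) t"
proof -
  have "lact C a c d s (ract C a b c x t) = lact C a c d s (gc C a b c x t) \<cdot> inv_arr V (RUnit V (Dom V x))"
    unfolding ract_def by (subst lact_reindex) auto
  also have "\<dots> = ract C a b d (lact C b c d s x) t"
    by (simp add: lact_gc ract_def)
  finally show ?thesis .
qed

lemma ract_ract:
  assumes [simp]: "a \<in> VObj C" "b \<in> VObj C" "c \<in> VObj C" "d \<in> VObj C"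
    "t \<in> Arr V" "Dom V t = Unit V" "Cod V t = VHom C a b"
    "s \<in> Arr V" "Dom V s = Unit V" "Cod V s = VHom C b c" "x \<in> Arr V" "Cod V x = VHom C c d"
  shows "ract C a b d (ract C b c d x s) t = ract C a c d x (ract C a b c s t)"
proof -
  have "ract C a b d (ract C b c d x s) t = ract C a b d (gc C b c d x s) t \<cdot> inv_arr V (RUnit V (Dom V x))"
    unfolding ract_def[of C b] by (subst ract_reindex) auto
  also have "\<dots> = ract C a c d x (ract C a b c s t)"
    by (simp add: ract_gc) (simp add: ract_def[of _ a c])
  finally show ?thesis .
qed

text \<open>The two unit constraints of \<open>I\<close> coincide, so on arrows of grade
  \<open>I\<close> both actions are composition in the underlying category.\<close>

lemma ract_eq_lact:
  assumes "Dom V s = Unit V" "Dom V t = Unit V"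
  shows "ract C a b c s t = lact C a b c s t"
  using assms by (simp add: ract_def lact_def lunit_unit)

lemma lact_id [simp]: "a \<in> VObj C \<Longrightarrow> b \<in> VObj C \<Longrightarrow> x \<in> Arr V \<Longrightarrow> Cod V x = VHom C a b \<Longrightarrow>
    lact C a b b (VId C b) x = x"
  by (simp add: lact_def gc_id)

lemma ract_id [simp]: "a \<in> VObj C \<Longrightarrow> b \<in> VObj C \<Longrightarrow> x \<in> Arr V \<Longrightarrow> Cod V x = VHom C a b \<Longrightarrow>
    ract C a a b x (VId C a) = x"
  by (simp add: ract_def gc_id)

lemma lact_id' [simp]:
  assumes "a \<in> VObj C" "b \<in> VObj C" "s \<in> Arr V" "Dom V s = Unit V" "Cod V s = VHom C a b"
  shows "lact C a a b s (VId C a) = s"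
proof -
  have "lact C a a b s (VId C a) = ract C a a b s (VId C a)" using assms by (simp add: ract_eq_lact)
  thus ?thesis using assms by simp
qed

end

lemma ucomp_lact:
  assumes "vcategory V C" "a \<in> VObj C" "b \<in> VObj C" "c \<in> VObj C"
    "t \<in> Arr V" "Dom V t = Unit V" "Cod V t = VHom C b c"
    "s \<in> Arr V" "Dom V s = Unit V" "Cod V s = VHom C a b"
  shows "ucomp V C a b c t s = lact C a b c t s"
  using assms by (simp add: ucomp_def lact_def gc_def)

subsection \<open>Commuting squares\<close>

text \<open>The two paths from \<open>p0\<close> to \<open>q1\<close> have grades
  \<open>X \<otimes> Y\<close> and \<open>Y \<otimes> X\<close>, hence the symmetry. With
  \<open>X\<close> a hom-object of a theory and \<open>Y\<close> the vertex of a wedge this is the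
  wedge condition; with \<open>X\<close> an arity and cotensor counits as \<open>x0\<close>,
  \<open>x1\<close> it characterises the action of \<open>[j, -]\<close> on arrows.\<close>

definition sq :: "('c, 'o, 'm, 'z) vcat_scheme \<Rightarrow> 'o \<Rightarrow> 'o \<Rightarrow> 'c \<Rightarrow> 'c \<Rightarrow> 'c \<Rightarrow> 'c \<Rightarrow> 'm \<Rightarrow> 'm \<Rightarrow> 'm \<Rightarrow> 'm \<Rightarrow> bool" where
  "sq C X Y p0 p1 q0 q1 x0 x1 yp yq \<longleftrightarrow>
     p0 \<in> VObj C \<and> p1 \<in> VObj C \<and> q0 \<in> VObj C \<and> q1 \<in> VObj C \<and>
     x0 \<in> hom V X (VHom C p0 q0) \<and> x1 \<in> hom V X (VHom C p1 q1) \<and>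
     yp \<in> hom V Y (VHom C p0 p1) \<and> yq \<in> hom V Y (VHom C q0 q1) \<and>
     gc C p0 p1 q1 x1 yp = gc C p0 q0 q1 yq x0 \<cdot> Sym V X Y"

context
  fixes C :: "('c, 'o, 'm, 'z) vcat_scheme"
  assumes C: "vcategory V C"
begin

text \<open>\<open>Sym V Y X\<close> inverts \<open>Sym V X Y\<close>. This exchange of the two
  gradings is the germ of the symmetry of commutation.\<close>

lemma sq_flip:
  assumes "sq C X Y p0 p1 q0 q1 x0 x1 yp yq"
  shows "sq C Y X p0 q0 p1 q1 yp yq x0 x1"
  using assms C unfolding sq_def by auto

text \<open>Both paths around the outer square are brought to a common form ending in the same
  isomorphism of grades; the hexagon moves \<open>X\<close> past \<open>Z \<otimes> Y\<close> one
  factor at a time. Only the square with edges of grade \<open>Z\<close> is assumed to commute, so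
  the two equations serve for pasting as well as for cancelling.\<close>

lemma sq_paste_aux:
  assumes "sq C X Z p1 p2 q1 q2 x1 x2 zp zq"
    and "p0 \<in> VObj C" "q0 \<in> VObj C" "x0 \<in> hom V X (VHom C p0 q0)"
    and "yp \<in> hom V Y (VHom C p0 p1)" "yq \<in> hom V Y (VHom C q0 q1)"
  shows "gc C p0 p2 q2 x2 (gc C p0 p1 p2 zp yp) \<cdot> Assoc V X Z Y =
      gc C p0 q1 q2 zq (gc C p0 p1 q1 x1 yp) \<cdot> Assoc V Z X Y \<cdot> (Sym V X Z \<boxtimes> Id V Y)"
    and "gc C p0 q0 q2 (gc C q0 q1 q2 zq yq) x0 \<cdot> Sym V X (Z \<otimes> Y) \<cdot> Assoc V X Z Y =
      gc C p0 q1 q2 zq (gc C p0 q0 q1 yq x0 \<cdot> Sym V X Y) \<cdot> Assoc V Z X Y \<cdot> (Sym V X Z \<boxtimes> Id V Y)"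
proof -
  have [simp]: "p0 \<in> VObj C" "p1 \<in> VObj C" "p2 \<in> VObj C" "q0 \<in> VObj C" "q1 \<in> VObj C" "q2 \<in> VObj C"
    "x0 \<in> Arr V" "Dom V x0 = X" "Cod V x0 = VHom C p0 q0"
    "x1 \<in> Arr V" "Dom V x1 = X" "Cod V x1 = VHom C p1 q1"
    "x2 \<in> Arr V" "Dom V x2 = X" "Cod V x2 = VHom C p2 q2"
    "zp \<in> Arr V" "Dom V zp = Z" "Cod V zp = VHom C p1 p2"
    "zq \<in> Arr V" "Dom V zq = Z" "Cod V zq = VHom C q1 q2"
    "yp \<in> Arr V" "Dom V yp = Y" "Cod V yp = VHom C p0 p1"
    "yq \<in> Arr V" "Dom V yq = Y" "Cod V yq = VHom C q0 q1"
    and eq: "gc C p1 p2 q2 x2 zp = gc C p1 q1 q2 zq x1 \<cdot> Sym V X Z"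
    using assms unfolding sq_def by auto
  have [simp]: "X \<in> Obj V" "Y \<in> Obj V" "Z \<in> Obj V"
    using dom_cod_obj(1)[of x0] dom_cod_obj(1)[of yp] dom_cod_obj(1)[of zp] by simp_all
  note [simp] = C
  have "gc C p0 p2 q2 x2 (gc C p0 p1 p2 zp yp) \<cdot> Assoc V X Z Y = gc C p0 p1 q2 (gc C p1 p2 q2 x2 zp) yp"
    by (simp add: gc_assoc)
  also have "\<dots> = gc C p0 q1 q2 zq (gc C p0 p1 q1 x1 yp) \<cdot> Assoc V Z X Y \<cdot> (Sym V X Z \<boxtimes> Id V Y)"
    unfolding eq by (simp add: gc_reindex1 gc_assoc)
  finally show "gc C p0 p2 q2 x2 (gc C p0 p1 p2 zp yp) \<cdot> Assoc V X Z Y =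
      gc C p0 q1 q2 zq (gc C p0 p1 q1 x1 yp) \<cdot> Assoc V Z X Y \<cdot> (Sym V X Z \<boxtimes> Id V Y)" .
  have "gc C p0 q0 q2 (gc C q0 q1 q2 zq yq) x0 \<cdot> Sym V X (Z \<otimes> Y) \<cdot> Assoc V X Z Y
      = gc C p0 q1 q2 zq (gc C p0 q0 q1 yq x0) \<cdot> Assoc V Z Y X \<cdot> Sym V X (Z \<otimes> Y) \<cdot> Assoc V X Z Y"
    by (simp add: gc_assoc)
  also have "\<dots> = gc C p0 q1 q2 zq (gc C p0 q0 q1 yq x0 \<cdot> Sym V X Y) \<cdot> Assoc V Z X Y \<cdot> (Sym V X Z \<boxtimes> Id V Y)"
    by (subst hexagon) (auto simp: gc_reindex2)
  finally show "gc C p0 q0 q2 (gc C q0 q1 q2 zq yq) x0 \<cdot> Sym V X (Z \<otimes> Y) \<cdot> Assoc V X Z Y =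
      gc C p0 q1 q2 zq (gc C p0 q0 q1 yq x0 \<cdot> Sym V X Y) \<cdot> Assoc V Z X Y \<cdot> (Sym V X Z \<boxtimes> Id V Y)" .
qed

lemma sq_paste:
  assumes "sq C X Z p1 p2 q1 q2 x1 x2 zp zq" "sq C X Y p0 p1 q0 q1 x0 x1 yp yq"
  shows "sq C X (Z \<otimes> Y) p0 p2 q0 q2 x0 x2 (gc C p0 p1 p2 zp yp) (gc C q0 q1 q2 zq yq)"
proof -
  have t: "p0 \<in> VObj C" "q0 \<in> VObj C" "x0 \<in> hom V X (VHom C p0 q0)"
    "yp \<in> hom V Y (VHom C p0 p1)" "yq \<in> hom V Y (VHom C q0 q1)"
    using assms(2) unfolding sq_def by blast+
  have o: "X \<in> Obj V" "Y \<in> Obj V" "Z \<in> Obj V"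
    using assms unfolding sq_def hom_V by (metis dom_cod_obj(1))+
  have "gc C p0 p2 q2 x2 (gc C p0 p1 p2 zp yp) \<cdot> Assoc V X Z Y =
      (gc C p0 q0 q2 (gc C q0 q1 q2 zq yq) x0 \<cdot> Sym V X (Z \<otimes> Y)) \<cdot> Assoc V X Z Y"
    using sq_paste_aux[OF assms(1) t] assms C o unfolding sq_def by simp
  hence "gc C p0 p2 q2 x2 (gc C p0 p1 p2 zp yp) = gc C p0 q0 q2 (gc C q0 q1 q2 zq yq) x0 \<cdot> Sym V X (Z \<otimes> Y)"
    by (rule iso_epic[rotated]) (use assms C o in \<open>auto simp: sq_def\<close>)
  thus ?thesis using assms C o unfolding sq_def by auto
qed

text \<open>A converse to pasting. It is applied with cotensor counits as \<open>zp\<close> and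
  \<open>zq\<close>, where \<open>inj\<close> is the uniqueness of factorisations: lifts through
  counits inherit commuting squares from the arrows that they lift.\<close>

lemma sq_cancel:
  assumes "sq C X Z p1 p2 q1 q2 x1 x2 zp zq"
    and "sq C X (Z \<otimes> Y) p0 p2 q0 q2 x0 x2 (gc C p0 p1 p2 zp yp) (gc C q0 q1 q2 zq yq)"
    and "yp \<in> hom V Y (VHom C p0 p1)" "yq \<in> hom V Y (VHom C q0 q1)"
    and inj: "\<And>f g. f \<in> hom V (X \<otimes> Y) (VHom C p0 q1) \<Longrightarrow> g \<in> hom V (X \<otimes> Y) (VHom C p0 q1) \<Longrightarrow>
      gc C p0 q1 q2 zq f = gc C p0 q1 q2 zq g \<Longrightarrow> f = g"
  shows "sq C X Y p0 p1 q0 q1 x0 x1 yp yq"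
proof -
  have t: "p0 \<in> VObj C" "q0 \<in> VObj C" "x0 \<in> hom V X (VHom C p0 q0)"
    using assms(2) unfolding sq_def by blast+
  have o [simp]: "X \<in> Obj V" "Y \<in> Obj V" "Z \<in> Obj V"
    using assms unfolding sq_def hom_V by (metis dom_cod_obj(1))+
  note ty = assms(1,3,4) t C
  have "gc C p0 q1 q2 zq (gc C p0 p1 q1 x1 yp) \<cdot> Assoc V Z X Y \<cdot> (Sym V X Z \<boxtimes> Id V Y)
      = gc C p0 q1 q2 zq (gc C p0 q0 q1 yq x0 \<cdot> Sym V X Y) \<cdot> Assoc V Z X Y \<cdot> (Sym V X Z \<boxtimes> Id V Y)"
    using sq_paste_aux[OF assms(1) t assms(3,4)] assms(2) ty unfolding sq_def by simp
  hence "gc C p0 q1 q2 zq (gc C p0 p1 q1 x1 yp) = gc C p0 q1 q2 zq (gc C p0 q0 q1 yq x0 \<cdot> Sym V X Y)"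
    by (rule iso_epic[rotated])
       (use ty in \<open>auto simp: sq_def intro!: isoI[of _ "(Sym V Z X \<boxtimes> Id V Y) \<cdot> inv_arr V (Assoc V Z X Y)"]
          simp: ten_comp ten_comp_ext\<close>)
  hence "gc C p0 p1 q1 x1 yp = gc C p0 q0 q1 yq x0 \<cdot> Sym V X Y"
    by (rule inj[rotated -1]) (use ty in \<open>auto simp: sq_def\<close>)
  thus ?thesis using ty unfolding sq_def by auto
qed

text \<open>With edges of grade \<open>I\<close> the square becomes enriched naturality. The grade
  \<open>X \<otimes> I\<close> is replaced by \<open>X\<close> along \<open>RUnit\<close>, which the
  symmetry turns into the left unit constraint on the other side.\<close>

lemma sq_unit:
  assumes "p0 \<in> VObj C" "p1 \<in> VObj C" "q0 \<in> VObj C" "q1 \<in> VObj C"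
    "x0 \<in> hom V X (VHom C p0 q0)" "x1 \<in> hom V X (VHom C p1 q1)"
    "s \<in> hom V (Unit V) (VHom C p0 p1)" "t \<in> hom V (Unit V) (VHom C q0 q1)"
  shows "sq C X (Unit V) p0 p1 q0 q1 x0 x1 s t \<longleftrightarrow> ract C p0 p1 q1 x1 s = lact C p0 q0 q1 t x0"
proof -
  have [simp]: "X \<in> Obj V" using assms by auto
  have "sq C X (Unit V) p0 p1 q0 q1 x0 x1 s t \<longleftrightarrow> gc C p0 p1 q1 x1 s = gc C p0 q0 q1 t x0 \<cdot> Sym V X (Unit V)"
    using assms unfolding sq_def by blast
  also have "\<dots> \<longleftrightarrow> gc C p0 p1 q1 x1 s \<cdot> inv_arr V (RUnit V X)
      = (gc C p0 q0 q1 t x0 \<cdot> Sym V X (Unit V)) \<cdot> inv_arr V (RUnit V X)"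
  proof
    assume *: "gc C p0 p1 q1 x1 s \<cdot> inv_arr V (RUnit V X)
      = (gc C p0 q0 q1 t x0 \<cdot> Sym V X (Unit V)) \<cdot> inv_arr V (RUnit V X)"
    show "gc C p0 p1 q1 x1 s = gc C p0 q0 q1 t x0 \<cdot> Sym V X (Unit V)"
      by (rule iso_epic[OF _ *]) (use assms C in \<open>auto intro!: isoI[of _ "RUnit V X"]\<close>)
  qed simp
  also have "(gc C p0 q0 q1 t x0 \<cdot> Sym V X (Unit V)) \<cdot> inv_arr V (RUnit V X) = lact C p0 q0 q1 t x0"
    using assms C by (simp add: lact_def sym_runit_inv)
  finally show ?thesis using assms by (simp add: ract_def)
qed

lemma sq_reindex:
  assumes "sq C X Y p0 p1 q0 q1 x0 x1 yp yq" "v \<in> hom V X' X" "w \<in> hom V Y' Y"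
  shows "sq C X' Y' p0 p1 q0 q1 (x0 \<cdot> v) (x1 \<cdot> v) (yp \<cdot> w) (yq \<cdot> w)"
proof -
  have o: "X \<in> Obj V" "Y \<in> Obj V" "X' \<in> Obj V" "Y' \<in> Obj V"
    using assms unfolding sq_def hom_V by (metis dom_cod_obj(1))+
  have "gc C p0 p1 q1 (x1 \<cdot> v) (yp \<cdot> w) = gc C p0 p1 q1 x1 yp \<cdot> (v \<boxtimes> w)"
    using assms C unfolding sq_def by (subst gc_reindex) auto
  also have "\<dots> = (gc C p0 q0 q1 yq x0 \<cdot> Sym V X Y) \<cdot> (v \<boxtimes> w)"
    using assms unfolding sq_def by simp
  also have "\<dots> = gc C p0 q0 q1 yq x0 \<cdot> (w \<boxtimes> v) \<cdot> Sym V X' Y'"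
    using assms C o sym_nat[of v w X Y] unfolding sq_def by (simp add: o)
  also have "\<dots> = gc C p0 q0 q1 (yq \<cdot> w) (x0 \<cdot> v) \<cdot> Sym V X' Y'"
    using assms C o unfolding sq_def by (subst gc_reindex) auto
  finally show ?thesis using assms C o unfolding sq_def by auto
qed

end

end

context smcc
begin

section \<open>Functors and isomorphisms on graded elements\<close>

lemma uinverse_iff:
  assumes "vcategory V C" "a \<in> VObj C" "b \<in> VObj C"
  shows "uinverse V C a b t s \<longleftrightarrow> t \<in> hom V (Unit V) (VHom C a b) \<and> s \<in> hom V (Unit V) (VHom C b a) \<and>
     lact C a b a s t = VId C a \<and> lact C b a b t s = VId C b"
  using assms by (auto simp: uinverse_def ucomp_lact)

lemma uinverse_sym: "uinverse V C a b t s \<Longrightarrow> uinverse V C b a s t"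
  by (auto simp: uinverse_def)

lemma uinverse_V:
  assumes "uinverse V C a b t s"
  shows "t \<in> Arr V" "Dom V t = Unit V" "Cod V t = VHom C a b"
    "s \<in> Arr V" "Dom V s = Unit V" "Cod V s = VHom C b a"
  using assms by (auto simp: uinverse_def)

context
  fixes C :: "('c, 'o, 'm, 'z) vcat_scheme"
  assumes C [simp]: "vcategory V C"
begin

lemma uinverse_lact:
  assumes "uinverse V C a b t s" "a \<in> VObj C" "b \<in> VObj C" "d \<in> VObj C" "x \<in> Arr V" "Cod V x = VHom C d a"
  shows "lact C d b a s (lact C d a b t x) = x"
  using assms uinverse_iff[OF C assms(2,3)] by (simp add: lact_lact)

lemma uinverse_lact_inj:
  assumes "uinverse V C a b t s" "lact C d a b t x = lact C d a b t y" "a \<in> VObj C" "b \<in> VObj C" "d \<in> VObj C"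
    "x \<in> Arr V" "Cod V x = VHom C d a" "y \<in> Arr V" "Cod V y = VHom C d a"
  shows "x = y"
  using uinverse_lact[OF assms(1,3-7)] uinverse_lact[OF assms(1,3-5,8,9)] assms(2) by metis

lemma uinverse_ract:
  assumes "uinverse V C a b t s" "a \<in> VObj C" "b \<in> VObj C" "d \<in> VObj C" "x \<in> Arr V" "Cod V x = VHom C a d"
  shows "ract C a b d (ract C b a d x s) t = x"
proof -
  have "ract C a b a s t = VId C a" using assms uinverse_iff[OF C assms(2,3)] by (simp add: ract_eq_lact)
  thus ?thesis using assms uinverse_V[OF assms(1)] by (simp add: ract_ract)
qed

lemma uinverse_unique:
  assumes "uinverse V C a b t s" "uinverse V C a b t s'" "a \<in> VObj C" "b \<in> VObj C"
  shows "s = s'"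
proof -
  have "s = lact C b a a (lact C a b a s' t) s" using assms uinverse_iff[OF C assms(3,4)] by simp
  also have "\<dots> = lact C b b a s' (lact C b a b t s)"
    using assms uinverse_V[OF assms(1)] uinverse_V[OF assms(2)] by (simp add: lact_lact)
  also have "\<dots> = s'"
    using assms uinverse_iff[OF C assms(3,4)] by simp
  finally show ?thesis .
qed

lemma uinverse_comp:
  assumes "uinverse V C a b t s" "uinverse V C b c t' s'" "a \<in> VObj C" "b \<in> VObj C" "c \<in> VObj C"
  shows "uinverse V C a c (lact C a b c t' t) (lact C c b a s s')"
proof -
  note [simp] = uinverse_V[OF assms(1)] uinverse_V[OF assms(2)]
  have "lact C a c a (lact C c b a s s') (lact C a b c t' t) = lact C a b a s (lact C a c b s' (lact C a b c t' t))"
    using assms by (simp add: lact_lact)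
  also have "\<dots> = VId C a"
    using uinverse_lact[OF assms(2), of a t] assms uinverse_iff[OF C, of a b t s] by simp
  finally have 1: "lact C a c a (lact C c b a s s') (lact C a b c t' t) = VId C a" .
  have "lact C c a c (lact C a b c t' t) (lact C c b a s s') = lact C c b c t' (lact C c a b t (lact C c b a s s'))"
    using assms by (simp add: lact_lact)
  also have "\<dots> = VId C c"
    using uinverse_lact[OF uinverse_sym[OF assms(1)], of c s'] assms uinverse_iff[OF C, of b c t' s'] by simp
  finally show ?thesis using 1 assms by (subst uinverse_iff) auto
qed

lemma uinverse_id: "a \<in> VObj C \<Longrightarrow> uinverse V C a a (VId C a) (VId C a)"
  by (subst uinverse_iff) auto

end

lemma vfunctor_obj:
  assumes "vfunctor V T C F" "a \<in> VObj T"
  shows "FO F a \<in> VObj C"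
  using assms by (auto simp: vfunctor_def)

lemma vfunctor_arr:
  assumes "vfunctor V T C F" "a \<in> VObj T" "b \<in> VObj T"
  shows "FA F a b \<in> Arr V" "Dom V (FA F a b) = VHom T a b" "Cod V (FA F a b) = VHom C (FO F a) (FO F b)"
  using assms by (auto simp: vfunctor_def)

lemma vfunctor_id:
  assumes "vfunctor V T C F" "a \<in> VObj T"
  shows "FA F a a \<cdot> VId T a = VId C (FO F a)"
  using assms by (auto simp: vfunctor_def)

context
  fixes C :: "('c, 'o, 'm, 'z) vcat_scheme" and T :: "('t, 'o, 'm, 'y) vcat_scheme" and F
  assumes C [simp]: "vcategory V C" and T [simp]: "vcategory V T" and F: "vfunctor V T C F"
begin

lemmas vfunctor_V [simp] = vfunctor_obj[OF F] vfunctor_arr[OF F]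

lemma vfunctor_gc:
  assumes "a \<in> VObj T" "b \<in> VObj T" "c \<in> VObj T"
    "y \<in> Arr V" "Cod V y = VHom T b c" "x \<in> Arr V" "Cod V x = VHom T a b"
  shows "FA F a c \<cdot> gc T a b c y x = gc C (FO F a) (FO F b) (FO F c) (FA F b c \<cdot> y) (FA F a b \<cdot> x)"
proof -
  have ax: "FA F a c \<cdot> VComp T a b c = VComp C (FO F a) (FO F b) (FO F c) \<cdot> (FA F b c \<boxtimes> FA F a b)"
    using F assms by (simp add: vfunctor_def)
  show ?thesis
    using assms by (simp add: gc_def comp_ext[OF ax] ten_comp)
qed

lemma vfunctor_lact:
  assumes "a \<in> VObj T" "b \<in> VObj T" "c \<in> VObj T"
    "t \<in> Arr V" "Dom V t = Unit V" "Cod V t = VHom T b c" "x \<in> Arr V" "Cod V x = VHom T a b"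
  shows "FA F a c \<cdot> lact T a b c t x = lact C (FO F a) (FO F b) (FO F c) (FA F b c \<cdot> t) (FA F a b \<cdot> x)"
  using assms by (simp add: lact_def comp_ext[OF vfunctor_gc])

lemma vfunctor_ract:
  assumes "a \<in> VObj T" "b \<in> VObj T" "c \<in> VObj T"
    "t \<in> Arr V" "Dom V t = Unit V" "Cod V t = VHom T a b" "x \<in> Arr V" "Cod V x = VHom T b c"
  shows "FA F a c \<cdot> ract T a b c x t = ract C (FO F a) (FO F b) (FO F c) (FA F b c \<cdot> x) (FA F a b \<cdot> t)"
  using assms by (simp add: ract_def comp_ext[OF vfunctor_gc])

lemma vfunctor_uinverse:
  assumes "uinverse V T a b t s" "a \<in> VObj T" "b \<in> VObj T"
  shows "uinverse V C (FO F a) (FO F b) (FA F a b \<cdot> t) (FA F b a \<cdot> s)"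
  using assms uinverse_V[OF assms(1)]
  by (simp add: uinverse_iff vfunctor_lact[symmetric] vfunctor_id[OF F])

end

section \<open>Cotensors\<close>

text \<open>Representability form of \<open>is_cotensor\<close>: in place of the invertibility of
  \<open>cot_cmp\<close>, every arrow of grade \<open>j \<otimes> X\<close> factors uniquely through
  \<open>\<kappa>\<close> by one of grade \<open>X\<close>. The two agree by
  \<open>is_cotensor_iff_univ\<close>.\<close>

definition univ :: "('c, 'o, 'm, 'z) vcat_scheme \<Rightarrow> 'o \<Rightarrow> 'c \<Rightarrow> 'c \<Rightarrow> 'm \<Rightarrow> bool" where
  "univ C j c l \<kappa> \<longleftrightarrow> c \<in> VObj C \<and> l \<in> VObj C \<and> \<kappa> \<in> hom V j (VHom C l c) \<and>
     (\<forall>d\<in>VObj C. \<forall>X\<in>Obj V. \<forall>g\<in>hom V (j \<otimes> X) (VHom C d c).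
        \<exists>!f. f \<in> hom V X (VHom C d l) \<and> gc C d l c \<kappa> f = g)"

definition clift :: "('c, 'o, 'm, 'z) vcat_scheme \<Rightarrow> 'c \<Rightarrow> 'c \<Rightarrow> 'm \<Rightarrow> 'c \<Rightarrow> 'o \<Rightarrow> 'm \<Rightarrow> 'm" where
  "clift C c l \<kappa> d X g = (THE f. f \<in> hom V X (VHom C d l) \<and> gc C d l c \<kappa> f = g)"

lemma univ_V:
  assumes "univ C j c l \<kappa>"
  shows "c \<in> VObj C" "l \<in> VObj C" "\<kappa> \<in> Arr V" "Dom V \<kappa> = j" "Cod V \<kappa> = VHom C l c" "j \<in> Obj V"
proof -
  show *: "c \<in> VObj C" "l \<in> VObj C" "\<kappa> \<in> Arr V" "Dom V \<kappa> = j" "Cod V \<kappa> = VHom C l c"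
    using assms by (auto simp: univ_def)
  show "j \<in> Obj V" using * dom_cod_obj(1)[of \<kappa>] by simp
qed

lemma univ_inj:
  assumes "univ C j c l \<kappa>" "gc C d l c \<kappa> f = gc C d l c \<kappa> g" "vcategory V C" "d \<in> VObj C"
    "f \<in> hom V X (VHom C d l)" "g \<in> hom V X (VHom C d l)"
  shows "f = g"
proof -
  have "X \<in> Obj V" using assms by auto
  moreover have "gc C d l c \<kappa> g \<in> hom V (j \<otimes> X) (VHom C d c)"
    using assms univ_V[OF assms(1)] by simp
  ultimately have "\<exists>!h. h \<in> hom V X (VHom C d l) \<and> gc C d l c \<kappa> h = gc C d l c \<kappa> g"
    using assms(1,4) unfolding univ_def by blast
  thus ?thesis using assms by blast
qed

lemma clift_V:
  assumes "univ C j c l \<kappa>" "d \<in> VObj C" "X \<in> Obj V" "g \<in> hom V (j \<otimes> X) (VHom C d c)"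
  shows "clift C c l \<kappa> d X g \<in> Arr V" "Dom V (clift C c l \<kappa> d X g) = X"
    "Cod V (clift C c l \<kappa> d X g) = VHom C d l" "gc C d l c \<kappa> (clift C c l \<kappa> d X g) = g"
proof -
  have "\<exists>!f. f \<in> hom V X (VHom C d l) \<and> gc C d l c \<kappa> f = g"
    using assms unfolding univ_def by blast
  from theI'[OF this] show "clift C c l \<kappa> d X g \<in> Arr V" "Dom V (clift C c l \<kappa> d X g) = X"
    "Cod V (clift C c l \<kappa> d X g) = VHom C d l" "gc C d l c \<kappa> (clift C c l \<kappa> d X g) = g"
    unfolding clift_def by auto
qed

lemma univI:
  assumes "c \<in> VObj C" "l \<in> VObj C" "\<kappa> \<in> hom V j (VHom C l c)"
    and "\<And>d X g. d \<in> VObj C \<Longrightarrow> X \<in> Obj V \<Longrightarrow> g \<in> hom V (j \<otimes> X) (VHom C d c) \<Longrightarrow>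
      \<exists>f. f \<in> hom V X (VHom C d l) \<and> gc C d l c \<kappa> f = g"
    and "\<And>d X f g. d \<in> VObj C \<Longrightarrow> X \<in> Obj V \<Longrightarrow> f \<in> hom V X (VHom C d l) \<Longrightarrow> g \<in> hom V X (VHom C d l) \<Longrightarrow>
      gc C d l c \<kappa> f = gc C d l c \<kappa> g \<Longrightarrow> f = g"
  shows "univ C j c l \<kappa>"
  unfolding univ_def
proof (intro conjI ballI)
  fix d X g assume *: "d \<in> VObj C" "X \<in> Obj V" "g \<in> hom V (j \<otimes> X) (VHom C d c)"
  show "\<exists>!f. f \<in> hom V X (VHom C d l) \<and> gc C d l c \<kappa> f = g"
    using assms(4)[OF *] assms(5)[OF *(1,2)] by (metis (no_types, lifting))
qed (use assms(1-3) in auto)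

context
  fixes C :: "('c, 'o, 'm, 'z) vcat_scheme"
  assumes C [simp]: "vcategory V C"
begin

text \<open>On arrows of grade \<open>X\<close> the comparison is composition with
  \<open>\<kappa>\<close> followed by transposition. This translates between the invertibility of
  \<open>cot_cmp\<close> and unique factorisation.\<close>

lemma cot_cmp_comp:
  assumes [simp]: "c \<in> VObj C" "l \<in> VObj C" "d \<in> VObj C" "\<kappa> \<in> Arr V" "Dom V \<kappa> = j" "Cod V \<kappa> = VHom C l c"
    "j \<in> Obj V" "f \<in> Arr V" "Dom V f = X" "Cod V f = VHom C d l"
  shows "cot_cmp V C j c l \<kappa> d \<cdot> f = curr V X j (VHom C d c) (gc C d l c \<kappa> f \<cdot> Sym V X j)"
proof -
  have [simp]: "X \<in> Obj V" using dom_cod_obj(1)[of f] by simp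
  have "(VComp C d l c \<cdot> (\<kappa> \<boxtimes> Id V (VHom C d l)) \<cdot> Sym V (VHom C d l) j) \<cdot> (f \<boxtimes> Id V j)
      = VComp C d l c \<cdot> (\<kappa> \<boxtimes> Id V (VHom C d l)) \<cdot> Sym V (VHom C d l) j \<cdot> (f \<boxtimes> Id V j)"
    by simp
  also have "\<dots> = gc C d l c \<kappa> f \<cdot> Sym V X j"
    by (subst sym_nat) (auto simp: gc_def ten_comp_ext)
  finally show ?thesis unfolding cot_cmp_def by (subst curr_comp) auto
qed

lemma cot_cmp_V:
  assumes "c \<in> VObj C" "l \<in> VObj C" "d \<in> VObj C" "\<kappa> \<in> Arr V" "Dom V \<kappa> = j" "Cod V \<kappa> = VHom C l c" "j \<in> Obj V"
  shows "cot_cmp V C j c l \<kappa> d \<in> Arr V" "Dom V (cot_cmp V C j c l \<kappa> d) = VHom C d l"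
    "Cod V (cot_cmp V C j c l \<kappa> d) = IHom V j (VHom C d c)"
  using assms by (simp_all add: cot_cmp_def)

lemma curr_sym_inject:
  assumes "curr V X j b (g \<cdot> Sym V X j) = curr V X j b (h \<cdot> Sym V X j)"
    "X \<in> Obj V" "j \<in> Obj V" "g \<in> Arr V" "h \<in> Arr V" "Dom V g = j \<otimes> X" "Dom V h = j \<otimes> X" "Cod V g = b" "Cod V h = b"
  shows "g = h"
proof (rule iso_epic)
  show "g \<cdot> Sym V X j = h \<cdot> Sym V X j"
    using arg_cong[OF assms(1), of "\<lambda>k. Ev V j b \<cdot> (k \<boxtimes> Id V j)"] assms(2-) by simp
qed (use assms in auto)

lemma is_cotensor_iff_univ: "is_cotensor V C j c l \<kappa> \<longleftrightarrow> univ C j c l \<kappa>"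
proof
  assume *: "is_cotensor V C j c l \<kappa>"
  hence ty [simp]: "c \<in> VObj C" "l \<in> VObj C" "\<kappa> \<in> Arr V" "Dom V \<kappa> = j" "Cod V \<kappa> = VHom C l c"
    by (auto simp: is_cotensor_def)
  have j [simp]: "j \<in> Obj V" using dom_cod_obj(1)[of \<kappa>] by simp
  show "univ C j c l \<kappa>"
  proof (rule univI)
    fix d X g assume d [simp]: "d \<in> VObj C" "X \<in> Obj V" and g: "g \<in> hom V (j \<otimes> X) (VHom C d c)"
    note [simp] = cot_cmp_V[OF ty(1,2) d(1) ty(3-5) j]
    have iso: "iso V (cot_cmp V C j c l \<kappa> d)" using * by (auto simp: is_cotensor_def)
    let ?f = "inv_arr V (cot_cmp V C j c l \<kappa> d) \<cdot> curr V X j (VHom C d c) (g \<cdot> Sym V X j)"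
    have f [simp]: "?f \<in> Arr V" "Dom V ?f = X" "Cod V ?f = VHom C d l" using iso g by auto
    have "cot_cmp V C j c l \<kappa> d \<cdot> ?f = curr V X j (VHom C d c) (g \<cdot> Sym V X j)"
      using g iso by auto
    hence "curr V X j (VHom C d c) (gc C d l c \<kappa> ?f \<cdot> Sym V X j) = curr V X j (VHom C d c) (g \<cdot> Sym V X j)"
      by (subst (asm) cot_cmp_comp) (simp_all add: f del: inv_arr_V)
    hence "gc C d l c \<kappa> ?f = g"
      by (rule curr_sym_inject) (use g f in \<open>auto simp del: inv_arr_V\<close>)
    thus "\<exists>f. f \<in> hom V X (VHom C d l) \<and> gc C d l c \<kappa> f = g" using f unfolding hom_V by blast
  next
    fix d X f g assume d [simp]: "d \<in> VObj C" "X \<in> Obj V"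
      and fg: "f \<in> hom V X (VHom C d l)" "g \<in> hom V X (VHom C d l)" "gc C d l c \<kappa> f = gc C d l c \<kappa> g"
    note [simp] = cot_cmp_V[OF ty(1,2) d(1) ty(3-5) j]
    have iso: "iso V (cot_cmp V C j c l \<kappa> d)" using * by (auto simp: is_cotensor_def)
    have "cot_cmp V C j c l \<kappa> d \<cdot> f = cot_cmp V C j c l \<kappa> d \<cdot> g"
      using fg by (simp add: cot_cmp_comp)
    thus "f = g" by (rule iso_monic[OF iso]) (use fg in auto)
  qed auto
next
  assume u: "univ C j c l \<kappa>"
  note [simp] = univ_V[OF u]
  show "is_cotensor V C j c l \<kappa>"
    unfolding is_cotensor_def
  proof (intro conjI ballI)
    fix d assume d [simp]: "d \<in> VObj C"
    let ?X = "IHom V j (VHom C d c)" and ?c = "cot_cmp V C j c l \<kappa> d"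
    note [simp] = cot_cmp_V[OF univ_V(1,2)[OF u] d univ_V(3-6)[OF u]]
    \<comment> \<open>Yoneda: the inverse is the factorisation of the generic arrow of grade
      \<open>j \<otimes> ?X\<close>, which is evaluation.\<close>
    let ?f = "clift C c l \<kappa> d ?X (Ev V j (VHom C d c) \<cdot> Sym V j ?X)"
    have f [simp]: "?f \<in> Arr V" "Dom V ?f = ?X" "Cod V ?f = VHom C d l"
      "gc C d l c \<kappa> ?f = Ev V j (VHom C d c) \<cdot> Sym V j ?X"
      by (rule clift_V[OF u]; simp)+
    have "?c \<cdot> ?f = curr V ?X j (VHom C d c) (Ev V j (VHom C d c))"
      by (subst cot_cmp_comp) auto
    also have "\<dots> = Id V ?X"
      by (rule ev_inject[of j "VHom C d c"]) auto
    finally have 1: "?c \<cdot> ?f = Id V ?X" .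
    have "curr V (VHom C d l) j (VHom C d c) (gc C d l c \<kappa> (?f \<cdot> ?c) \<cdot> Sym V (VHom C d l) j) = ?c \<cdot> ?f \<cdot> ?c"
      by (subst cot_cmp_comp) auto
    also have "\<dots> = ?c \<cdot> Id V (VHom C d l)"
      by (subst comp_ext[OF 1]) auto
    also have "\<dots> = curr V (VHom C d l) j (VHom C d c) (gc C d l c \<kappa> (Id V (VHom C d l)) \<cdot> Sym V (VHom C d l) j)"
      by (subst cot_cmp_comp) auto
    finally have "gc C d l c \<kappa> (?f \<cdot> ?c) = gc C d l c \<kappa> (Id V (VHom C d l))"
      by (rule curr_sym_inject) auto
    hence 2: "?f \<cdot> ?c = Id V (VHom C d l)"
      by (rule univ_inj[OF u]) auto
    show "iso V ?c" by (rule isoI[of _ ?f]) (simp_all add: 1 2)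
  qed auto
qed

text \<open>The actions \<open>cot_arr\<close> and the structure functor of
  \<open>object_theory\<close> are defined by such inverses of \<open>cot_cmp\<close>. The last
  equation replaces the formula by its universal property.\<close>

lemma cot_lift:
  assumes u: "univ C j c l \<kappa>" and [simp]: "d \<in> VObj C" "X \<in> Obj V"
    and h [simp]: "h \<in> Arr V" "Dom V h = X \<otimes> j" "Cod V h = VHom C d c"
  defines "f \<equiv> inv_arr V (cot_cmp V C j c l \<kappa> d) \<cdot> curr V X j (VHom C d c) h"
  shows "f \<in> Arr V" "Dom V f = X" "Cod V f = VHom C d l" "gc C d l c \<kappa> f = h \<cdot> Sym V j X"
proof -
  note [simp] = univ_V[OF u] cot_cmp_V[OF univ_V(1,2)[OF u] assms(2) univ_V(3-6)[OF u]]
  have iso [simp]: "iso V (cot_cmp V C j c l \<kappa> d)"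
    using u[folded is_cotensor_iff_univ] assms(2) unfolding is_cotensor_def by blast
  show f [simp]: "f \<in> Arr V" "Dom V f = X" "Cod V f = VHom C d l" by (simp_all add: f_def)
  have "curr V X j (VHom C d c) (gc C d l c \<kappa> f \<cdot> Sym V X j) = cot_cmp V C j c l \<kappa> d \<cdot> f"
    by (subst cot_cmp_comp) auto
  also have "\<dots> = curr V X j (VHom C d c) ((h \<cdot> Sym V j X) \<cdot> Sym V X j)"
    by (simp add: f_def)
  finally show "gc C d l c \<kappa> f = h \<cdot> Sym V j X"
    by (rule curr_sym_inject) auto
qed

text \<open>This is \<open>[k, [j, c]] = [j \<otimes> k, c]\<close>: after reassociating the grade,
  an arrow is factored through \<open>\<kappa>\<close> and the result through
  \<open>\<mu>\<close>.\<close>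

lemma univ_comp:
  assumes u: "univ C j c l \<kappa>" and w: "univ C k l m \<mu>"
  shows "univ C (j \<otimes> k) c m (gc C m l c \<kappa> \<mu>)"
proof (rule univI)
  note [simp] = univ_V[OF u] univ_V[OF w]
  fix d X g assume [simp]: "d \<in> VObj C" "X \<in> Obj V" and "g \<in> hom V ((j \<otimes> k) \<otimes> X) (VHom C d c)"
  hence [simp]: "g \<in> Arr V" "Dom V g = (j \<otimes> k) \<otimes> X" "Cod V g = VHom C d c" by auto
  define h where "h = clift C c l \<kappa> d (k \<otimes> X) (g \<cdot> inv_arr V (Assoc V j k X))"
  have h [simp]: "h \<in> Arr V" "Dom V h = k \<otimes> X" "Cod V h = VHom C d l"
    "gc C d l c \<kappa> h = g \<cdot> inv_arr V (Assoc V j k X)"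
    unfolding h_def by (rule clift_V[OF u]; simp)+
  define f where "f = clift C l m \<mu> d X h"
  have f [simp]: "f \<in> Arr V" "Dom V f = X" "Cod V f = VHom C d m" "gc C d m l \<mu> f = h"
    unfolding f_def by (rule clift_V[OF w]; simp)+
  have "gc C d m c (gc C m l c \<kappa> \<mu>) f = g" by (simp add: gc_assoc)
  thus "\<exists>f. f \<in> hom V X (VHom C d m) \<and> gc C d m c (gc C m l c \<kappa> \<mu>) f = g"
    using f by (intro exI[of _ f]) simp
next
  note [simp] = univ_V[OF u] univ_V[OF w]
  fix d X f g assume [simp]: "d \<in> VObj C" "X \<in> Obj V" and fg: "f \<in> hom V X (VHom C d m)" "g \<in> hom V X (VHom C d m)"
    "gc C d m c (gc C m l c \<kappa> \<mu>) f = gc C d m c (gc C m l c \<kappa> \<mu>) g"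
  have "gc C d l c \<kappa> (gc C d m l \<mu> f) \<cdot> Assoc V j k X = gc C d l c \<kappa> (gc C d m l \<mu> g) \<cdot> Assoc V j k X"
    using fg by (simp add: gc_assoc)
  hence "gc C d l c \<kappa> (gc C d m l \<mu> f) = gc C d l c \<kappa> (gc C d m l \<mu> g)"
    by (rule iso_epic[rotated]) (use fg in auto)
  hence "gc C d m l \<mu> f = gc C d m l \<mu> g"
    by (rule univ_inj[OF u]) (use fg in auto)
  thus "f = g" by (rule univ_inj[OF w]) (use fg in auto)
qed (use univ_V[OF u] univ_V[OF w] in auto)

text \<open>Arrows into \<open>l\<close> are tested by composing with \<open>\<kappa>\<close>, which
  turns a factorisation problem for \<open>\<mu>\<close> into one for the composite. This is how a
  cotensor \<open>[k, l]\<close> is recognised when only cotensors of \<open>c\<close> are under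
  control.\<close>

lemma univ_cancel:
  assumes u: "univ C j c l \<kappa>" and w: "univ C (j \<otimes> k) c m (gc C m l c \<kappa> \<mu>)"
    and ty [simp]: "\<mu> \<in> Arr V" "Dom V \<mu> = k" "Cod V \<mu> = VHom C m l"
  shows "univ C k l m \<mu>"
proof -
  note [simp] = univ_V[OF u] univ_V(2)[OF w]
  have [simp]: "k \<in> Obj V" using dom_cod_obj(1)[of \<mu>] by simp
  show ?thesis
  proof (rule univI)
    fix d X g assume [simp]: "d \<in> VObj C" "X \<in> Obj V" and g: "g \<in> hom V (k \<otimes> X) (VHom C d l)"
    let ?g = "gc C d l c \<kappa> g \<cdot> Assoc V j k X"
    obtain f where f: "f \<in> hom V X (VHom C d m)" "gc C d m c (gc C m l c \<kappa> \<mu>) f = ?g"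
      using clift_V[OF w, of d X ?g] g by auto
    hence "gc C d l c \<kappa> (gc C d m l \<mu> f) \<cdot> Assoc V j k X = ?g"
      by (simp add: gc_assoc)
    hence "gc C d l c \<kappa> (gc C d m l \<mu> f) = gc C d l c \<kappa> g"
      by (rule iso_epic[rotated]) (use f g in auto)
    hence "gc C d m l \<mu> f = g" by (rule univ_inj[OF u]) (use f g in auto)
    thus "\<exists>f. f \<in> hom V X (VHom C d m) \<and> gc C d m l \<mu> f = g" using f by blast
  next
    fix d X f g assume [simp]: "d \<in> VObj C" "X \<in> Obj V" and fg: "f \<in> hom V X (VHom C d m)" "g \<in> hom V X (VHom C d m)"
      "gc C d m l \<mu> f = gc C d m l \<mu> g"
    have "gc C d m c (gc C m l c \<kappa> \<mu>) f = gc C d m c (gc C m l c \<kappa> \<mu>) g"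
      using fg by (simp add: gc_assoc)
    thus "f = g" by (rule univ_inj[OF w]) (use fg in auto)
  qed auto
qed

lemma univ_reindex:
  assumes u: "univ C j c l \<kappa>" and v [simp]: "iso V v" "Cod V v = j" "Dom V v = k"
  shows "univ C k c l (\<kappa> \<cdot> v)"
proof -
  note [simp] = univ_V[OF u] iso_arr[OF v(1)]
  have [simp]: "k \<in> Obj V" using dom_cod_obj(1)[of v] by simp
  show ?thesis
  proof (rule univI)
    fix d X g assume [simp]: "d \<in> VObj C" "X \<in> Obj V" and g: "g \<in> hom V (k \<otimes> X) (VHom C d c)"
    let ?g = "g \<cdot> (inv_arr V v \<boxtimes> Id V X)"
    obtain f where f: "f \<in> hom V X (VHom C d l)" "gc C d l c \<kappa> f = ?g"
      using clift_V[OF u, of d X ?g] g by auto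
    hence "gc C d l c (\<kappa> \<cdot> v) f = g"
      using g by (simp add: gc_reindex1 ten_comp)
    thus "\<exists>f. f \<in> hom V X (VHom C d l) \<and> gc C d l c (\<kappa> \<cdot> v) f = g" using f by blast
  next
    fix d X f g assume [simp]: "d \<in> VObj C" "X \<in> Obj V" and fg: "f \<in> hom V X (VHom C d l)" "g \<in> hom V X (VHom C d l)"
      "gc C d l c (\<kappa> \<cdot> v) f = gc C d l c (\<kappa> \<cdot> v) g"
    have "gc C d l c \<kappa> f \<cdot> (v \<boxtimes> Id V X) = gc C d l c \<kappa> g \<cdot> (v \<boxtimes> Id V X)"
      using fg by (simp add: gc_reindex1)
    hence "gc C d l c \<kappa> f = gc C d l c \<kappa> g"
      by (rule iso_epic[rotated]) (use fg in auto)
    thus "f = g" by (rule univ_inj[OF u]) (use fg in auto)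
  qed auto
qed

lemma univ_ract:
  assumes u: "univ C j c l \<kappa>" and t: "uinverse V C m l t s" and m [simp]: "m \<in> VObj C"
  shows "univ C j c m (ract C m l c \<kappa> t)"
proof (rule univI)
  note [simp] = univ_V[OF u] uinverse_V[OF t]
  fix d X g assume [simp]: "d \<in> VObj C" "X \<in> Obj V" and g: "g \<in> hom V (j \<otimes> X) (VHom C d c)"
  obtain f where f: "f \<in> hom V X (VHom C d l)" "gc C d l c \<kappa> f = g"
    using clift_V[OF u, of d X g] g by auto
  have "gc C d m c (ract C m l c \<kappa> t) (lact C d l m s f) = g"
    using f uinverse_lact[OF C uinverse_sym[OF t], of d f] by (simp add: gc_ract_lact)
  thus "\<exists>f. f \<in> hom V X (VHom C d m) \<and> gc C d m c (ract C m l c \<kappa> t) f = g"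
    using f by (intro exI[of _ "lact C d l m s f"]) simp
next
  note [simp] = univ_V[OF u] uinverse_V[OF t]
  fix d X f g assume [simp]: "d \<in> VObj C" "X \<in> Obj V" and fg: "f \<in> hom V X (VHom C d m)" "g \<in> hom V X (VHom C d m)"
    "gc C d m c (ract C m l c \<kappa> t) f = gc C d m c (ract C m l c \<kappa> t) g"
  have "gc C d l c \<kappa> (lact C d m l t f) = gc C d l c \<kappa> (lact C d m l t g)"
    using fg by (simp add: gc_ract_lact)
  hence "lact C d m l t f = lact C d m l t g" by (rule univ_inj[OF u]) (use fg in auto)
  thus "f = g" by (rule uinverse_lact_inj[OF C t]) (use fg in auto)
qed (use univ_V[OF u] uinverse_V[OF t] in auto)

lemma univ_lact:
  assumes u: "univ C j c l \<kappa>" and t: "uinverse V C c m t s" and m [simp]: "m \<in> VObj C"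
  shows "univ C j m l (lact C l c m t \<kappa>)"
proof (rule univI)
  note [simp] = univ_V[OF u] uinverse_V[OF t]
  fix d X g assume [simp]: "d \<in> VObj C" "X \<in> Obj V" and g: "g \<in> hom V (j \<otimes> X) (VHom C d m)"
  obtain f where f: "f \<in> hom V X (VHom C d l)" "gc C d l c \<kappa> f = lact C d m c s g"
    using clift_V[OF u, of d X "lact C d m c s g"] g by auto
  have "gc C d l m (lact C l c m t \<kappa>) f = lact C d c m t (gc C d l c \<kappa> f)"
    using f(1) by (simp add: lact_gc)
  also have "\<dots> = g"
    using f g uinverse_lact[OF C uinverse_sym[OF t], of d g] by simp
  finally show "\<exists>f. f \<in> hom V X (VHom C d l) \<and> gc C d l m (lact C l c m t \<kappa>) f = g" using f by blast
next
  note [simp] = univ_V[OF u] uinverse_V[OF t]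
  fix d X f g assume [simp]: "d \<in> VObj C" "X \<in> Obj V" and fg: "f \<in> hom V X (VHom C d l)" "g \<in> hom V X (VHom C d l)"
    "gc C d l m (lact C l c m t \<kappa>) f = gc C d l m (lact C l c m t \<kappa>) g"
  have "lact C d c m t (gc C d l c \<kappa> f) = lact C d c m t (gc C d l c \<kappa> g)"
    using fg by (simp add: lact_gc)
  hence "gc C d l c \<kappa> f = gc C d l c \<kappa> g"
    by (rule uinverse_lact_inj[OF C t]) (use fg in auto)
  thus "f = g" by (rule univ_inj[OF u]) (use fg in auto)
qed (use univ_V[OF u] uinverse_V[OF t] in auto)

lemma univ_ract_inj:
  assumes u: "univ C j c l \<kappa>" and eq: "ract C d l c \<kappa> t = ract C d l c \<kappa> s" and [simp]: "d \<in> VObj C"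
    and t: "t \<in> hom V (Unit V) (VHom C d l)" "s \<in> hom V (Unit V) (VHom C d l)"
  shows "t = s"
proof -
  note [simp] = univ_V[OF u]
  have "gc C d l c \<kappa> t = gc C d l c \<kappa> s"
    by (rule iso_epic[OF _ eq[unfolded ract_def]]) (use t in \<open>auto intro!: isoI[of _ "RUnit V j"]\<close>)
  thus ?thesis by (rule univ_inj[OF u]) (use t in auto)
qed

lemma univ_unit_lift:
  assumes u: "univ C j c l \<kappa>" and [simp]: "d \<in> VObj C" and f: "f \<in> hom V j (VHom C d c)"
  obtains t where "t \<in> hom V (Unit V) (VHom C d l)" "ract C d l c \<kappa> t = f"
proof
  note [simp] = univ_V[OF u]
  define t where "t = clift C c l \<kappa> d (Unit V) (f \<cdot> RUnit V j)"
  have t [simp]: "t \<in> Arr V" "Dom V t = Unit V" "Cod V t = VHom C d l" "gc C d l c \<kappa> t = f \<cdot> RUnit V j"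
    unfolding t_def by (rule clift_V[OF u]; use f in simp)+
  show "t \<in> hom V (Unit V) (VHom C d l)" "ract C d l c \<kappa> t = f" using f by (simp_all add: ract_def)
qed

text \<open>Each counit is lifted through the other; both composites of the lifts are identities,
  because they fix a counit.\<close>

lemma univ_unique:
  assumes u: "univ C j c l \<kappa>" and w: "univ C j c m \<mu>"
  obtains t s where "uinverse V C m l t s" "ract C m l c \<kappa> t = \<mu>"
proof -
  note [simp] = univ_V[OF u] univ_V[OF w]
  obtain t where t: "t \<in> hom V (Unit V) (VHom C m l)" "ract C m l c \<kappa> t = \<mu>"
    by (rule univ_unit_lift[OF u, of m \<mu>]) auto
  obtain s where s: "s \<in> hom V (Unit V) (VHom C l m)" "ract C l m c \<mu> s = \<kappa>"
    by (rule univ_unit_lift[OF w, of l \<kappa>]) auto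
  have "ract C l l c \<kappa> (lact C l m l t s) = ract C l m c (ract C m l c \<kappa> t) s"
    using t(1) s(1) by (simp add: ract_ract ract_eq_lact)
  also have "\<dots> = ract C l l c \<kappa> (VId C l)" using t s by simp
  finally have 1: "lact C l m l t s = VId C l"
    by (rule univ_ract_inj[OF u]) (use t s in auto)
  have "ract C m m c \<mu> (lact C m l m s t) = ract C m l c (ract C l m c \<mu> s) t"
    using t(1) s(1) by (simp add: ract_ract ract_eq_lact)
  also have "\<dots> = ract C m m c \<mu> (VId C m)" using t s by simp
  finally have 2: "lact C m l m s t = VId C m"
    by (rule univ_ract_inj[OF w]) (use t s in auto)
  have "uinverse V C m l t s" using 1 2 t s by (subst uinverse_iff) auto
  thus thesis using that t by blast
qed

end

text \<open>
  It suffices to test the cotensors \<open>j = [j, I]\<close>: any cotensor \<open>l = [j, k]\<close> in \<open>T\<close> is also a cotensor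
  \<open>[k \<otimes> j, I]\<close>, hence isomorphic to the object \<open>k \<otimes> j\<close>.
\<close>

lemma preserves_cotensorsI:
  assumes C: "vcategory V C" and T: "vcategory V T" and \<J>: "system_of_arities V \<J>" "VObj T = \<J>"
    and \<tau>: "\<And>j. j \<in> \<J> \<Longrightarrow> univ T j (Unit V) j (\<tau> j)"
    and A: "vfunctor V T C A"
    and p: "\<And>j. j \<in> \<J> \<Longrightarrow> univ C j (FO A (Unit V)) (FO A j) (FA A j (Unit V) \<cdot> \<tau> j)"
  shows "preserves_cotensors V \<J> T C A"
  unfolding preserves_cotensors_def is_cotensor_iff_univ[OF C] is_cotensor_iff_univ[OF T]
proof (intro ballI allI impI)
  fix j k l \<kappa> assume j: "j \<in> \<J>" and u: "univ T j k l \<kappa>"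
  note [simp] = C T univ_V[OF u] vfunctor_obj[OF A] vfunctor_arr[OF A]
  have k: "k \<in> \<J>" "k \<otimes> j \<in> \<J>" "l \<in> \<J>" using univ_V[OF u] \<J> j by (auto simp: system_of_arities_def)
  have [simp]: "k \<in> Obj V" "Unit V \<in> VObj T" "k \<otimes> j \<in> VObj T" using k \<J> by (auto simp: system_of_arities_def)
  note [simp] = univ_V[OF \<tau>[OF k(1)]] univ_V[OF \<tau>[OF k(2)]]
  have "univ T (k \<otimes> j) (Unit V) l (gc T l k (Unit V) (\<tau> k) \<kappa>)"
    by (rule univ_comp[OF T \<tau>[OF k(1)] u])
  then obtain t s where t: "uinverse V T l (k \<otimes> j) t s"
    "ract T l (k \<otimes> j) (Unit V) (\<tau> (k \<otimes> j)) t = gc T l k (Unit V) (\<tau> k) \<kappa>"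
    by (rule univ_unique[OF T \<tau>[OF k(2)]])
  note [simp] = uinverse_V[OF t(1)]
  \<comment> \<open>\<open>t\<close> identifies \<open>l\<close> with \<open>k \<otimes> j\<close>
    in \<open>T\<close>, so its image transports the cotensor \<open>FO A (k \<otimes> j)\<close>
    supplied by \<open>p\<close> to \<open>FO A l\<close>. The new counit is then rewritten to pass
    through that of \<open>FO A k\<close>, which \<open>univ_cancel\<close> removes.\<close>
  have "univ C (k \<otimes> j) (FO A (Unit V)) (FO A l) (ract C (FO A l) (FO A (k \<otimes> j)) (FO A (Unit V))
      (FA A (k \<otimes> j) (Unit V) \<cdot> \<tau> (k \<otimes> j)) (FA A l (k \<otimes> j) \<cdot> t))"
    by (rule univ_ract[OF C p[OF k(2)] vfunctor_uinverse[OF C T A t(1)]]) auto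
  also have "ract C (FO A l) (FO A (k \<otimes> j)) (FO A (Unit V))
      (FA A (k \<otimes> j) (Unit V) \<cdot> \<tau> (k \<otimes> j)) (FA A l (k \<otimes> j) \<cdot> t) =
      FA A l (Unit V) \<cdot> gc T l k (Unit V) (\<tau> k) \<kappa>"
    unfolding t(2)[symmetric] by (subst vfunctor_ract[OF C T A]) auto
  also have "\<dots> = gc C (FO A l) (FO A k) (FO A (Unit V)) (FA A k (Unit V) \<cdot> \<tau> k) (FA A l k \<cdot> \<kappa>)"
    by (subst vfunctor_gc[OF C T A]) auto
  finally show "univ C j (FO A k) (FO A l) (FA A l k \<cdot> \<kappa>)"
    by (rule univ_cancel[OF C p[OF k(1)]]) auto
qed

end

section \<open>The dual of the category of arities\<close>

context smcc
begin

text \<open>The axioms are posed in the calculus of \<open>gc\<close> and evaluated at the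
  identities of the hom-objects, which are the generic graded arrows.\<close>

lemma vcategoryI:
  assumes hom: "\<And>a b. a \<in> VObj C \<Longrightarrow> b \<in> VObj C \<Longrightarrow> VHom C a b \<in> Obj V"
    and comp: "\<And>a b c. a \<in> VObj C \<Longrightarrow> b \<in> VObj C \<Longrightarrow> c \<in> VObj C \<Longrightarrow>
        VComp C a b c \<in> hom V (VHom C b c \<otimes> VHom C a b) (VHom C a c)"
    and id: "\<And>a. a \<in> VObj C \<Longrightarrow> VId C a \<in> hom V (Unit V) (VHom C a a)"
    and assoc: "\<And>a b c d x y z. a \<in> VObj C \<Longrightarrow> b \<in> VObj C \<Longrightarrow> c \<in> VObj C \<Longrightarrow> d \<in> VObj C \<Longrightarrow>
        x \<in> hom V (VHom C a b) (VHom C a b) \<Longrightarrow> y \<in> hom V (VHom C b c) (VHom C b c) \<Longrightarrow>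
        z \<in> hom V (VHom C c d) (VHom C c d) \<Longrightarrow>
        gc C a b d (gc C b c d z y) x = gc C a c d z (gc C a b c y x) \<cdot> Assoc V (VHom C c d) (VHom C b c) (VHom C a b)"
    and unit: "\<And>a b x. a \<in> VObj C \<Longrightarrow> b \<in> VObj C \<Longrightarrow> x \<in> hom V (VHom C a b) (VHom C a b) \<Longrightarrow>
        gc C a b b (VId C b) x = x \<cdot> LUnit V (VHom C a b) \<and> gc C a a b x (VId C a) = x \<cdot> RUnit V (VHom C a b)"
  shows "vcategory V C"
  unfolding vcategory_def
proof (intro conjI ballI)
  fix a b c d assume *: "a \<in> VObj C" "b \<in> VObj C" "c \<in> VObj C" "d \<in> VObj C"
  note [simp] = hom * comp[unfolded hom_V]
  show "VComp C a b d \<cdot> (VComp C b c d \<boxtimes> Id V (VHom C a b)) = VComp C a c d \<cdot>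
      (Id V (VHom C c d) \<boxtimes> VComp C a b c) \<cdot> Assoc V (VHom C c d) (VHom C b c) (VHom C a b)"
    using assoc[OF *, of "Id V (VHom C a b)" "Id V (VHom C b c)" "Id V (VHom C c d)"] by (simp add: gc_def)
next
  fix a b assume *: "a \<in> VObj C" "b \<in> VObj C"
  note [simp] = hom * comp[unfolded hom_V] id[unfolded hom_V]
  show "VComp C a b b \<cdot> (VId C b \<boxtimes> Id V (VHom C a b)) = LUnit V (VHom C a b)"
    "VComp C a a b \<cdot> (Id V (VHom C a b) \<boxtimes> VId C a) = RUnit V (VHom C a b)"
    using unit[OF *, of "Id V (VHom C a b)"] by (simp_all add: gc_def)
qed (use hom comp id in auto)

section \<open>The base category enriched over itself\<close>

lemma gc_self_V:
  assumes "a \<in> Obj V" "b \<in> Obj V" "c \<in> Obj V" "y \<in> hom V Y (IHom V b c)" "x \<in> hom V X (IHom V a b)"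
  shows "gc (self_vcat V) a b c y x \<in> hom V (Y \<otimes> X) (IHom V a c)"
    and "Ev V a c \<cdot> (gc (self_vcat V) a b c y x \<boxtimes> Id V a) =
      Ev V b c \<cdot> (y \<boxtimes> (Ev V a b \<cdot> (x \<boxtimes> Id V a))) \<cdot> Assoc V Y X a"
proof -
  have [simp]: "Y \<in> Obj V" "X \<in> Obj V" using assms by auto
  let ?E = "Ev V b c \<cdot> (Id V (IHom V b c) \<boxtimes> Ev V a b) \<cdot> Assoc V (IHom V b c) (IHom V a b) a"
  let ?c = "curr V (IHom V b c \<otimes> IHom V a b) a c ?E"
  show "gc (self_vcat V) a b c y x \<in> hom V (Y \<otimes> X) (IHom V a c)"
    using assms by (simp add: gc_def self_vcat_def)
  have "Ev V a c \<cdot> (gc (self_vcat V) a b c y x \<boxtimes> Id V a) = Ev V a c \<cdot> (?c \<boxtimes> Id V a) \<cdot> ((y \<boxtimes> x) \<boxtimes> Id V a)"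
    using assms by (simp add: gc_def self_vcat_def ten_comp)
  also have "\<dots> = ?E \<cdot> ((y \<boxtimes> x) \<boxtimes> Id V a)"
    using assms by (subst comp_ext[OF curr(4)]) auto
  also have "\<dots> = Ev V b c \<cdot> (Id V (IHom V b c) \<boxtimes> Ev V a b) \<cdot> (y \<boxtimes> (x \<boxtimes> Id V a)) \<cdot> Assoc V Y X a"
    using assms assoc_nat[of y x "Id V a" "IHom V b c" "IHom V a b" a] by simp
  also have "\<dots> = Ev V b c \<cdot> (y \<boxtimes> (Ev V a b \<cdot> (x \<boxtimes> Id V a))) \<cdot> Assoc V Y X a"
    using assms by (simp add: ten_comp_ext)
  finally show "Ev V a c \<cdot> (gc (self_vcat V) a b c y x \<boxtimes> Id V a) =
      Ev V b c \<cdot> (y \<boxtimes> (Ev V a b \<cdot> (x \<boxtimes> Id V a))) \<cdot> Assoc V Y X a" .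
qed

text \<open>Everything is compared after evaluation, where a composite evaluates in two stages by
  \<open>gc_self_V\<close>. Associativity thereby becomes the pentagon, and the unit laws become
  \<open>lunit_ten\<close> and the triangle.\<close>

lemma vcategory_self: "vcategory V (self_vcat V)"
proof (rule vcategoryI)
  fix a b c d x y z
  assume "a \<in> VObj (self_vcat V)" "b \<in> VObj (self_vcat V)" "c \<in> VObj (self_vcat V)" "d \<in> VObj (self_vcat V)"
    "x \<in> hom V (VHom (self_vcat V) a b) (VHom (self_vcat V) a b)"
    "y \<in> hom V (VHom (self_vcat V) b c) (VHom (self_vcat V) b c)"
    "z \<in> hom V (VHom (self_vcat V) c d) (VHom (self_vcat V) c d)"
  hence ob [simp]: "a \<in> Obj V" "b \<in> Obj V" "c \<in> Obj V" "d \<in> Obj V"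
    and x [simp]: "x \<in> Arr V" "Dom V x = IHom V a b" "Cod V x = IHom V a b"
    and y [simp]: "y \<in> Arr V" "Dom V y = IHom V b c" "Cod V y = IHom V b c"
    and z [simp]: "z \<in> Arr V" "Dom V z = IHom V c d" "Cod V z = IHom V c d" by (auto simp: self_vcat_def)
  let ?S = "self_vcat V" and ?X = "IHom V a b" and ?Y = "IHom V b c" and ?Z = "IHom V c d"
  have yx: "gc ?S a b c y x \<in> hom V (?Y \<otimes> ?X) (IHom V a c)" by (rule gc_self_V) auto
  have zy: "gc ?S b c d z y \<in> hom V (?Z \<otimes> ?Y) (IHom V b d)" by (rule gc_self_V) auto
  have zyx: "gc ?S a b d (gc ?S b c d z y) x \<in> hom V ((?Z \<otimes> ?Y) \<otimes> ?X) (IHom V a d)"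
    using zy by (intro gc_self_V) auto
  have zyx': "gc ?S a c d z (gc ?S a b c y x) \<in> hom V (?Z \<otimes> (?Y \<otimes> ?X)) (IHom V a d)"
    using yx by (intro gc_self_V) auto
  let ?x = "Ev V a b \<cdot> (x \<boxtimes> Id V a)" let ?y = "Ev V b c \<cdot> (y \<boxtimes> ?x)"
  have "Ev V a d \<cdot> (gc ?S a b d (gc ?S b c d z y) x \<boxtimes> Id V a)
      = Ev V b d \<cdot> (gc ?S b c d z y \<boxtimes> ?x) \<cdot> Assoc V (?Z \<otimes> ?Y) ?X a"
    using zy by (subst gc_self_V(2)[of _ _ _ _ "?Z \<otimes> ?Y" _ ?X]) auto
  also have "\<dots> = Ev V b d \<cdot> (gc ?S b c d z y \<boxtimes> Id V b) \<cdot> (Id V (?Z \<otimes> ?Y) \<boxtimes> ?x) \<cdot> Assoc V (?Z \<otimes> ?Y) ?X a"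
    using zy by (simp add: ten_comp_ext del: ten_id)
  also have "\<dots> = (Ev V c d \<cdot> (z \<boxtimes> (Ev V b c \<cdot> (y \<boxtimes> Id V b))) \<cdot> Assoc V ?Z ?Y b)
      \<cdot> ((Id V ?Z \<boxtimes> Id V ?Y) \<boxtimes> ?x) \<cdot> Assoc V (?Z \<otimes> ?Y) ?X a"
    using zy by (subst comp_ext[OF gc_self_V(2)[of _ _ _ _ "?Z" _ ?Y]]) auto
  also have "\<dots> = Ev V c d \<cdot> (z \<boxtimes> ?y) \<cdot> Assoc V ?Z ?Y (?X \<otimes> a) \<cdot> Assoc V (?Z \<otimes> ?Y) ?X a"
    by (simp add: comp_ext[OF assoc_nat] ten_comp_ext ten_comp del: ten_id)
  also have "\<dots> = Ev V c d \<cdot> (z \<boxtimes> ?y) \<cdot> (Id V ?Z \<boxtimes> Assoc V ?Y ?X a)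
      \<cdot> Assoc V ?Z (?Y \<otimes> ?X) a \<cdot> (Assoc V ?Z ?Y ?X \<boxtimes> Id V a)"
    by (subst pentagon) auto
  also have "\<dots> = (Ev V c d \<cdot> (z \<boxtimes> (?y \<cdot> Assoc V ?Y ?X a))
      \<cdot> Assoc V ?Z (?Y \<otimes> ?X) a) \<cdot> (Assoc V ?Z ?Y ?X \<boxtimes> Id V a)"
    by (simp add: ten_comp_ext)
  also have "?y \<cdot> Assoc V ?Y ?X a = Ev V a c \<cdot> (gc ?S a b c y x \<boxtimes> Id V a)"
    by (subst gc_self_V(2)[of _ _ _ _ "?Y" _ ?X]) auto
  also have "(Ev V c d \<cdot> (z \<boxtimes> (Ev V a c \<cdot> (gc ?S a b c y x \<boxtimes> Id V a))) \<cdot> Assoc V ?Z (?Y \<otimes> ?X) a)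
      = Ev V a d \<cdot> (gc ?S a c d z (gc ?S a b c y x) \<boxtimes> Id V a)"
    using yx by (subst gc_self_V(2)[of _ _ _ _ "?Z" _ "?Y \<otimes> ?X"]) auto
  finally have "Ev V a d \<cdot> (gc ?S a b d (gc ?S b c d z y) x \<boxtimes> Id V a) =
      Ev V a d \<cdot> ((gc ?S a c d z (gc ?S a b c y x) \<cdot> Assoc V ?Z ?Y ?X) \<boxtimes> Id V a)"
    using zyx' by (simp add: ten_comp)
  hence "gc ?S a b d (gc ?S b c d z y) x = gc ?S a c d z (gc ?S a b c y x) \<cdot> Assoc V ?Z ?Y ?X"
    by (rule ev_inject) (use zyx zyx' in auto)
  thus "gc ?S a b d (gc ?S b c d z y) x = gc ?S a c d z (gc ?S a b c y x) \<cdot> Assoc V (VHom ?S c d) (VHom ?S b c) (VHom ?S a b)"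
    by (simp add: self_vcat_def)
next
  fix a b x assume "a \<in> VObj (self_vcat V)" "b \<in> VObj (self_vcat V)"
    "x \<in> hom V (VHom (self_vcat V) a b) (VHom (self_vcat V) a b)"
  hence ob [simp]: "a \<in> Obj V" "b \<in> Obj V"
    and x [simp]: "x \<in> Arr V" "Dom V x = IHom V a b" "Cod V x = IHom V a b" by (auto simp: self_vcat_def)
  let ?S = "self_vcat V" and ?X = "IHom V a b"
  have [simp]: "VId ?S c = curr V (Unit V) c c (LUnit V c)" for c by (simp add: self_vcat_def)
  have l: "gc ?S a b b (VId ?S b) x \<in> hom V (Unit V \<otimes> ?X) (IHom V a b)"
    and r: "gc ?S a a b x (VId ?S a) \<in> hom V (?X \<otimes> Unit V) (IHom V a b)" by (intro gc_self_V; simp)+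
  have "Ev V a b \<cdot> (gc ?S a b b (VId ?S b) x \<boxtimes> Id V a)
      = Ev V b b \<cdot> (VId ?S b \<boxtimes> (Ev V a b \<cdot> (x \<boxtimes> Id V a))) \<cdot> Assoc V (Unit V) ?X a"
    by (subst gc_self_V(2)[of _ _ _ _ "Unit V" _ ?X]) auto
  also have "\<dots> = Ev V b b \<cdot> (VId ?S b \<boxtimes> Id V b) \<cdot> (Id V (Unit V) \<boxtimes> (Ev V a b \<cdot> (x \<boxtimes> Id V a))) \<cdot> Assoc V (Unit V) ?X a"
    by (simp add: ten_comp_ext)
  also have "\<dots> = LUnit V b \<cdot> (Id V (Unit V) \<boxtimes> (Ev V a b \<cdot> (x \<boxtimes> Id V a))) \<cdot> Assoc V (Unit V) ?X a"
    by (simp add: comp_ext[OF curr(4)])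
  also have "\<dots> = Ev V a b \<cdot> (x \<boxtimes> Id V a) \<cdot> (LUnit V (?X \<otimes> a) \<cdot> Assoc V (Unit V) ?X a)"
    by (subst comp_ext[OF lunit_nat]) auto
  also have "\<dots> = Ev V a b \<cdot> ((x \<cdot> LUnit V ?X) \<boxtimes> Id V a)"
    by (subst lunit_ten) (auto simp: ten_comp)
  finally have 1: "gc ?S a b b (VId ?S b) x = x \<cdot> LUnit V ?X"
    by (rule ev_inject) (use l in auto)
  have "Ev V a b \<cdot> (gc ?S a a b x (VId ?S a) \<boxtimes> Id V a)
      = Ev V a b \<cdot> (x \<boxtimes> (Ev V a a \<cdot> (VId ?S a \<boxtimes> Id V a))) \<cdot> Assoc V ?X (Unit V) a"
    by (subst gc_self_V(2)[of _ _ _ _ ?X _ "Unit V"]) auto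
  also have "\<dots> = Ev V a b \<cdot> (x \<boxtimes> Id V a) \<cdot> ((Id V ?X \<boxtimes> LUnit V a) \<cdot> Assoc V ?X (Unit V) a)"
    by (simp add: ten_comp_ext)
  also have "\<dots> = Ev V a b \<cdot> ((x \<cdot> RUnit V ?X) \<boxtimes> Id V a)"
    by (subst triangle) (auto simp: ten_comp)
  finally have 2: "gc ?S a a b x (VId ?S a) = x \<cdot> RUnit V ?X"
    by (rule ev_inject) (use r in auto)
  show "gc ?S a b b (VId ?S b) x = x \<cdot> LUnit V (VHom ?S a b) \<and> gc ?S a a b x (VId ?S a) = x \<cdot> RUnit V (VHom ?S a b)"
    using 1 2 by (simp add: self_vcat_def)
qed (auto simp: self_vcat_def)

section \<open>Full subcategories and opposites of enriched categories\<close>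

lemma vcategory_full_sub:
  assumes "vcategory V C" "S \<subseteq> VObj C"
  shows "vcategory V (full_sub_vcat C S)"
proof -
  have "x \<in> VObj C" if "x \<in> S" for x using assms that by auto
  thus ?thesis using assms(1) unfolding vcategory_def full_sub_vcat_def by simp
qed

lemma gc_op:
  assumes "vcategory V C" "a \<in> VObj C" "b \<in> VObj C" "c \<in> VObj C"
    "y \<in> Arr V" "Cod V y = VHom C c b" "x \<in> Arr V" "Cod V x = VHom C b a"
  shows "gc (op_vcat V C) a b c y x = gc C c b a x y \<cdot> Sym V (Dom V y) (Dom V x)"
  using assms by (simp add: gc_def op_vcat_def sym_nat)

text \<open>Two ways of reversing a product of three factors, as needed for associativity in an
  opposite category. The hexagon is used for \<open>c\<close>, \<open>a\<close>, \<open>b\<close>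
  and for \<open>a\<close>, \<open>c\<close>, \<open>b\<close>, with the symmetries that cancel
  inserted in between.\<close>

lemma hexagon':
  assumes [simp]: "a \<in> Obj V" "b \<in> Obj V" "c \<in> Obj V"
  shows "(Id V c \<boxtimes> Sym V a b) \<cdot> Sym V (a \<otimes> b) c =
    Assoc V c b a \<cdot> (Sym V b c \<boxtimes> Id V a) \<cdot> Sym V a (b \<otimes> c) \<cdot> Assoc V a b c"
proof -
  have "iso V (Assoc V a b c \<cdot> Sym V c (a \<otimes> b) \<cdot> Assoc V c a b)"
    by (rule isoI[of _ "inv_arr V (Assoc V c a b) \<cdot> Sym V (a \<otimes> b) c \<cdot> inv_arr V (Assoc V a b c)"]) auto
  have hex: "(Id V a \<boxtimes> Sym V b c) \<cdot> Assoc V a b c \<cdot> Sym V c (a \<otimes> b) \<cdot> Assoc V c a b =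
      Assoc V a c b \<cdot> (Sym V c a \<boxtimes> Id V b)"
    by (subst hexagon) (auto simp: ten_comp_ext)
  have "Assoc V c b a \<cdot> (Sym V b c \<boxtimes> Id V a) \<cdot> Sym V a (b \<otimes> c) \<cdot> Assoc V a b c
      = Assoc V c b a \<cdot> Sym V a (c \<otimes> b) \<cdot> (Id V a \<boxtimes> Sym V b c) \<cdot> Assoc V a b c"
    using comp_ext[OF sym_nat[of "Id V a" "Sym V b c" a "c \<otimes> b"], of "Assoc V a b c"] by simp
  also have "\<dots> = Assoc V c b a \<cdot> Sym V a (c \<otimes> b) \<cdot> ((Id V a \<boxtimes> Sym V b c) \<cdot> Assoc V a b c \<cdot>
      Sym V c (a \<otimes> b) \<cdot> Assoc V c a b) \<cdot> inv_arr V (Assoc V c a b) \<cdot> Sym V (a \<otimes> b) c"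
    by simp
  also have "\<dots> = (Assoc V c b a \<cdot> Sym V a (c \<otimes> b) \<cdot> Assoc V a c b) \<cdot> (Sym V c a \<boxtimes> Id V b)
      \<cdot> inv_arr V (Assoc V c a b) \<cdot> Sym V (a \<otimes> b) c"
    unfolding hex by simp
  also have "\<dots> = (Id V c \<boxtimes> Sym V a b) \<cdot> Sym V (a \<otimes> b) c"
    by (subst hexagon) (auto simp: ten_comp_ext ten_comp)
  finally show ?thesis by simp
qed

lemma vcategory_op:
  assumes [simp]: "vcategory V C"
  shows "vcategory V (op_vcat V C)"
proof -
  have [simp]: "VObj (op_vcat V C) = VObj C" "VHom (op_vcat V C) a b = VHom C b a"
    "VComp (op_vcat V C) a b c = VComp C c b a \<cdot> Sym V (VHom C c b) (VHom C b a)"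
    "VId (op_vcat V C) a = VId C a" for a b c by (auto simp: op_vcat_def)
  show ?thesis
  proof (rule vcategoryI)
    fix a b c d x y z
    assume "a \<in> VObj (op_vcat V C)" "b \<in> VObj (op_vcat V C)" "c \<in> VObj (op_vcat V C)" "d \<in> VObj (op_vcat V C)"
      "x \<in> hom V (VHom (op_vcat V C) a b) (VHom (op_vcat V C) a b)"
      "y \<in> hom V (VHom (op_vcat V C) b c) (VHom (op_vcat V C) b c)"
      "z \<in> hom V (VHom (op_vcat V C) c d) (VHom (op_vcat V C) c d)"
    hence [simp]: "a \<in> VObj C" "b \<in> VObj C" "c \<in> VObj C" "d \<in> VObj C"
      "x \<in> Arr V" "Dom V x = VHom C b a" "Cod V x = VHom C b a"
      "y \<in> Arr V" "Dom V y = VHom C c b" "Cod V y = VHom C c b"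
      "z \<in> Arr V" "Dom V z = VHom C d c" "Cod V z = VHom C d c" by auto
    let ?X = "VHom C b a" and ?Y = "VHom C c b" and ?Z = "VHom C d c" and ?O = "op_vcat V C"
    have "gc ?O a b d (gc ?O b c d z y) x = gc C d b a x (gc C d c b y z) \<cdot> (Id V ?X \<boxtimes> Sym V ?Z ?Y) \<cdot> Sym V (?Z \<otimes> ?Y) ?X"
      by (simp add: gc_op gc_reindex2)
    also have "\<dots> = gc C d c a (gc C c b a x y) z \<cdot> (Sym V ?Y ?X \<boxtimes> Id V ?Z) \<cdot> Sym V ?Z (?Y \<otimes> ?X) \<cdot> Assoc V ?Z ?Y ?X"
      by (simp add: hexagon' gc_assoc)
    also have "\<dots> = gc ?O a c d z (gc ?O a b c y x) \<cdot> Assoc V ?Z ?Y ?X"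
      by (simp add: gc_op gc_reindex1)
    finally show "gc ?O a b d (gc ?O b c d z y) x = gc ?O a c d z (gc ?O a b c y x) \<cdot> Assoc V (VHom ?O c d) (VHom ?O b c) (VHom ?O a b)"
      by simp
  next
    fix a b x assume "a \<in> VObj (op_vcat V C)" "b \<in> VObj (op_vcat V C)"
      "x \<in> hom V (VHom (op_vcat V C) a b) (VHom (op_vcat V C) a b)"
    thus "gc (op_vcat V C) a b b (VId (op_vcat V C) b) x = x \<cdot> LUnit V (VHom (op_vcat V C) a b) \<and>
        gc (op_vcat V C) a a b x (VId (op_vcat V C) a) = x \<cdot> RUnit V (VHom (op_vcat V C) a b)"
      by (simp add: gc_op gc_id runit_sym lunit_sym)
  qed auto
qed

end

section \<open>The dual of the arities and its cotensors of the unit object\<close>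

locale arity_system = smcc V for V :: "('o, 'm) smc" (structure) +
  fixes \<J> :: "'o set"
  assumes arity_system: "system_of_arities V \<J>"
begin

lemma arities_V [simp]: "j \<in> \<J> \<Longrightarrow> j \<in> Obj V" "Unit V \<in> \<J>" "j \<in> \<J> \<Longrightarrow> k \<in> \<J> \<Longrightarrow> j \<otimes> k \<in> \<J>"
  using arity_system by (auto simp: system_of_arities_def)

abbreviation "\<O> \<equiv> op_arities V \<J>"

lemma op_arities_V [simp]: "VObj \<O> = \<J>" "VHom \<O> a b = IHom V b a"
  by (simp_all add: op_arities_def op_vcat_def full_sub_vcat_def self_vcat_def)

lemma op_arities [simp]: "vcategory V \<O>"
  unfolding op_arities_def
  by (intro vcategory_op vcategory_full_sub vcategory_self) (auto simp: self_vcat_def)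

lemma gc_op_arities:
  assumes "a \<in> \<J>" "b \<in> \<J>" "c \<in> \<J>" "y \<in> Arr V" "Cod V y = IHom V c b" "x \<in> Arr V" "Cod V x = IHom V b a"
  shows "gc \<O> a b c y x = gc (self_vcat V) c b a x y \<cdot> Sym V (Dom V y) (Dom V x)"
proof -
  let ?F = "full_sub_vcat (self_vcat V) \<J>"
  have "vcategory V ?F"
    by (intro vcategory_full_sub vcategory_self) (auto simp: self_vcat_def)
  hence "gc \<O> a b c y x = gc ?F c b a x y \<cdot> Sym V (Dom V y) (Dom V x)"
    unfolding op_arities_def by (rule gc_op) (use assms in \<open>auto simp: full_sub_vcat_def self_vcat_def\<close>)
  thus ?thesis by (simp add: gc_def full_sub_vcat_def)
qed

text \<open>The canonical isomorphism of \<open>j\<close> with \<open>IHom V I j\<close>. As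
  \<open>IHom V I j\<close> is the hom-object from \<open>j\<close> to \<open>I\<close> in the dual,
  it is the counit that makes \<open>j\<close> the cotensor \<open>[j, I]\<close> there.\<close>

definition \<kappa>\<^sub>0 :: "'o \<Rightarrow> 'm" where
  "\<kappa>\<^sub>0 j = curr V j (Unit V) j (RUnit V j)"

lemma \<kappa>\<^sub>0_V [simp]:
  assumes "j \<in> \<J>"
  shows "\<kappa>\<^sub>0 j \<in> Arr V" "Dom V (\<kappa>\<^sub>0 j) = j" "Cod V (\<kappa>\<^sub>0 j) = IHom V (Unit V) j"
    "Ev V (Unit V) j \<cdot> (\<kappa>\<^sub>0 j \<boxtimes> Id V (Unit V)) = RUnit V j"
  using assms by (simp_all add: \<kappa>\<^sub>0_def)

lemma \<kappa>\<^sub>0_unit: "\<kappa>\<^sub>0 (Unit V) = VId \<O> (Unit V)"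
  by (simp add: \<kappa>\<^sub>0_def op_arities_def op_vcat_def full_sub_vcat_def self_vcat_def lunit_unit)

lemma \<kappa>\<^sub>0_comp_ev:
  assumes "j \<in> \<J>" "v \<in> hom V X j"
  shows "Ev V (Unit V) j \<cdot> ((\<kappa>\<^sub>0 j \<cdot> v) \<boxtimes> Id V (Unit V)) = v \<cdot> RUnit V X"
proof -
  have "Ev V (Unit V) j \<cdot> ((\<kappa>\<^sub>0 j \<cdot> v) \<boxtimes> Id V (Unit V)) = Ev V (Unit V) j \<cdot> (\<kappa>\<^sub>0 j \<boxtimes> Id V (Unit V)) \<cdot> (v \<boxtimes> Id V (Unit V))"
    using assms by (simp add: ten_comp)
  also have "\<dots> = v \<cdot> RUnit V X"
    using assms by (subst comp_ext[OF \<kappa>\<^sub>0_V(4)]) (auto simp: runit_nat)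
  finally show ?thesis .
qed

lemma \<kappa>\<^sub>0_inj:
  assumes "\<kappa>\<^sub>0 j \<cdot> v = \<kappa>\<^sub>0 j \<cdot> w" "j \<in> \<J>" "v \<in> hom V X j" "w \<in> hom V X j"
  shows "v = w"
proof (rule iso_epic)
  have X: "X \<in> Obj V" using assms by auto
  thus "iso V (RUnit V X)" by simp
  show "v \<cdot> RUnit V X = w \<cdot> RUnit V X"
    using \<kappa>\<^sub>0_comp_ev[OF assms(2,3)] \<kappa>\<^sub>0_comp_ev[OF assms(2,4)] assms(1) by simp
qed (use assms in auto)

text \<open>Composing with the counit in the dual is evaluation in V, up to the isomorphism
  \<open>\<kappa>\<^sub>0 j\<close>. Through this formula the enriched structure of the dual is
  reduced to \<open>Ev\<close>.\<close>

lemma gc_\<kappa>\<^sub>0: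
  assumes [simp]: "j \<in> \<J>" "k \<in> \<J>" "f \<in> Arr V" "Dom V f = X" "Cod V f = IHom V k j"
  shows "gc \<O> j k (Unit V) (\<kappa>\<^sub>0 k) f = \<kappa>\<^sub>0 j \<cdot> Ev V k j \<cdot> (f \<boxtimes> Id V k) \<cdot> Sym V k X"
proof (rule ev_inject)
  have [simp]: "X \<in> Obj V" using dom_cod_obj(1)[of f] by simp
  have g: "gc (self_vcat V) (Unit V) k j f (\<kappa>\<^sub>0 k) \<in> hom V (X \<otimes> k) (IHom V (Unit V) j)"
    by (rule gc_self_V) auto
  have "Ev V (Unit V) j \<cdot> (gc \<O> j k (Unit V) (\<kappa>\<^sub>0 k) f \<boxtimes> Id V (Unit V)) =
      Ev V (Unit V) j \<cdot> (gc (self_vcat V) (Unit V) k j f (\<kappa>\<^sub>0 k) \<boxtimes> Id V (Unit V)) \<cdot> (Sym V k X \<boxtimes> Id V (Unit V))"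
    using g by (simp add: gc_op_arities ten_comp)
  also have "\<dots> = (Ev V k j \<cdot> (f \<boxtimes> (Ev V (Unit V) k \<cdot> (\<kappa>\<^sub>0 k \<boxtimes> Id V (Unit V)))) \<cdot> Assoc V X k (Unit V)) \<cdot> (Sym V k X \<boxtimes> Id V (Unit V))"
    using g by (subst comp_ext[OF gc_self_V(2)[of _ _ _ _ X _ k]]) auto
  also have "\<dots> = Ev V k j \<cdot> (f \<boxtimes> Id V k) \<cdot> ((Id V X \<boxtimes> RUnit V k) \<cdot> Assoc V X k (Unit V)) \<cdot> (Sym V k X \<boxtimes> Id V (Unit V))"
    by (simp add: ten_comp_ext)
  also have "\<dots> = Ev V k j \<cdot> (f \<boxtimes> Id V k) \<cdot> Sym V k X \<cdot> RUnit V (k \<otimes> X)"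
    by (subst runit_ten) (auto simp: runit_nat)
  also have "\<dots> = Ev V (Unit V) j \<cdot> ((\<kappa>\<^sub>0 j \<cdot> (Ev V k j \<cdot> (f \<boxtimes> Id V k) \<cdot> Sym V k X)) \<boxtimes> Id V (Unit V))"
    by (subst \<kappa>\<^sub>0_comp_ev[of j _ "k \<otimes> X"]) auto
  finally show "Ev V (Unit V) j \<cdot> (gc \<O> j k (Unit V) (\<kappa>\<^sub>0 k) f \<boxtimes> Id V (Unit V)) =
    Ev V (Unit V) j \<cdot> ((\<kappa>\<^sub>0 j \<cdot> Ev V k j \<cdot> (f \<boxtimes> Id V k) \<cdot> Sym V k X) \<boxtimes> Id V (Unit V))" by simp
qed (use dom_cod_obj(1)[of f] in auto)

lemma \<kappa>\<^sub>0_surj: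
  assumes "j \<in> \<J>" "x \<in> hom V X (IHom V (Unit V) j)"
  obtains v where "v \<in> hom V X j" "x = \<kappa>\<^sub>0 j \<cdot> v"
proof
  have [simp]: "X \<in> Obj V" using assms by auto
  let ?v = "Ev V (Unit V) j \<cdot> (x \<boxtimes> Id V (Unit V)) \<cdot> inv_arr V (RUnit V X)"
  show v: "?v \<in> hom V X j" using assms by auto
  show "x = \<kappa>\<^sub>0 j \<cdot> ?v"
    by (rule ev_inject, subst \<kappa>\<^sub>0_comp_ev[OF assms(1) v]) (use assms in auto)
qed

text \<open>By \<open>gc_\<kappa>\<^sub>0\<close> the required factorisation is transposition, and
  its uniqueness is that of transposes.\<close>

lemma univ_\<kappa>\<^sub>0:
  assumes j [simp]: "j \<in> \<J>"
  shows "univ \<O> j (Unit V) j (\<kappa>\<^sub>0 j)"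
proof (rule univI)
  fix d X g assume "d \<in> VObj \<O>" and [simp]: "X \<in> Obj V" and g: "g \<in> hom V (j \<otimes> X) (VHom \<O> d (Unit V))"
  hence [simp]: "d \<in> \<J>" by simp
  obtain v where v: "v \<in> hom V (j \<otimes> X) d" "g = \<kappa>\<^sub>0 d \<cdot> v"
    using \<kappa>\<^sub>0_surj[of d g "j \<otimes> X"] g by auto
  let ?f = "curr V X j d (v \<cdot> Sym V X j)"
  have "gc \<O> d j (Unit V) (\<kappa>\<^sub>0 j) ?f = \<kappa>\<^sub>0 d \<cdot> (Ev V j d \<cdot> (?f \<boxtimes> Id V j)) \<cdot> Sym V j X"
    using v by (subst gc_\<kappa>\<^sub>0[of _ _ _ X]) (auto simp del: curr(4))
  also have "\<dots> = g" using v by (subst curr(4)) auto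
  finally show "\<exists>f. f \<in> hom V X (VHom \<O> d j) \<and> gc \<O> d j (Unit V) (\<kappa>\<^sub>0 j) f = g"
    using v by (intro exI[of _ ?f]) auto
next
  fix d X f g assume "d \<in> VObj \<O>" and [simp]: "X \<in> Obj V" and
    fg: "f \<in> hom V X (VHom \<O> d j)" "g \<in> hom V X (VHom \<O> d j)"
    and eq: "gc \<O> d j (Unit V) (\<kappa>\<^sub>0 j) f = gc \<O> d j (Unit V) (\<kappa>\<^sub>0 j) g"
  hence [simp]: "d \<in> \<J>" by simp
  have "\<kappa>\<^sub>0 d \<cdot> ((Ev V j d \<cdot> (f \<boxtimes> Id V j)) \<cdot> Sym V j X) = \<kappa>\<^sub>0 d \<cdot> ((Ev V j d \<cdot> (g \<boxtimes> Id V j)) \<cdot> Sym V j X)"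
    using eq fg by (simp add: gc_\<kappa>\<^sub>0)
  hence "(Ev V j d \<cdot> (f \<boxtimes> Id V j)) \<cdot> Sym V j X = (Ev V j d \<cdot> (g \<boxtimes> Id V j)) \<cdot> Sym V j X"
    by (rule \<kappa>\<^sub>0_inj[where X = "j \<otimes> X"]) (use fg in auto)
  hence "Ev V j d \<cdot> (f \<boxtimes> Id V j) = Ev V j d \<cdot> (g \<boxtimes> Id V j)"
    by (rule iso_epic[rotated]) (use fg in auto)
  thus "f = g" by (rule ev_inject) (use fg in auto)
qed auto

section \<open>Structure functors\<close>

text \<open>Since \<open>gc \<O> j k I (\<kappa>\<^sub>0 k) id = \<kappa>\<^sub>0 j \<cdot> \<epsilon> j k\<close>, the equation \<open>gc U j k I (\<tau> k) (FA S j k) = \<tau> j \<cdot> \<epsilon> j k\<close>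
  says that \<open>S\<close> sends \<open>\<kappa>\<^sub>0\<close> to \<open>\<tau>\<close>, without presupposing that \<open>S\<close> is a functor.\<close>

definition \<epsilon> :: "'o \<Rightarrow> 'o \<Rightarrow> 'm" where
  "\<epsilon> j k = Ev V k j \<cdot> Sym V k (IHom V k j)"

lemma \<epsilon>_V [simp]:
  assumes "j \<in> \<J>" "k \<in> \<J>"
  shows "\<epsilon> j k \<in> Arr V" "Dom V (\<epsilon> j k) = k \<otimes> IHom V k j" "Cod V (\<epsilon> j k) = j"
  using assms by (simp_all add: \<epsilon>_def)

lemma gc_\<kappa>\<^sub>0_\<epsilon>:
  assumes [simp]: "j \<in> \<J>" "k \<in> \<J>" "f \<in> Arr V" "Cod V f = IHom V k j"
  shows "gc \<O> j k (Unit V) (\<kappa>\<^sub>0 k) f = \<kappa>\<^sub>0 j \<cdot> \<epsilon> j k \<cdot> (Id V k \<boxtimes> f)"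
  using sym_nat[of "Id V k" f k "IHom V k j"] by (simp add: gc_\<kappa>\<^sub>0[where X = "Dom V f"] \<epsilon>_def)

lemma structure_functor_eq:
  assumes U [simp]: "vcategory V U" and S: "vfunctor V \<O> U S" and jk [simp]: "j \<in> \<J>" "k \<in> \<J>"
  defines "\<tau> \<equiv> \<lambda>j. FA S j (Unit V) \<cdot> \<kappa>\<^sub>0 j"
  shows "gc U (FO S j) (FO S k) (FO S (Unit V)) (\<tau> k) (FA S j k) = \<tau> j \<cdot> \<epsilon> j k"
proof -
  note [simp] = vfunctor_obj[OF S, simplified] vfunctor_arr[OF S, simplified]
  have "gc U (FO S j) (FO S k) (FO S (Unit V)) (\<tau> k) (FA S j k)
      = gc U (FO S j) (FO S k) (FO S (Unit V)) (FA S k (Unit V) \<cdot> \<kappa>\<^sub>0 k) (FA S j k \<cdot> Id V (IHom V k j))"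
    by (simp add: \<tau>_def)
  also have "\<dots> = FA S j (Unit V) \<cdot> gc \<O> j k (Unit V) (\<kappa>\<^sub>0 k) (Id V (IHom V k j))"
    by (subst vfunctor_gc[OF U op_arities S]) auto
  also have "\<dots> = \<tau> j \<cdot> \<epsilon> j k"
    by (simp add: gc_\<kappa>\<^sub>0_\<epsilon> \<tau>_def)
  finally show ?thesis .
qed

text \<open>A functor out of the dual that carries \<open>\<kappa>\<^sub>0\<close> to
  \<open>\<tau>\<close> is forced: \<open>FA S j k\<close> is the unique lift of
  \<open>\<tau> j \<cdot> \<epsilon> j k\<close> through \<open>\<tau> k\<close>. Functoriality
  follows by comparing after composition with \<open>\<tau>\<close>. This is the passage from the
  description of a theory by counits alone to the one by a structure functor.\<close>

lemma structure_functorI: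
  assumes U [simp]: "vcategory V U" and UJ [simp]: "VObj U = \<J>" and u: "\<And>j. j \<in> \<J> \<Longrightarrow> univ U j (Unit V) j (\<tau> j)"
    and FOS: "FO S = (\<lambda>j\<in>\<J>. j)" and ext: "ext2 \<J> (FA S) = FA S"
    and ty: "\<And>j k. j \<in> \<J> \<Longrightarrow> k \<in> \<J> \<Longrightarrow> FA S j k \<in> hom V (IHom V k j) (VHom U j k)"
    and eq: "\<And>j k. j \<in> \<J> \<Longrightarrow> k \<in> \<J> \<Longrightarrow> gc U j k (Unit V) (\<tau> k) (FA S j k) = \<tau> j \<cdot> \<epsilon> j k"
    and \<tau>_unit: "\<tau> (Unit V) = VId U (Unit V)"
  shows "vfunctor V \<O> U S" "\<And>j. j \<in> \<J> \<Longrightarrow> FA S j (Unit V) \<cdot> \<kappa>\<^sub>0 j = \<tau> j"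
    "preserves_cotensors V \<J> \<O> U S"
proof -
  have [simp]: "FO S j = j" if "j \<in> \<J>" for j using that FOS by simp
  note [simp] = univ_V[OF u] ty[unfolded hom_V]
  \<comment> \<open>What applying \<open>S\<close> to the equation \<open>v(1)\<close> would yield,
    obtained before \<open>S\<close> is known to be a functor: since
    \<open>\<kappa>\<^sub>0 j\<close> is monic, \<open>v\<close> must be
    \<open>\<epsilon> j k\<close> reindexed along \<open>x\<close>.\<close>
  have eq': "gc U j k (Unit V) (\<tau> k) (FA S j k \<cdot> x) = \<tau> j \<cdot> v"
    if [simp]: "j \<in> \<J>" "k \<in> \<J>" "x \<in> Arr V" "Cod V x = IHom V k j"
      and v: "gc \<O> j k (Unit V) (\<kappa>\<^sub>0 k) x = \<kappa>\<^sub>0 j \<cdot> v" "v \<in> Arr V" "Cod V v = j" "Dom V v = k \<otimes> Dom V x" for j k x v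
  proof -
    have "\<epsilon> j k \<cdot> (Id V k \<boxtimes> x) = v"
      by (rule \<kappa>\<^sub>0_inj[of j _ _ "k \<otimes> Dom V x"]) (use v in \<open>auto simp: gc_\<kappa>\<^sub>0_\<epsilon>\<close>)
    thus ?thesis by (simp add: gc_reindex2 eq)
  qed
  show S: "vfunctor V \<O> U S"
    unfolding vfunctor_def op_arities_V
  proof (intro conjI ballI)
    show "FO S \<in> \<J> \<rightarrow>\<^sub>E VObj U" using FOS by simp
    show "FA S j j \<cdot> VId \<O> j = VId U (FO S j)" if [simp]: "j \<in> \<J>" for j
    proof -
      have "gc U j j (Unit V) (\<tau> j) (FA S j j \<cdot> VId \<O> j) = \<tau> j \<cdot> RUnit V j"
        by (rule eq') (auto simp: gc_id)
      also have "\<dots> = gc U j j (Unit V) (\<tau> j) (VId U j)" by (simp add: gc_id)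
      finally have "FA S j j \<cdot> VId \<O> j = VId U j" by (rule univ_inj[OF u[OF that]]) auto
      thus ?thesis by simp
    qed
    show "FA S j l \<cdot> VComp \<O> j k l = VComp U (FO S j) (FO S k) (FO S l) \<cdot> (FA S k l \<boxtimes> FA S j k)"
      if [simp]: "j \<in> \<J>" "k \<in> \<J>" "l \<in> \<J>" for j k l
    proof -
      let ?x = "Id V (IHom V k j)" and ?y = "Id V (IHom V l k)"
      \<comment> \<open>A composite in the dual is evaluated in two stages after reassociation;
        \<open>?x\<close> and \<open>?y\<close> are the generic arrows of the two
        hom-objects.\<close>
      let ?v = "\<epsilon> j k \<cdot> (\<epsilon> k l \<boxtimes> ?x) \<cdot> inv_arr V (Assoc V l (IHom V l k) (IHom V k j))"
      have "gc \<O> j l (Unit V) (\<kappa>\<^sub>0 l) (gc \<O> j k l ?y ?x) = (gc \<O> j l (Unit V) (\<kappa>\<^sub>0 l) (gc \<O> j k l ?y ?x) \<cdot>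
          Assoc V l (IHom V l k) (IHom V k j)) \<cdot> inv_arr V (Assoc V l (IHom V l k) (IHom V k j))" by simp
      also have "\<dots> = gc \<O> j k (Unit V) (gc \<O> k l (Unit V) (\<kappa>\<^sub>0 l) ?y) ?x \<cdot> inv_arr V (Assoc V l (IHom V l k) (IHom V k j))"
        by (subst gc_assoc) auto
      also have "\<dots> = gc \<O> j k (Unit V) (\<kappa>\<^sub>0 k \<cdot> \<epsilon> k l) ?x \<cdot> inv_arr V (Assoc V l (IHom V l k) (IHom V k j))"
        by (subst gc_\<kappa>\<^sub>0_\<epsilon>[of k l]) auto
      also have "\<dots> = \<kappa>\<^sub>0 j \<cdot> ?v"
        by (simp add: gc_reindex1 gc_\<kappa>\<^sub>0_\<epsilon>)
      finally have v: "gc \<O> j l (Unit V) (\<kappa>\<^sub>0 l) (gc \<O> j k l ?y ?x) = \<kappa>\<^sub>0 j \<cdot> ?v" .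
      have "gc U j l (Unit V) (\<tau> l) (FA S j l \<cdot> gc \<O> j k l ?y ?x) = \<tau> j \<cdot> ?v"
        by (rule eq'[OF _ _ _ _ v]) auto
      also have "\<dots> = gc U j k (Unit V) (\<tau> k \<cdot> \<epsilon> k l) (FA S j k) \<cdot> inv_arr V (Assoc V l (IHom V l k) (IHom V k j))"
        by (simp add: gc_reindex1 eq)
      also have "\<dots> = gc U j k (Unit V) (gc U k l (Unit V) (\<tau> l) (FA S k l)) (FA S j k)
          \<cdot> inv_arr V (Assoc V l (IHom V l k) (IHom V k j))"
        by (subst eq) auto
      also have "\<dots> = gc U j l (Unit V) (\<tau> l) (gc U j k l (FA S k l) (FA S j k))"
        by (subst gc_assoc) auto
      finally have "FA S j l \<cdot> gc \<O> j k l ?y ?x = gc U j k l (FA S k l) (FA S j k)"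
        by (rule univ_inj[OF u[OF that(3)]]) auto
      thus ?thesis using vcomp[OF op_arities, of j k l] by (simp add: gc_def)
    qed
  qed (use ext ty in auto)
  show \<tau>: "FA S j (Unit V) \<cdot> \<kappa>\<^sub>0 j = \<tau> j" if [simp]: "j \<in> \<J>" for j
  proof -
    \<comment> \<open>Both \<open>\<kappa>\<^sub>0 I\<close> and \<open>\<tau> I\<close> are
      identities, so the case \<open>k = I\<close> of \<open>eq'\<close> reads off the value on
      \<open>\<kappa>\<^sub>0 j\<close>.\<close>
    have "gc U j (Unit V) (Unit V) (\<tau> (Unit V)) (FA S j (Unit V) \<cdot> \<kappa>\<^sub>0 j) = \<tau> j \<cdot> LUnit V j"
      by (rule eq') (auto simp: gc_id \<kappa>\<^sub>0_unit)
    also have "\<dots> = gc U j (Unit V) (Unit V) (\<tau> (Unit V)) (\<tau> j)"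
      by (simp add: \<tau>_unit gc_id)
    finally show ?thesis by (rule univ_inj[OF u[OF arities_V(2)]]) auto
  qed
  show "preserves_cotensors V \<J> \<O> U S"
    by (rule preserves_cotensorsI[OF U op_arities arity_system _ univ_\<kappa>\<^sub>0 S]) (auto simp: \<tau> u)
qed

end

section \<open>Pointwise cotensors of algebras\<close>

locale admissible_cat = arity_system V \<J> for V :: "('o, 'm) smc" (structure) and \<J> :: "'o set" +
  fixes C :: "('c, 'o, 'm) cvcat"
  assumes C [simp]: "vcategory V C" and admissible: "admissible V \<J> C"
begin

abbreviation "cot \<equiv> Cot C"
abbreviation "cnt \<equiv> Cnt C"
abbreviation "cota \<equiv> cot_arr V C"

lemma univ_cnt: "j \<in> \<J> \<Longrightarrow> c \<in> VObj C \<Longrightarrow> univ C j c (cot j c) (cnt j c)"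
  using admissible by (simp add: admissible_def has_designated_cotensors_def is_cotensor_iff_univ)

lemma cot_V [simp]:
  assumes "j \<in> \<J>" "c \<in> VObj C"
  shows "cot j c \<in> VObj C" "cnt j c \<in> Arr V" "Dom V (cnt j c) = j" "Cod V (cnt j c) = VHom C (cot j c) c"
  using univ_V[OF univ_cnt[OF assms]] by auto

lemma cot_unit [simp]:
  assumes "c \<in> VObj C"
  shows "cot (Unit V) c = c" "cnt (Unit V) c = VId C c"
  using admissible assms by (simp_all add: admissible_def has_designated_cotensors_def)

lemma cota_V [simp]:
  assumes "j \<in> \<J>" "c \<in> VObj C" "d \<in> VObj C"
  shows "cota j c d \<in> Arr V" "Dom V (cota j c d) = VHom C c d" "Cod V (cota j c d) = VHom C (cot j c) (cot j d)"
proof -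
  have "VComp C (cot j c) c d \<cdot> (Id V (VHom C c d) \<boxtimes> cnt j c) \<in> hom V (VHom C c d \<otimes> j) (VHom C (cot j c) d)"
    using assms by simp
  with cot_lift(1-3)[OF C univ_cnt[OF assms(1,3)], of "cot j c" "VHom C c d"
      "VComp C (cot j c) c d \<cdot> (Id V (VHom C c d) \<boxtimes> cnt j c)"]
  show "cota j c d \<in> Arr V" "Dom V (cota j c d) = VHom C c d" "Cod V (cota j c d) = VHom C (cot j c) (cot j d)"
    using assms unfolding cot_arr_def by simp_all
qed

text \<open>Naturality of the counit. Together with \<open>cota_unique\<close> it characterises
  \<open>[j, -]\<close> on arrows, so that functoriality in \<open>cota_gc\<close> and
  \<open>cota_id\<close> comes from pasting squares and from squares of grade
  \<open>I\<close>.\<close>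

lemma cota_sq:
  assumes "j \<in> \<J>" "c \<in> VObj C" "d \<in> VObj C" "x \<in> hom V X (VHom C c d)"
  shows "sq C j X (cot j c) (cot j d) c d (cnt j c) (cnt j d) (cota j c d \<cdot> x) x"
proof -
  have [simp]: "X \<in> Obj V" using assms by auto
  note [simp] = assms(1-3)
  let ?H = "VHom C c d" let ?h = "VComp C (cot j c) c d \<cdot> (Id V ?H \<boxtimes> cnt j c)"
  have "gc C (cot j c) (cot j d) d (cnt j d) (cota j c d) = ?h \<cdot> Sym V j ?H"
    unfolding cot_arr_def by (rule cot_lift[OF C univ_cnt[OF assms(1,3)]]) auto
  hence "gc C (cot j c) (cot j d) d (cnt j d) (cota j c d) = gc C (cot j c) c d (Id V ?H) (cnt j c) \<cdot> Sym V j ?H"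
    by (simp add: gc_def)
  hence "sq C j ?H (cot j c) (cot j d) c d (cnt j c) (cnt j d) (cota j c d) (Id V ?H)"
    by (simp add: sq_def)
  from sq_reindex[OF C this, of "Id V j" j x X] show ?thesis using assms by simp
qed

lemma cota_unique:
  assumes "j \<in> \<J>" "sq C j X (cot j c) (cot j d) c d (cnt j c) (cnt j d) y x"
  shows "y = cota j c d \<cdot> x"
proof -
  have ty: "c \<in> VObj C" "d \<in> VObj C" "x \<in> hom V X (VHom C c d)" "y \<in> hom V X (VHom C (cot j c) (cot j d))"
    using assms(2) unfolding sq_def by blast+
  have "gc C (cot j c) (cot j d) d (cnt j d) y = gc C (cot j c) (cot j d) d (cnt j d) (cota j c d \<cdot> x)"
    using assms(2) cota_sq[OF assms(1) ty(1-3)] unfolding sq_def by simp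
  thus ?thesis
    by (rule univ_inj[OF univ_cnt[OF assms(1) ty(2)]]) (use ty assms(1) in auto)
qed

lemma cota_gc:
  assumes "j \<in> \<J>" "a \<in> VObj C" "b \<in> VObj C" "c \<in> VObj C"
    "y \<in> Arr V" "Cod V y = VHom C b c" "x \<in> Arr V" "Cod V x = VHom C a b"
  shows "cota j a c \<cdot> gc C a b c y x = gc C (cot j a) (cot j b) (cot j c) (cota j b c \<cdot> y) (cota j a b \<cdot> x)"
  by (rule cota_unique[symmetric, OF assms(1) sq_paste[OF C cota_sq cota_sq]]) (use assms in auto)

lemma cota_id:
  assumes "j \<in> \<J>" "a \<in> VObj C"
  shows "cota j a a \<cdot> VId C a = VId C (cot j a)"
  by (rule cota_unique[symmetric, OF assms(1)], subst sq_unit[OF C]) (use assms in auto)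

lemma cota_unit:
  assumes "c \<in> VObj C" "d \<in> VObj C" "x \<in> Arr V" "Cod V x = VHom C c d"
  shows "cota (Unit V) c d \<cdot> x = x"
  by (rule cota_unique[symmetric, of _ "Dom V x"], simp, rule sq_flip[OF C], subst sq_unit[OF C]) (use assms in auto)

text \<open>\<open>[j, l]\<close> with \<open>l = [k, c]\<close> is a cotensor
  \<open>[k \<otimes> j, c]\<close>, hence by the symmetry a cotensor
  \<open>[j \<otimes> k, c]\<close>. Cancelling \<open>[j, c]\<close> leaves
  \<open>[k, [j, c]]\<close>.\<close>

lemma univ_cota:
  assumes j [simp]: "j \<in> \<J>" and u: "univ C k c l \<kappa>"
  shows "univ C k (cot j c) (cot j l) (cota j l c \<cdot> \<kappa>)"
proof (rule univ_cancel[OF C univ_cnt])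
  note [simp] = univ_V[OF u]
  have "univ C (k \<otimes> j) c (cot j l) (gc C (cot j l) l c \<kappa> (cnt j l))"
    by (rule univ_comp[OF C u univ_cnt]) auto
  hence "univ C (j \<otimes> k) c (cot j l) (gc C (cot j l) l c \<kappa> (cnt j l) \<cdot> Sym V j k)"
    by (rule univ_reindex[OF C]) auto
  thus "univ C (j \<otimes> k) c (cot j l) (gc C (cot j l) (cot j c) c (cnt j c) (cota j l c \<cdot> \<kappa>))"
    using cota_sq[of j l c \<kappa> k] unfolding sq_def by simp
qed (use univ_V[OF u] in auto)

subsection \<open>Theories and algebras\<close>

text \<open>The arrow from \<open>j\<close> to the hom-object \<open>VHom T j I\<close> that
  exhibits \<open>j\<close> as \<open>[j, I]\<close>: the datum from which a theory can be
  recovered.\<close>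

definition \<tau> :: "('o, 'm) thy \<Rightarrow> 'o \<Rightarrow> 'm" where
  "\<tau> T j = FA (Str T) j (Unit V) \<cdot> \<kappa>\<^sub>0 j"

lemma theory_V [simp]:
  assumes "is_theory V \<J> T"
  shows "vcategory V T" "VObj T = \<J>"
  using assms unfolding is_theory_def by blast+

lemma theory_functor:
  assumes "is_theory V \<J> T"
  shows "vfunctor V \<O> T (Str T)" "j \<in> \<J> \<Longrightarrow> FO (Str T) j = j" "preserves_cotensors V \<J> \<O> T (Str T)"
  using assms unfolding is_theory_def by blast+

lemma univ_\<tau>:
  assumes T: "is_theory V \<J> T" and j: "j \<in> \<J>"
  shows "univ T j (Unit V) j (\<tau> T j)"
proof -
  have "is_cotensor V \<O> j (Unit V) j (\<kappa>\<^sub>0 j)"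
    using j by (simp add: is_cotensor_iff_univ univ_\<kappa>\<^sub>0)
  hence "is_cotensor V T j (FO (Str T) (Unit V)) (FO (Str T) j) (FA (Str T) j (Unit V) \<cdot> \<kappa>\<^sub>0 j)"
    using theory_functor(3)[OF T] j unfolding preserves_cotensors_def by blast
  thus ?thesis using T j by (simp add: is_cotensor_iff_univ \<tau>_def theory_functor(2))
qed

lemma \<tau>_V [simp]:
  assumes "is_theory V \<J> T" "j \<in> \<J>"
  shows "\<tau> T j \<in> Arr V" "Dom V (\<tau> T j) = j" "Cod V (\<tau> T j) = VHom T j (Unit V)"
  using univ_V[OF univ_\<tau>[OF assms]] by auto

lemma \<tau>_unit:
  assumes "is_theory V \<J> T"
  shows "\<tau> T (Unit V) = VId T (Unit V)"
  using vfunctor_id[OF theory_functor(1)[OF assms], of "Unit V"] assms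
  by (simp add: \<tau>_def \<kappa>\<^sub>0_unit theory_functor(2))

lemma alg_cot_FO [simp]: "k \<in> \<J> \<Longrightarrow> FO (alg_cot V \<J> C j A) k = cot j (FO A k)"
  by (simp add: alg_cot_def)

lemma alg_cot_FA [simp]:
  "k \<in> \<J> \<Longrightarrow> l \<in> \<J> \<Longrightarrow> FA (alg_cot V \<J> C j A) k l = cota j (FO A k) (FO A l) \<cdot> FA A k l"
  by (simp add: alg_cot_def ext2_def)

context
  fixes T assumes T [simp]: "is_theory V \<J> T"
begin

lemma algebra_V [simp]:
  assumes "is_algebra V \<J> C T A"
  shows "j \<in> \<J> \<Longrightarrow> FO A j \<in> VObj C"
    "j \<in> \<J> \<Longrightarrow> k \<in> \<J> \<Longrightarrow> FA A j k \<in> Arr V"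
    "j \<in> \<J> \<Longrightarrow> k \<in> \<J> \<Longrightarrow> Dom V (FA A j k) = VHom T j k"
    "j \<in> \<J> \<Longrightarrow> k \<in> \<J> \<Longrightarrow> Cod V (FA A j k) = VHom C (FO A j) (FO A k)"
  using assms vfunctor_obj[of T C A] vfunctor_arr[of T C A] by (auto simp: is_algebra_def)

lemma algebra_functor: "is_algebra V \<J> C T A \<Longrightarrow> vfunctor V T C A"
  by (simp add: is_algebra_def)

lemma univ_algebra:
  assumes "is_algebra V \<J> C T A" "j \<in> \<J>"
  shows "univ C j (FO A (Unit V)) (FO A j) (FA A j (Unit V) \<cdot> \<tau> T j)"
  using assms univ_\<tau>[OF T assms(2)]
  by (auto simp: is_algebra_def preserves_cotensors_def is_cotensor_iff_univ)

lemma is_algebraI: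
  assumes "vfunctor V T C A"
    "\<And>j. j \<in> \<J> \<Longrightarrow> univ C j (FO A (Unit V)) (FO A j) (FA A j (Unit V) \<cdot> \<tau> T j)"
  shows "is_algebra V \<J> C T A"
  unfolding is_algebra_def
  using preserves_cotensorsI[OF C theory_V(1)[OF T] arity_system theory_V(2)[OF T] univ_\<tau>[OF T] assms] assms(1) by blast

lemma alg_cot_algebra:
  assumes A [simp]: "is_algebra V \<J> C T A" and j [simp]: "j \<in> \<J>"
  shows "is_algebra V \<J> C T (alg_cot V \<J> C j A)"
proof (rule is_algebraI)
  note F = algebra_functor[OF A]
  show "vfunctor V T C (alg_cot V \<J> C j A)"
    unfolding vfunctor_def
  proof (intro conjI ballI)
    show "FO (alg_cot V \<J> C j A) \<in> VObj T \<rightarrow>\<^sub>E VObj C"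
      by (auto simp: alg_cot_def)
    show "ext2 (VObj T) (FA (alg_cot V \<J> C j A)) = FA (alg_cot V \<J> C j A)"
      by (auto simp: alg_cot_def ext2_def fun_eq_iff)
    show "FA (alg_cot V \<J> C j A) k k \<cdot> VId T k = VId C (FO (alg_cot V \<J> C j A) k)" if "k \<in> VObj T" for k
      using that vfunctor_id[OF F, of k] by (simp add: cota_id)
    show "FA (alg_cot V \<J> C j A) a c \<cdot> VComp T a b c =
        VComp C (FO (alg_cot V \<J> C j A) a) (FO (alg_cot V \<J> C j A) b) (FO (alg_cot V \<J> C j A) c)
          \<cdot> (FA (alg_cot V \<J> C j A) b c \<boxtimes> FA (alg_cot V \<J> C j A) a b)"
      if "a \<in> VObj T" "b \<in> VObj T" "c \<in> VObj T" for a b c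
    proof -
      have [simp]: "a \<in> \<J>" "b \<in> \<J>" "c \<in> \<J>" using that by simp_all
      have "FA A a c \<cdot> VComp T a b c = gc C (FO A a) (FO A b) (FO A c) (FA A b c) (FA A a b)"
        using F by (simp add: vfunctor_def gc_def)
      thus ?thesis by (simp add: cota_gc) (simp add: gc_def)
    qed
  qed auto
  fix k assume [simp]: "k \<in> \<J>"
  show "univ C k (FO (alg_cot V \<J> C j A) (Unit V)) (FO (alg_cot V \<J> C j A) k)
      (FA (alg_cot V \<J> C j A) k (Unit V) \<cdot> \<tau> T k)"
    using univ_cota[OF j univ_algebra[OF A, of k]] by simp
qed

text \<open>An equality, because the designated cotensors by \<open>I\<close> are trivial. Through
  it the object \<open>I\<close> of the commutant theory is \<open>A\<close> itself, so that counits
  with codomain \<open>A\<close> are arrows into hom-objects of that theory.\<close>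

lemma alg_cot_unit:
  assumes A [simp]: "is_algebra V \<J> C T A"
  shows "alg_cot V \<J> C (Unit V) A = A"
proof -
  have e: "FO A \<in> extensional \<J>" "ext2 \<J> (FA A) = FA A"
    using algebra_functor[OF A] by (auto simp: vfunctor_def PiE_def)
  have "FO (alg_cot V \<J> C (Unit V) A) = FO A"
    by (rule extensionalityI[OF _ e(1)]) (auto simp: alg_cot_def)
  moreover have "FA (alg_cot V \<J> C (Unit V) A) = FA A"
    by (subst e(2)[symmetric]) (auto simp: alg_cot_def ext2_def fun_eq_iff cota_unit)
  ultimately show ?thesis by simp
qed

subsection \<open>The category of algebras of a theory\<close>

text \<open>Once wedges are families of squares, their reindexing and composition are instances of
  \<open>sq_reindex\<close> and \<open>sq_paste\<close>.\<close>

lemma hom_wedge_iff: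
  assumes [simp]: "is_algebra V \<J> C T A" "is_algebra V \<J> C T B"
  shows "hom_wedge V T C A B E p \<longleftrightarrow> E \<in> Obj V \<and> (\<forall>j\<in>\<J>. p j \<in> hom V E (VHom C (FO A j) (FO B j))) \<and>
     (\<forall>j\<in>\<J>. \<forall>k\<in>\<J>. sq C (VHom T j k) E (FO A j) (FO B j) (FO A k) (FO B k) (FA A j k) (FA B j k) (p j) (p k))"
proof -
  have "sq C (VHom T j k) E (FO A j) (FO B j) (FO A k) (FO B k) (FA A j k) (FA B j k) (p j) (p k) \<longleftrightarrow>
      VComp C (FO A j) (FO B j) (FO B k) \<cdot> (FA B j k \<boxtimes> p j) =
      VComp C (FO A j) (FO A k) (FO B k) \<cdot> (p k \<boxtimes> FA A j k) \<cdot> Sym V (VHom T j k) E"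
    if "E \<in> Obj V" "\<forall>j\<in>\<J>. p j \<in> hom V E (VHom C (FO A j) (FO B j))" "j \<in> \<J>" "k \<in> \<J>" for j k
    using that unfolding sq_def by (simp add: gc_def)
  thus ?thesis unfolding hom_wedge_def theory_V(2)[OF T] by blast
qed

lemma hom_wedge_sq:
  assumes "hom_wedge V T C A B E p" "is_algebra V \<J> C T A" "is_algebra V \<J> C T B" "j \<in> \<J>" "k \<in> \<J>"
    "x \<in> hom V X (VHom T j k)"
  shows "sq C X E (FO A j) (FO B j) (FO A k) (FO B k) (FA A j k \<cdot> x) (FA B j k \<cdot> x) (p j) (p k)"
proof -
  have "sq C (VHom T j k) E (FO A j) (FO B j) (FO A k) (FO B k) (FA A j k) (FA B j k) (p j) (p k)" "E \<in> Obj V"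
    using assms by (simp_all add: hom_wedge_iff)
  from sq_reindex[OF C this(1) assms(6), of "Id V E" E] this show ?thesis by (auto simp: sq_def)
qed

lemma hom_wedge_V:
  assumes "hom_wedge V T C A B E p" "j \<in> \<J>"
  shows "p j \<in> Arr V" "Dom V (p j) = E" "Cod V (p j) = VHom C (FO A j) (FO B j)" "E \<in> Obj V"
  using assms by (auto simp: hom_wedge_def)

lemma hom_wedge_reindex:
  assumes "hom_wedge V T C A B E p" "is_algebra V \<J> C T A" "is_algebra V \<J> C T B" "h \<in> hom V X E"
  shows "hom_wedge V T C A B X (\<lambda>j. p j \<cdot> h)"
  unfolding hom_wedge_iff[OF assms(2,3)]
proof (intro conjI ballI)
  fix j k assume [simp]: "j \<in> \<J>" "k \<in> \<J>"
  have "sq C (VHom T j k) E (FO A j) (FO B j) (FO A k) (FO B k) (FA A j k) (FA B j k) (p j) (p k)"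
    using assms by (simp add: hom_wedge_iff)
  from sq_reindex[OF C this _ assms(4), of "Id V (VHom T j k)" "VHom T j k"]
  show "sq C (VHom T j k) X (FO A j) (FO B j) (FO A k) (FO B k) (FA A j k) (FA B j k) (p j \<cdot> h) (p k \<cdot> h)"
    using assms by simp
qed (use assms hom_wedge_V[OF assms(1)] in auto)

lemma hom_wedge_comp:
  assumes "hom_wedge V T C A B E p" "hom_wedge V T C B D E' q"
    and [simp]: "is_algebra V \<J> C T A" "is_algebra V \<J> C T B" "is_algebra V \<J> C T D"
  shows "hom_wedge V T C A D (E' \<otimes> E) (\<lambda>j. gc C (FO A j) (FO B j) (FO D j) (q j) (p j))"
  unfolding hom_wedge_iff[OF assms(3,5)]
proof (intro conjI ballI)
  fix j k assume [simp]: "j \<in> \<J>" "k \<in> \<J>"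
  show "sq C (VHom T j k) (E' \<otimes> E) (FO A j) (FO D j) (FO A k) (FO D k) (FA A j k) (FA D j k)
     (gc C (FO A j) (FO B j) (FO D j) (q j) (p j)) (gc C (FO A k) (FO B k) (FO D k) (q k) (p k))"
    by (rule sq_paste[OF C, where ?x1.0 = "FA B j k"]) (use assms in \<open>auto simp: hom_wedge_iff\<close>)
qed (use hom_wedge_V[OF assms(1)] hom_wedge_V[OF assms(2)] hom_wedge_V(4)[OF assms(1) arities_V(2)]
    hom_wedge_V(4)[OF assms(2) arities_V(2)] in auto)

lemma hom_wedge_id:
  assumes [simp]: "is_algebra V \<J> C T A"
  shows "hom_wedge V T C A A (Unit V) (\<lambda>j. VId C (FO A j))"
  unfolding hom_wedge_iff[OF assms assms]
  by (auto simp: sq_unit[OF C])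

text \<open>This works because \<open>B\<close> preserves the cotensors \<open>j = [j, I]\<close>.\<close>

lemma hom_wedge_unique:
  assumes "hom_wedge V T C A B E p" "hom_wedge V T C A B E q" "p (Unit V) = q (Unit V)"
    and [simp]: "is_algebra V \<J> C T A" "is_algebra V \<J> C T B" "j \<in> \<J>"
  shows "p j = q j"
proof -
  note s = hom_wedge_sq[OF _ assms(4,5,6) arities_V(2), of E _ "\<tau> T j" j]
  have "gc C (FO A j) (FO B j) (FO B (Unit V)) (FA B j (Unit V) \<cdot> \<tau> T j) (p j) =
      gc C (FO A j) (FO B j) (FO B (Unit V)) (FA B j (Unit V) \<cdot> \<tau> T j) (q j)"
    using s[OF assms(1)] s[OF assms(2)] assms(3) by (simp add: sq_def)
  thus ?thesis
    by (rule univ_inj[OF univ_algebra[OF assms(5,6)]])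
      (use hom_wedge_V[OF assms(1)] hom_wedge_V[OF assms(2)] in auto)
qed

abbreviation "eo \<equiv> end_obj V T C"
abbreviation "ep \<equiv> end_proj V T C"

lemma is_hom_end:
  assumes "is_algebra V \<J> C T A" "is_algebra V \<J> C T B"
  shows "is_hom_end V T C A B (eo A B) (ep A B)"
proof -
  obtain E p where "is_hom_end V T C A B E p"
    using admissible assms T unfolding admissible_def by blast
  hence "(\<lambda>(E, p). is_hom_end V T C A B E p) (E, p)" by simp
  hence "(\<lambda>(E, p). is_hom_end V T C A B E p) (hom_end V T C A B)"
    unfolding hom_end_def by (rule someI)
  thus ?thesis by (simp add: end_obj_def end_proj_def case_prod_beta)
qed

context
  fixes A B assumes A [simp]: "is_algebra V \<J> C T A" and B [simp]: "is_algebra V \<J> C T B"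
begin

lemma end_wedge: "hom_wedge V T C A B (eo A B) (ep A B)"
  using is_hom_end[OF A B] by (simp add: is_hom_end_def)

lemma end_V [simp]:
  shows "eo A B \<in> Obj V" "j \<in> \<J> \<Longrightarrow> ep A B j \<in> Arr V" "j \<in> \<J> \<Longrightarrow> Dom V (ep A B j) = eo A B"
    "j \<in> \<J> \<Longrightarrow> Cod V (ep A B j) = VHom C (FO A j) (FO B j)"
  using hom_wedge_V[OF end_wedge arities_V(2)] hom_wedge_V[OF end_wedge] by auto

lemma end_lift:
  assumes "hom_wedge V T C A B X q"
  shows "end_lift V T C A B X q \<in> Arr V" "Dom V (end_lift V T C A B X q) = X"
    "Cod V (end_lift V T C A B X q) = eo A B" "j \<in> \<J> \<Longrightarrow> ep A B j \<cdot> end_lift V T C A B X q = q j"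
proof -
  have "\<exists>!h. h \<in> hom V X (eo A B) \<and> (\<forall>j\<in>VObj T. ep A B j \<cdot> h = q j)"
    using is_hom_end[OF A B] assms unfolding is_hom_end_def by blast
  from theI'[OF this] show "end_lift V T C A B X q \<in> Arr V" "Dom V (end_lift V T C A B X q) = X"
    "Cod V (end_lift V T C A B X q) = eo A B" "j \<in> \<J> \<Longrightarrow> ep A B j \<cdot> end_lift V T C A B X q = q j"
    unfolding end_lift_def by auto
qed

lemma end_inj:
  assumes "\<And>j. j \<in> \<J> \<Longrightarrow> ep A B j \<cdot> h = ep A B j \<cdot> h'" "h \<in> hom V X (eo A B)" "h' \<in> hom V X (eo A B)"
  shows "h = h'"
proof -
  have "\<exists>!g. g \<in> hom V X (eo A B) \<and> (\<forall>j\<in>VObj T. ep A B j \<cdot> g = ep A B j \<cdot> h)"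
    using is_hom_end[OF A B] hom_wedge_reindex[OF end_wedge A B assms(2)] unfolding is_hom_end_def by blast
  moreover have "\<forall>j\<in>VObj T. ep A B j \<cdot> h' = ep A B j \<cdot> h" using assms by simp
  ultimately show ?thesis using assms by blast
qed

text \<open>The algebra that a commutant carries acts on homs by evaluation at \<open>I\<close>;
  this makes it faithful, which is the source of all uniqueness statements about commutants.\<close>

lemma end_inj_unit:
  assumes "ep A B (Unit V) \<cdot> h = ep A B (Unit V) \<cdot> h'" "h \<in> hom V X (eo A B)" "h' \<in> hom V X (eo A B)"
  shows "h = h'"
proof (rule end_inj[OF _ assms(2,3)])
  show "ep A B j \<cdot> h = ep A B j \<cdot> h'" if "j \<in> \<J>" for j
    using hom_wedge_unique[OF hom_wedge_reindex[OF end_wedge A B assms(2)]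
        hom_wedge_reindex[OF end_wedge A B assms(3)] assms(1) A B that] .
qed

end

abbreviation "D \<equiv> TAlg V \<J> C T"

lemma TAlg_V [simp]: "A \<in> VObj D \<longleftrightarrow> is_algebra V \<J> C T A" "VHom D = eo" "Cot D = alg_cot V \<J> C"
  by (simp_all add: TAlg_def)

lemma VComp_TAlg:
  assumes [simp]: "is_algebra V \<J> C T A" "is_algebra V \<J> C T B" "is_algebra V \<J> C T E"
  shows "VComp D A B E \<in> hom V (eo B E \<otimes> eo A B) (eo A E)"
    "j \<in> \<J> \<Longrightarrow> ep A E j \<cdot> VComp D A B E = gc C (FO A j) (FO B j) (FO E j) (ep B E j) (ep A B j)"
proof -
  let ?q = "\<lambda>j. gc C (FO A j) (FO B j) (FO E j) (ep B E j) (ep A B j)"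
  have "hom_wedge V T C A E (eo B E \<otimes> eo A B) ?q"
    by (rule hom_wedge_comp[OF end_wedge end_wedge]) auto
  from end_lift[OF assms(1,3) this]
  show "VComp D A B E \<in> hom V (eo B E \<otimes> eo A B) (eo A E)"
    "j \<in> \<J> \<Longrightarrow> ep A E j \<cdot> VComp D A B E = ?q j"
    by (simp_all add: TAlg_def gc_def)
qed

lemma VId_TAlg:
  assumes [simp]: "is_algebra V \<J> C T A"
  shows "VId D A \<in> hom V (Unit V) (eo A A)" "j \<in> \<J> \<Longrightarrow> ep A A j \<cdot> VId D A = VId C (FO A j)"
  using end_lift[OF assms assms hom_wedge_id[OF assms]] by (simp_all add: TAlg_def)

lemma ep_gc:
  assumes [simp]: "is_algebra V \<J> C T A" "is_algebra V \<J> C T B" "is_algebra V \<J> C T E"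
    "y \<in> Arr V" "Cod V y = eo B E" "x \<in> Arr V" "Cod V x = eo A B" "j \<in> \<J>"
  shows "ep A E j \<cdot> gc D A B E y x = gc C (FO A j) (FO B j) (FO E j) (ep B E j \<cdot> y) (ep A B j \<cdot> x)"
  using VComp_TAlg(1)[of A B E] comp_ext[OF VComp_TAlg(2)[of A B E j], of "y \<boxtimes> x"]
  by (simp add: gc_reindex) (simp add: gc_def)

text \<open>The projections of an end are jointly monic and by \<open>ep_gc\<close> turn composition
  into composition in \<open>C\<close>, so the axioms are inherited pointwise.\<close>

lemma vcategory_TAlg [simp]: "vcategory V D"
proof (rule vcategoryI)
  show "VComp D A B E \<in> hom V (VHom D B E \<otimes> VHom D A B) (VHom D A E)"
    if "A \<in> VObj D" "B \<in> VObj D" "E \<in> VObj D" for A B E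
    using VComp_TAlg(1) that by simp
  show "VId D A \<in> hom V (Unit V) (VHom D A A)" if "A \<in> VObj D" for A
    using VId_TAlg(1) that by simp
next
  fix A B E F x y z assume "A \<in> VObj D" "B \<in> VObj D" "E \<in> VObj D" "F \<in> VObj D"
    "x \<in> hom V (VHom D A B) (VHom D A B)" "y \<in> hom V (VHom D B E) (VHom D B E)"
    "z \<in> hom V (VHom D E F) (VHom D E F)"
  hence [simp]: "is_algebra V \<J> C T A" "is_algebra V \<J> C T B" "is_algebra V \<J> C T E" "is_algebra V \<J> C T F"
    "x \<in> Arr V" "Dom V x = eo A B" "Cod V x = eo A B"
    "y \<in> Arr V" "Dom V y = eo B E" "Cod V y = eo B E"
    "z \<in> Arr V" "Dom V z = eo E F" "Cod V z = eo E F" by auto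
  have [simp]: "gc D A B' E' y' x' \<in> Arr V" "Dom V (gc D A B' E' y' x') = Dom V y' \<otimes> Dom V x'"
    "Cod V (gc D A B' E' y' x') = eo A E'"
    if "is_algebra V \<J> C T A" "is_algebra V \<J> C T B'" "is_algebra V \<J> C T E'"
      "y' \<in> Arr V" "Cod V y' = eo B' E'" "x' \<in> Arr V" "Cod V x' = eo A B'" for A B' E' x' y'
    using VComp_TAlg(1)[OF that(1-3)] that by (simp_all add: gc_def)
  have "gc D A B F (gc D B E F z y) x = gc D A E F z (gc D A B E y x) \<cdot> Assoc V (eo E F) (eo B E) (eo A B)"
    by (rule end_inj[of A F]) (simp_all add: ep_gc comp_ext[OF ep_gc] gc_assoc)
  thus "gc D A B F (gc D B E F z y) x = gc D A E F z (gc D A B E y x) \<cdot> Assoc V (VHom D E F) (VHom D B E) (VHom D A B)"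
    by simp
next
  fix A B x assume "A \<in> VObj D" "B \<in> VObj D" "x \<in> hom V (VHom D A B) (VHom D A B)"
  hence [simp]: "is_algebra V \<J> C T A" "is_algebra V \<J> C T B" "x \<in> Arr V" "Dom V x = eo A B" "Cod V x = eo A B"
    by auto
  note [simp] = VComp_TAlg(1)[unfolded hom_V] VId_TAlg(1)[unfolded hom_V]
  have "gc D A B B (VId D B) x = x \<cdot> LUnit V (eo A B)"
    by (rule end_inj[of A B]) (simp_all add: ep_gc VId_TAlg(2) comp_ext[symmetric] gc_id, simp_all add: gc_def)
  moreover have "gc D A A B x (VId D A) = x \<cdot> RUnit V (eo A B)"
    by (rule end_inj[of A B]) (simp_all add: ep_gc VId_TAlg(2) comp_ext[symmetric] gc_id, simp_all add: gc_def)
  ultimately show "gc D A B B (VId D B) x = x \<cdot> LUnit V (VHom D A B) \<and> gc D A A B x (VId D A) = x \<cdot> RUnit V (VHom D A B)"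
    by simp
qed auto

text \<open>That the designated counits form a homomorphism from \<open>[j, A]\<close> to
  \<open>A\<close> is their naturality \<open>cota_sq\<close> with the two gradings
  exchanged.\<close>

lemma Cnt_TAlg:
  assumes A [simp]: "is_algebra V \<J> C T A" and j [simp]: "j \<in> \<J>"
  shows "Cnt D j A \<in> hom V j (eo (alg_cot V \<J> C j A) A)"
    "k \<in> \<J> \<Longrightarrow> ep (alg_cot V \<J> C j A) A k \<cdot> Cnt D j A = cnt j (FO A k)"
proof -
  have "hom_wedge V T C (alg_cot V \<J> C j A) A j (\<lambda>k. cnt j (FO A k))"
    unfolding hom_wedge_iff[OF alg_cot_algebra[OF A j] A]
  proof (intro conjI ballI)
    fix k l assume [simp]: "k \<in> \<J>" "l \<in> \<J>"
    show "sq C (VHom T k l) j (FO (alg_cot V \<J> C j A) k) (FO A k) (FO (alg_cot V \<J> C j A) l) (FO A l)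
         (FA (alg_cot V \<J> C j A) k l) (FA A k l) (cnt j (FO A k)) (cnt j (FO A l))"
      using sq_flip[OF C cota_sq[of j "FO A k" "FO A l" "FA A k l" "VHom T k l"]] by simp
  qed auto
  from end_lift[OF alg_cot_algebra[OF A j] A this]
  show "Cnt D j A \<in> hom V j (eo (alg_cot V \<J> C j A) A)"
    "k \<in> \<J> \<Longrightarrow> ep (alg_cot V \<J> C j A) A k \<cdot> Cnt D j A = cnt j (FO A k)"
    by (simp_all add: TAlg_def)
qed

lemma Cnt_TAlg_unit:
  assumes A [simp]: "is_algebra V \<J> C T A"
  shows "Cnt D (Unit V) A = VId D A"
proof (rule end_inj[OF A A])
  show "ep A A k \<cdot> Cnt D (Unit V) A = ep A A k \<cdot> VId D A" if "k \<in> \<J>" for k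
    using Cnt_TAlg(2)[OF A arities_V(2) that] VId_TAlg(2)[OF A that] that unfolding alg_cot_unit[OF A] by simp
qed (use Cnt_TAlg(1)[OF A arities_V(2)] VId_TAlg(1)[OF A] in \<open>simp_all add: alg_cot_unit\<close>)

text \<open>Lifts exist pointwise by \<open>univ_cnt\<close>. They form a wedge since squares can be
  cancelled along the counits, and they are unique because both the counits and the projections of
  the end detect equality.\<close>

lemma univ_TAlg:
  assumes A [simp]: "is_algebra V \<J> C T A" and j [simp]: "j \<in> \<J>"
  shows "univ D j A (alg_cot V \<J> C j A) (Cnt D j A)"
proof (rule univI)
  note [simp] = alg_cot_algebra[OF A j] Cnt_TAlg(1)[OF A j, unfolded hom_V]
  fix B X g assume "B \<in> VObj D" and [simp]: "X \<in> Obj V" and "g \<in> hom V (j \<otimes> X) (VHom D B A)"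
  hence B [simp]: "is_algebra V \<J> C T B" and g [simp]: "g \<in> Arr V" "Dom V g = j \<otimes> X" "Cod V g = eo B A" by auto
  define f where "f = (\<lambda>k. clift C (FO A k) (cot j (FO A k)) (cnt j (FO A k)) (FO B k) X (ep B A k \<cdot> g))"
  have f [simp]: "f k \<in> Arr V" "Dom V (f k) = X" "Cod V (f k) = VHom C (FO B k) (cot j (FO A k))"
    "gc C (FO B k) (cot j (FO A k)) (FO A k) (cnt j (FO A k)) (f k) = ep B A k \<cdot> g" if "k \<in> \<J>" for k
    unfolding f_def by (rule clift_V[OF univ_cnt]; use that in simp)+
  have w: "hom_wedge V T C B (alg_cot V \<J> C j A) X f"
    unfolding hom_wedge_iff[OF B alg_cot_algebra[OF A j]]
  proof (intro conjI ballI)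
    fix k l assume [simp]: "k \<in> \<J>" "l \<in> \<J>"
    have g: "hom_wedge V T C B A (j \<otimes> X) (\<lambda>k. ep B A k \<cdot> g)"
      by (rule hom_wedge_reindex[OF end_wedge]) auto
    have 1: "sq C (VHom T k l) j (cot j (FO A k)) (FO A k) (cot j (FO A l)) (FO A l)
         (cota j (FO A k) (FO A l) \<cdot> FA A k l) (FA A k l) (cnt j (FO A k)) (cnt j (FO A l))"
      by (rule sq_flip[OF C cota_sq]) auto
    have 2: "sq C (VHom T k l) (j \<otimes> X) (FO B k) (FO A k) (FO B l) (FO A l) (FA B k l) (FA A k l)
       (gc C (FO B k) (cot j (FO A k)) (FO A k) (cnt j (FO A k)) (f k))
       (gc C (FO B l) (cot j (FO A l)) (FO A l) (cnt j (FO A l)) (f l))"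
      using g by (simp add: hom_wedge_iff)
    have "sq C (VHom T k l) X (FO B k) (cot j (FO A k)) (FO B l) (cot j (FO A l)) (FA B k l)
        (cota j (FO A k) (FO A l) \<cdot> FA A k l) (f k) (f l)"
      \<comment> \<open>Square \<open>1\<close> is that of the counits, square \<open>2\<close> that
        of the homomorphism \<open>g\<close>; what remains is the square of the lifts.\<close>
      by (rule sq_cancel[OF C 1 2], simp, simp, rule univ_inj[OF univ_cnt]) auto
    thus "sq C (VHom T k l) X (FO B k) (FO (alg_cot V \<J> C j A) k) (FO B l) (FO (alg_cot V \<J> C j A) l) (FA B k l)
        (FA (alg_cot V \<J> C j A) k l) (f k) (f l)" by simp
  qed auto
  let ?f = "end_lift V T C B (alg_cot V \<J> C j A) X f"
  note [simp] = end_lift[OF B alg_cot_algebra[OF A j] w]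
  have "gc D B (alg_cot V \<J> C j A) A (Cnt D j A) ?f = g"
    by (rule end_inj[of B A]) (simp_all add: ep_gc Cnt_TAlg(2))
  thus "\<exists>f. f \<in> hom V X (VHom D B (alg_cot V \<J> C j A)) \<and> gc D B (alg_cot V \<J> C j A) A (Cnt D j A) f = g"
    by (intro exI[of _ ?f]) simp
next
  note [simp] = alg_cot_algebra[OF A j] Cnt_TAlg(1)[OF A j, unfolded hom_V]
  fix B X f g assume "B \<in> VObj D" and [simp]: "X \<in> Obj V"
    and "f \<in> hom V X (VHom D B (alg_cot V \<J> C j A))" "g \<in> hom V X (VHom D B (alg_cot V \<J> C j A))"
    and eq: "gc D B (alg_cot V \<J> C j A) A (Cnt D j A) f = gc D B (alg_cot V \<J> C j A) A (Cnt D j A) g"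
  hence B [simp]: "is_algebra V \<J> C T B" and [simp]: "f \<in> Arr V" "Dom V f = X" "Cod V f = eo B (alg_cot V \<J> C j A)"
     "g \<in> Arr V" "Dom V g = X" "Cod V g = eo B (alg_cot V \<J> C j A)" by auto
  show "f = g"
  proof (rule end_inj[OF B alg_cot_algebra[OF A j], where X = X])
    fix k assume k [simp]: "k \<in> \<J>"
    have "gc C (FO B k) (cot j (FO A k)) (FO A k) (cnt j (FO A k)) (ep B (alg_cot V \<J> C j A) k \<cdot> f) =
       gc C (FO B k) (cot j (FO A k)) (FO A k) (cnt j (FO A k)) (ep B (alg_cot V \<J> C j A) k \<cdot> g)"
      using arg_cong[OF eq, of "\<lambda>h. ep B A k \<cdot> h"] by (simp add: ep_gc Cnt_TAlg(2))
    thus "ep B (alg_cot V \<J> C j A) k \<cdot> f = ep B (alg_cot V \<J> C j A) k \<cdot> g"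
      by (rule univ_inj[OF univ_cnt[OF j algebra_V(1)[OF A k]]]) auto
  qed auto
qed (use Cnt_TAlg(1)[OF A j] alg_cot_algebra[OF A j] in auto)

end

end

section \<open>Commutants\<close>

context arity_system
begin

context
  fixes D :: "('d, 'o, 'm) cvcat" and x
  assumes D [simp]: "vcategory V D" and x [simp]: "x \<in> VObj D"
    and univ: "\<And>j. j \<in> \<J> \<Longrightarrow> univ D j x (Cot D j x) (Cnt D j x)"
    and unit: "Cot D (Unit V) x = x" "Cnt D (Unit V) x = VId D x"
begin

abbreviation "P \<equiv> object_theory V \<J> D x"

lemma object_theory_V [simp]:
  "VObj P = \<J>"
  "j \<in> \<J> \<Longrightarrow> k \<in> \<J> \<Longrightarrow> VHom P j k = VHom D (Cot D j x) (Cot D k x)"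
  "j \<in> \<J> \<Longrightarrow> VId P j = VId D (Cot D j x)"
  "j \<in> \<J> \<Longrightarrow> k \<in> \<J> \<Longrightarrow> l \<in> \<J> \<Longrightarrow> VComp P j k l = VComp D (Cot D j x) (Cot D k x) (Cot D l x)"
  by (simp_all add: object_theory_def ext2_def ext3_def)

lemma gc_object_theory:
  "j \<in> \<J> \<Longrightarrow> k \<in> \<J> \<Longrightarrow> l \<in> \<J> \<Longrightarrow> gc P j k l g f = gc D (Cot D j x) (Cot D k x) (Cot D l x) g f"
  by (simp add: gc_def)

lemma vcategory_object_theory: "vcategory V P"
proof -
  note [simp] = univ_V[OF univ]
  show ?thesis
    by (rule vcategoryI) (auto simp: gc_object_theory gc_assoc gc_id)
qed

text \<open>The hom-objects of \<open>P\<close> are those of \<open>D\<close> between objects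
  \<open>[d, x]\<close>, so the universal property restricts; \<open>unit\<close> identifies
  \<open>x\<close> with the object \<open>I\<close> of \<open>P\<close>.\<close>

lemma univ_object_theory:
  assumes [simp]: "j \<in> \<J>"
  shows "univ P j (Unit V) j (Cnt D j x)"
proof -
  note [simp] = univ_V[OF univ]
  have "\<exists>!f. f \<in> hom V X (VHom P d j) \<and> gc P d j (Unit V) (Cnt D j x) f = g"
    if [simp]: "d \<in> \<J>" and that: "X \<in> Obj V" "g \<in> hom V (j \<otimes> X) (VHom P d (Unit V))" for d X g
  proof -
    have "Cot D d x \<in> VObj D" "g \<in> hom V (j \<otimes> X) (VHom D (Cot D d x) x)" using that by (auto simp: unit)
    hence "\<exists>!f. f \<in> hom V X (VHom D (Cot D d x) (Cot D j x)) \<and> gc D (Cot D d x) (Cot D j x) x (Cnt D j x) f = g"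
      using univ[OF assms] that(1) unfolding univ_def by blast
    thus ?thesis by (simp add: gc_object_theory unit)
  qed
  thus ?thesis unfolding univ_def by (auto simp: unit)
qed

lemma object_theory_structure:
  assumes [simp]: "j \<in> \<J>" "k \<in> \<J>"
  shows "FA (Str P) j k \<in> hom V (IHom V k j) (VHom P j k)"
    "gc P j k (Unit V) (Cnt D k x) (FA (Str P) j k) = Cnt D j x \<cdot> \<epsilon> j k"
proof -
  note [simp] = univ_V[OF univ]
  have e: "FA (Str P) j k = inv_arr V (cot_cmp V D k x (Cot D k x) (Cnt D k x) (Cot D j x)) \<cdot>
      curr V (IHom V k j) k (VHom D (Cot D j x) x) (Cnt D j x \<cdot> Ev V k j)"
    by (simp add: object_theory_def ext2_def)
  have h: "Cnt D j x \<cdot> Ev V k j \<in> Arr V" "Dom V (Cnt D j x \<cdot> Ev V k j) = IHom V k j \<otimes> k"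
    "Cod V (Cnt D j x \<cdot> Ev V k j) = VHom D (Cot D j x) x" by auto
  note l = cot_lift[OF D univ[OF assms(2)] _ _ h, folded e]
  show "FA (Str P) j k \<in> hom V (IHom V k j) (VHom P j k)" using l(1-3) by simp
  show "gc P j k (Unit V) (Cnt D k x) (FA (Str P) j k) = Cnt D j x \<cdot> \<epsilon> j k"
    using l(4) by (simp add: gc_object_theory unit \<epsilon>_def)
qed

text \<open>The cotensor counits take the role of \<open>\<tau>\<close> in
  \<open>structure_functorI\<close>, and the given action on homs consists of precisely the lifts
  demanded there.\<close>

lemma object_theory:
  shows "is_theory V \<J> P" "\<And>j. j \<in> \<J> \<Longrightarrow> FA (Str P) j (Unit V) \<cdot> \<kappa>\<^sub>0 j = Cnt D j x"
proof -
  have 1: "FO (Str P) = (\<lambda>j\<in>\<J>. j)" "ext2 \<J> (FA (Str P)) = FA (Str P)"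
    by (auto simp: object_theory_def ext2_def fun_eq_iff)
  have 2: "Cnt D (Unit V) x = VId P (Unit V)" by (simp add: unit)
  note s = structure_functorI[OF vcategory_object_theory object_theory_V(1) univ_object_theory 1
      object_theory_structure 2]
  show "is_theory V \<J> P"
    unfolding is_theory_def
  proof (intro conjI ballI)
    show "ext2 \<J> (VHom P) = VHom P" "ext3 \<J> (VComp P) = VComp P" "VId P \<in> extensional \<J>"
      by (auto simp: object_theory_def ext2_def ext3_def fun_eq_iff)
  qed (use s(1,3) vcategory_object_theory 1 in auto)
  show "\<And>j. j \<in> \<J> \<Longrightarrow> FA (Str P) j (Unit V) \<cdot> \<kappa>\<^sub>0 j = Cnt D j x" by (rule s(2))
qed

end

end

context admissible_cat
begin

lemma algebras_iff: "X \<in> algebras V \<J> C \<longleftrightarrow> is_theory V \<J> (fst X) \<and> is_algebra V \<J> C (fst X) (snd X)"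
  by (auto simp: algebras_def)

abbreviation com where "com \<equiv> commutant V \<J> C"
abbreviation car where "car \<equiv> alg_carrier V"

context
  fixes T A assumes T [simp]: "is_theory V \<J> T" and A [simp]: "is_algebra V \<J> C T A"
begin

abbreviation "T' \<equiv> fst (com (T, A))"
abbreviation "A' \<equiv> snd (com (T, A))"

lemma commutant_theory_eq: "T' = object_theory V \<J> (TAlg V \<J> C T) A"
  by (simp add: commutant_def)

lemma commutant_V [simp]:
  "j \<in> \<J> \<Longrightarrow> k \<in> \<J> \<Longrightarrow> VHom T' j k = end_obj V T C (alg_cot V \<J> C j A) (alg_cot V \<J> C k A)"
  "j \<in> \<J> \<Longrightarrow> FO A' j = cot j (FO A (Unit V))"
  "j \<in> \<J> \<Longrightarrow> k \<in> \<J> \<Longrightarrow> FA A' j k = end_proj V T C (alg_cot V \<J> C j A) (alg_cot V \<J> C k A) (Unit V)"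
  by (simp_all add: commutant_def object_theory_def ext2_def alg_carrier_def TAlg_V(2)[OF T])

lemma commutant_theory [simp]: "is_theory V \<J> T'"
  and \<tau>_commutant: "j \<in> \<J> \<Longrightarrow> \<tau> T' j = Cnt (TAlg V \<J> C T) j A"
proof -
  note o = object_theory[of "TAlg V \<J> C T" A, OF vcategory_TAlg[OF T], simplified TAlg_V[OF T], OF A univ_TAlg[OF T A]
      alg_cot_unit[OF T A] Cnt_TAlg_unit[OF T A]]
  show "is_theory V \<J> T'" "j \<in> \<J> \<Longrightarrow> \<tau> T' j = Cnt (TAlg V \<J> C T) j A"
    using o unfolding commutant_theory_eq \<tau>_def by simp_all
qed

lemma gc_commutant:
  "j \<in> \<J> \<Longrightarrow> k \<in> \<J> \<Longrightarrow> l \<in> \<J> \<Longrightarrow> gc T' j k l y x =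
    gc (TAlg V \<J> C T) (alg_cot V \<J> C j A) (alg_cot V \<J> C k A) (alg_cot V \<J> C l A) y x"
  "j \<in> \<J> \<Longrightarrow> VId T' j = VId (TAlg V \<J> C T) (alg_cot V \<J> C j A)"
  by (simp_all add: commutant_theory_eq object_theory_def gc_def ext3_def TAlg_V(3)[OF T])

lemma commutant_algebra [simp]: "is_algebra V \<J> C T' A'"
proof (rule is_algebraI[OF commutant_theory])
  note [simp] = alg_cot_algebra[OF T A] algebra_V[OF T] end_V[OF T]
  show "vfunctor V T' C A'"
    unfolding vfunctor_def theory_V(2)[OF commutant_theory]
  proof (intro conjI ballI)
    show "FO A' \<in> \<J> \<rightarrow>\<^sub>E VObj C" by (auto simp: commutant_def alg_carrier_def)
    show "ext2 \<J> (FA A') = FA A'" by (auto simp: commutant_def ext2_def fun_eq_iff)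
    show "FA A' j k \<in> hom V (VHom T' j k) (VHom C (FO A' j) (FO A' k))" if "j \<in> \<J>" "k \<in> \<J>" for j k
      using that by simp
    show "FA A' j j \<cdot> VId T' j = VId C (FO A' j)" if "j \<in> \<J>" for j
      using that VId_TAlg(2)[OF T, of "alg_cot V \<J> C j A" "Unit V"] by (simp add: gc_commutant)
    show "FA A' a c \<cdot> VComp T' a b c = VComp C (FO A' a) (FO A' b) (FO A' c) \<cdot> (FA A' b c \<boxtimes> FA A' a b)"
      if "a \<in> \<J>" "b \<in> \<J>" "c \<in> \<J>" for a b c
    proof -
      have "VComp T' a b c = VComp (TAlg V \<J> C T) (alg_cot V \<J> C a A) (alg_cot V \<J> C b A) (alg_cot V \<J> C c A)"
        using that by (simp add: commutant_theory_eq object_theory_def ext3_def TAlg_V(3)[OF T])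
      thus ?thesis using that by (simp add: VComp_TAlg(2)[OF T]) (simp add: gc_def)
    qed
  qed
  fix j assume [simp]: "j \<in> \<J>"
  \<comment> \<open>Evaluation at \<open>I\<close> sends the pointwise counit to the designated one,
    so the carrier algebra satisfies the cotensor condition.\<close>
  have "FA A' j (Unit V) \<cdot> \<tau> T' j = cnt j (FO A (Unit V))"
    using Cnt_TAlg(2)[OF T A, of j "Unit V"] by (simp add: \<tau>_commutant alg_cot_unit[OF T A])
  thus "univ C j (FO A' (Unit V)) (FO A' j) (FA A' j (Unit V) \<cdot> \<tau> T' j)"
    by (simp add: univ_cnt)
qed

end

lemma commutant_algebras: "X \<in> algebras V \<J> C \<Longrightarrow> com X \<in> algebras V \<J> C"
  by (cases X) (simp add: algebras_iff)

lemma carrier_commutant: "X \<in> algebras V \<J> C \<Longrightarrow> car (com X) = car X"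
  using algebra_V(1)[of "fst X" "snd X" "Unit V"]
  by (cases X) (simp add: algebras_iff alg_carrier_def)

end

section \<open>Strong morphisms\<close>

lemma ext2_eqI:
  "ext2 S f = f \<Longrightarrow> ext2 S g = g \<Longrightarrow> (\<And>a b. a \<in> S \<Longrightarrow> b \<in> S \<Longrightarrow> f a b = g a b) \<Longrightarrow> f = g"
  unfolding ext2_def fun_eq_iff by metis

lemma ext2_idem [simp]: "ext2 S (ext2 S f) = ext2 S f"
  by (auto simp: ext2_def fun_eq_iff)

lemma ext2_app [simp]: "a \<in> S \<Longrightarrow> b \<in> S \<Longrightarrow> ext2 S f a b = f a b"
  by (simp add: ext2_def)

lemma vfun_eqI:
  fixes F G :: "('a, 'b, 'm) vfun"
  assumes "FO F \<in> extensional S" "FO G \<in> extensional S" "ext2 S (FA F) = FA F" "ext2 S (FA G) = FA G"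
    and "\<And>a. a \<in> S \<Longrightarrow> FO F a = FO G a" "\<And>a b. a \<in> S \<Longrightarrow> b \<in> S \<Longrightarrow> FA F a b = FA G a b"
  shows "F = G"
proof -
  have "FO F = FO G" by (rule extensionalityI[OF assms(1,2)]) (rule assms(5))
  moreover have "FA F = FA G" by (rule ext2_eqI[OF assms(3,4)]) (rule assms(6))
  ultimately show ?thesis by simp
qed

context smcc
begin

lemma vfunctor_ext: "vfunctor V T C F \<Longrightarrow> FO F \<in> extensional (VObj T)" "vfunctor V T C F \<Longrightarrow> ext2 (VObj T) (FA F) = FA F"
  by (auto simp: vfunctor_def PiE_def)

lemma vfun_comp_V [simp]:
  "a \<in> S \<Longrightarrow> FO (vfun_comp V S G F) a = FO G (FO F a)"
  "a \<in> S \<Longrightarrow> b \<in> S \<Longrightarrow> FA (vfun_comp V S G F) a b = FA G (FO F a) (FO F b) \<cdot> FA F a b"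
  "FO (vfun_comp V S G F) \<in> extensional S" "ext2 S (FA (vfun_comp V S G F)) = FA (vfun_comp V S G F)"
  by (simp_all add: vfun_comp_def)

lemma vfunctorI:
  assumes "\<And>a. a \<in> VObj T \<Longrightarrow> FO F a \<in> VObj C" "FO F \<in> extensional (VObj T)" "ext2 (VObj T) (FA F) = FA F"
    and "\<And>a b. a \<in> VObj T \<Longrightarrow> b \<in> VObj T \<Longrightarrow> FA F a b \<in> hom V (VHom T a b) (VHom C (FO F a) (FO F b))"
    and "\<And>a. a \<in> VObj T \<Longrightarrow> FA F a a \<cdot> VId T a = VId C (FO F a)"
    and "\<And>a b c. a \<in> VObj T \<Longrightarrow> b \<in> VObj T \<Longrightarrow> c \<in> VObj T \<Longrightarrow>
      FA F a c \<cdot> VComp T a b c = gc C (FO F a) (FO F b) (FO F c) (FA F b c) (FA F a b)"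
  shows "vfunctor V T C F"
  using assms unfolding vfunctor_def gc_def PiE_iff by blast

lemma vfunctor_VComp:
  "vfunctor V T C F \<Longrightarrow> a \<in> VObj T \<Longrightarrow> b \<in> VObj T \<Longrightarrow> c \<in> VObj T \<Longrightarrow>
      FA F a c \<cdot> VComp T a b c = gc C (FO F a) (FO F b) (FO F c) (FA F b c) (FA F a b)"
  unfolding vfunctor_def gc_def by blast

lemma vfunctor_comp:
  assumes T: "vcategory V T" and U: "vcategory V U" and C: "vcategory V C"
    and F: "vfunctor V T U F" and G: "vfunctor V U C G"
  shows "vfunctor V T C (vfun_comp V (VObj T) G F)"
proof -
  note [simp] = T U C vfunctor_obj[OF F] vfunctor_arr[OF F] vfunctor_obj[OF G] vfunctor_arr[OF G]
    vfunctor_id[OF F] vfunctor_id[OF G]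
  show ?thesis
    by (rule vfunctorI) (auto simp: vfunctor_VComp[OF F] vfunctor_gc[OF C U G])
qed

lemma vfunctor_vfun_id:
  assumes T: "vcategory V T"
  shows "vfunctor V T T (vfun_id V T)"
proof -
  note [simp] = T
  show ?thesis by (rule vfunctorI) (auto simp: vfun_id_def gc_def)
qed

lemma vfun_id_V [simp]:
  "a \<in> VObj T \<Longrightarrow> FO (vfun_id V T) a = a"
  "a \<in> VObj T \<Longrightarrow> b \<in> VObj T \<Longrightarrow> FA (vfun_id V T) a b = Id V (VHom T a b)"
  by (simp_all add: vfun_id_def)

context
  fixes C :: "('c, 'o, 'm, 'z) vcat_scheme"
  assumes C [simp]: "vcategory V C"
begin

lemma uinverse_ract_inj:
  assumes "uinverse V C a b t s" "ract C a b d x t = ract C a b d y t" "a \<in> VObj C" "b \<in> VObj C" "d \<in> VObj C"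
    "x \<in> Arr V" "Cod V x = VHom C b d" "y \<in> Arr V" "Cod V y = VHom C b d"
  shows "x = y"
  using uinverse_ract[OF C uinverse_sym[OF assms(1)] assms(4,3,5,6,7)]
    uinverse_ract[OF C uinverse_sym[OF assms(1)] assms(4,3,5,8,9)] assms(2) by metis

lemma natural_inverse:
  assumes t: "uinverse V C p0 p1 t t'" and u: "uinverse V C q0 q1 u u'"
    and [simp]: "p0 \<in> VObj C" "p1 \<in> VObj C" "q0 \<in> VObj C" "q1 \<in> VObj C"
    and [simp]: "x0 \<in> Arr V" "Cod V x0 = VHom C p0 q0" "x1 \<in> Arr V" "Cod V x1 = VHom C p1 q1"
    and eq: "ract C p0 p1 q1 x1 t = lact C p0 q0 q1 u x0"
  shows "ract C p1 p0 q0 x0 t' = lact C p1 q1 q0 u' x1"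
proof -
  note [simp] = uinverse_V[OF t] uinverse_V[OF u]
  have "ract C p1 p0 q0 x0 t' = ract C p1 p0 q0 (lact C p0 q1 q0 u' (lact C p0 q0 q1 u x0)) t'"
    by (subst uinverse_lact[OF C u]) auto
  also have "\<dots> = lact C p1 q1 q0 u' (ract C p1 p0 q1 (ract C p0 p1 q1 x1 t) t')"
    unfolding eq[symmetric] by (subst lact_ract) auto
  also have "\<dots> = lact C p1 q1 q0 u' x1"
    by (subst uinverse_ract[OF C uinverse_sym[OF t]]) auto
  finally show ?thesis .
qed

end

end

context admissible_cat
begin

text \<open>Strong morphisms in the calculus of graded arrows: a theory morphism is tested on
  \<open>\<tau>\<close>, and naturality is stated by the actions of grade \<open>I\<close>. Inverses
  are chosen pointwise; by \<open>natural_inverse\<close> they are again natural.\<close>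

definition strong_data :: "('o, 'm) thy \<Rightarrow> ('o, 'c, 'm) vfun \<Rightarrow> ('o, 'm) thy \<Rightarrow> ('o, 'c, 'm) vfun \<Rightarrow>
    ('o, 'o, 'm) vfun \<Rightarrow> ('o \<Rightarrow> 'm) \<Rightarrow> bool" where
  "strong_data T A U B M t \<longleftrightarrow> vfunctor V T U M \<and> (\<forall>j\<in>\<J>. FO M j = j) \<and>
     (\<forall>j\<in>\<J>. FA M j (Unit V) \<cdot> \<tau> T j = \<tau> U j) \<and> t \<in> extensional \<J> \<and>
     (\<forall>j\<in>\<J>. \<exists>s. uinverse V C (FO A j) (FO B j) (t j) s) \<and>
     (\<forall>j\<in>\<J>. \<forall>k\<in>\<J>. ract C (FO A j) (FO B j) (FO B k) (FA B j k \<cdot> FA M j k) (t j) =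
        lact C (FO A j) (FO A k) (FO B k) (t k) (FA A j k))"

context
  fixes T U assumes T [simp]: "is_theory V \<J> T" and U [simp]: "is_theory V \<J> U"
begin

text \<open>The structure functor of \<open>U\<close> consists of the unique lifts of
  \<open>\<tau> U j \<cdot> \<epsilon> j k\<close> through \<open>\<tau> U k\<close>. If
  \<open>M\<close> preserves \<open>\<tau>\<close>, it carries the corresponding equation for
  \<open>T\<close> to this one, so it commutes with the structure functors.\<close>

lemma theory_morphism_iff:
  "theory_morphism V \<J> T U M \<longleftrightarrow> vfunctor V T U M \<and> (\<forall>j\<in>\<J>. FO M j = j) \<and>
     (\<forall>j\<in>\<J>. FA M j (Unit V) \<cdot> \<tau> T j = \<tau> U j)"
proof (cases "vfunctor V T U M")
  case M: True
  note ST = theory_functor[OF T] and SU = theory_functor[OF U]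
  note [simp] = ST(2) SU(2) vfunctor_arr[OF ST(1), simplified] vfunctor_arr[OF SU(1), simplified]
    vfunctor_arr[OF M, simplified]
  have "vfun_comp V \<J> M (Str T) = Str U \<longleftrightarrow> (\<forall>j\<in>\<J>. FO M j = j) \<and> (\<forall>j\<in>\<J>. FA M j (Unit V) \<cdot> \<tau> T j = \<tau> U j)"
  proof (intro iffI conjI ballI)
    assume eq: "vfun_comp V \<J> M (Str T) = Str U"
    show FO: "FO M j = j" if "j \<in> \<J>" for j
      using arg_cong[OF eq, of "\<lambda>F. FO F j"] that by simp
    show "FA M j (Unit V) \<cdot> \<tau> T j = \<tau> U j" if [simp]: "j \<in> \<J>" for j
      using arg_cong[OF eq, of "\<lambda>F. FA F j (Unit V) \<cdot> \<kappa>\<^sub>0 j"] by (simp add: \<tau>_def FO)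
  next
    assume *: "(\<forall>j\<in>\<J>. FO M j = j) \<and> (\<forall>j\<in>\<J>. FA M j (Unit V) \<cdot> \<tau> T j = \<tau> U j)"
    hence FO [simp]: "FO M j = j" if "j \<in> \<J>" for j using that by blast
    have e: "gc T j k (Unit V) (\<tau> T k) (FA (Str T) j k) = \<tau> T j \<cdot> \<epsilon> j k"
      "gc U j k (Unit V) (\<tau> U k) (FA (Str U) j k) = \<tau> U j \<cdot> \<epsilon> j k" if "j \<in> \<J>" "k \<in> \<J>" for j k
      using structure_functor_eq[OF _ ST(1) that] structure_functor_eq[OF _ SU(1) that] that by (simp_all add: \<tau>_def)
    show "vfun_comp V \<J> M (Str T) = Str U"
    proof (rule vfun_eqI[where S = \<J>])
      fix j k assume [simp]: "j \<in> \<J>" "k \<in> \<J>"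
      have "gc U j k (Unit V) (\<tau> U k) (FA M j k \<cdot> FA (Str T) j k) =
          FA M j (Unit V) \<cdot> gc T j k (Unit V) (\<tau> T k) (FA (Str T) j k)"
        using * by (subst vfunctor_gc[OF theory_V(1)[OF U] theory_V(1)[OF T] M]) auto
      also have "\<dots> = (FA M j (Unit V) \<cdot> \<tau> T j) \<cdot> \<epsilon> j k"
        by (simp add: e)
      also have "\<dots> = gc U j k (Unit V) (\<tau> U k) (FA (Str U) j k)"
        using * by (simp add: e)
      finally have "FA M j k \<cdot> FA (Str T) j k = FA (Str U) j k"
        by (rule univ_inj[OF univ_\<tau>[OF U \<open>k \<in> \<J>\<close>]]) auto
      thus "FA (vfun_comp V \<J> M (Str T)) j k = FA (Str U) j k" by simp
    qed (use vfunctor_ext[OF SU(1)] in auto)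
  qed
  thus ?thesis using M by (simp add: theory_morphism_def)
qed (simp add: theory_morphism_def)

lemma vnat_iso_iff:
  assumes A [simp]: "is_algebra V \<J> C T A" and G: "vfunctor V T C G"
  shows "vnat_iso V T C A G t \<longleftrightarrow> t \<in> extensional \<J> \<and>
     (\<forall>j\<in>\<J>. \<exists>s. uinverse V C (FO A j) (FO G j) (t j) s) \<and>
     (\<forall>j\<in>\<J>. \<forall>k\<in>\<J>. ract C (FO A j) (FO G j) (FO G k) (FA G j k) (t j) =
        lact C (FO A j) (FO A k) (FO G k) (t k) (FA A j k))" (is "_ \<longleftrightarrow> ?R")
proof -
  note [simp] = algebra_V[OF T A] vfunctor_obj[OF G, simplified] vfunctor_arr[OF G, simplified]
  have 1: "vnat V T C A G t \<longleftrightarrow> t \<in> extensional \<J> \<and> (\<forall>j\<in>\<J>. t j \<in> hom V (Unit V) (VHom C (FO A j) (FO G j))) \<and>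
     (\<forall>j\<in>\<J>. \<forall>k\<in>\<J>. ract C (FO A j) (FO G j) (FO G k) (FA G j k) (t j) =
        lact C (FO A j) (FO A k) (FO G k) (t k) (FA A j k))" for t
    unfolding vnat_def theory_V(2)[OF T] by (auto simp: ract_def lact_def gc_def)
  have 2: "vnat V T C G A s \<longleftrightarrow> s \<in> extensional \<J> \<and> (\<forall>j\<in>\<J>. s j \<in> hom V (Unit V) (VHom C (FO G j) (FO A j))) \<and>
     (\<forall>j\<in>\<J>. \<forall>k\<in>\<J>. ract C (FO G j) (FO A j) (FO A k) (FA A j k) (s j) =
        lact C (FO G j) (FO G k) (FO A k) (s k) (FA G j k))" for s
    unfolding vnat_def theory_V(2)[OF T] by (auto simp: ract_def lact_def gc_def)
  show ?thesis
  proof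
    assume "vnat_iso V T C A G t"
    thus ?R unfolding vnat_iso_def 1 theory_V(2)[OF T] by blast
  next
    assume R: ?R
    then obtain s where s: "\<And>j. j \<in> \<J> \<Longrightarrow> uinverse V C (FO A j) (FO G j) (t j) (s j)"
      by metis
    have "vnat V T C A G t" unfolding 1 using R uinverse_V[OF s] by auto
    moreover have "vnat V T C G A (restrict s \<J>)"
      unfolding 2
    proof (intro conjI ballI)
      fix j k assume jk: "j \<in> \<J>" "k \<in> \<J>"
      have "ract C (FO G j) (FO A j) (FO A k) (FA A j k) (s j) =
        lact C (FO G j) (FO G k) (FO A k) (s k) (FA G j k)"
        by (rule natural_inverse[OF C s s]) (use R jk in auto)
      thus "ract C (FO G j) (FO A j) (FO A k) (FA A j k) (restrict s \<J> j) =
        lact C (FO G j) (FO G k) (FO A k) (restrict s \<J> k) (FA G j k)" using jk by simp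
    qed (use uinverse_V[OF s] in auto)
    ultimately show "vnat_iso V T C A G t"
      unfolding vnat_iso_def theory_V(2)[OF T] using s by (intro conjI exI[of _ "restrict s \<J>"]) auto
  qed
qed

lemma strong_data_iff:
  assumes A [simp]: "is_algebra V \<J> C T A" and B [simp]: "is_algebra V \<J> C U B"
  shows "theory_morphism V \<J> T U M \<and> vnat_iso V T C A (vfun_comp V \<J> B M) t \<longleftrightarrow> strong_data T A U B M t"
proof (cases "theory_morphism V \<J> T U M")
  case M: True
  hence m: "vfunctor V T U M" "\<And>j. j \<in> \<J> \<Longrightarrow> FO M j = j" by (simp_all add: theory_morphism_iff)
  have "vfunctor V T C (vfun_comp V \<J> B M)"
    using vfunctor_comp[OF theory_V(1)[OF T] theory_V(1)[OF U] C m(1) algebra_functor[OF U B]] by simp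
  from vnat_iso_iff[OF A this] M m show ?thesis
    unfolding strong_data_def theory_morphism_iff by simp
qed (auto simp: strong_data_def theory_morphism_iff)

end

lemma strong_morphism_iff:
  "strong_morphism V \<J> C f \<longleftrightarrow> Src f \<in> algebras V \<J> C \<and> Tgt f \<in> algebras V \<J> C \<and>
     strong_data (fst (Src f)) (snd (Src f)) (fst (Tgt f)) (snd (Tgt f)) (MFun f) (MNat f)"
  using strong_data_iff unfolding strong_morphism_def algebras_iff by blast

section \<open>The category of algebras and strong morphisms\<close>

abbreviation "\<A> \<equiv> Alg_s V \<J> C"

lemma hom_Alg_s: "f \<in> hom \<A> X Y \<longleftrightarrow> Src f = X \<and> Tgt f = Y \<and> X \<in> algebras V \<J> C \<and> Y \<in> algebras V \<J> C \<and>
     strong_data (fst X) (snd X) (fst Y) (snd Y) (MFun f) (MNat f)"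
  by (auto simp: hom_def Alg_s_def strong_morphism_iff)

lemma strong_data_V:
  assumes "strong_data T A U B M t"
  shows "vfunctor V T U M" "j \<in> \<J> \<Longrightarrow> FO M j = j" "j \<in> \<J> \<Longrightarrow> FA M j (Unit V) \<cdot> \<tau> T j = \<tau> U j" "t \<in> extensional \<J>"
    "j \<in> \<J> \<Longrightarrow> t j \<in> Arr V" "j \<in> \<J> \<Longrightarrow> Dom V (t j) = Unit V" "j \<in> \<J> \<Longrightarrow> Cod V (t j) = VHom C (FO A j) (FO B j)"
    "j \<in> \<J> \<Longrightarrow> k \<in> \<J> \<Longrightarrow> ract C (FO A j) (FO B j) (FO B k) (FA B j k \<cdot> FA M j k) (t j) =
        lact C (FO A j) (FO A k) (FO B k) (t k) (FA A j k)"
proof -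
  show "j \<in> \<J> \<Longrightarrow> t j \<in> Arr V" "j \<in> \<J> \<Longrightarrow> Dom V (t j) = Unit V" "j \<in> \<J> \<Longrightarrow> Cod V (t j) = VHom C (FO A j) (FO B j)"
    using assms uinverse_V unfolding strong_data_def by metis+
qed (use assms in \<open>simp_all add: strong_data_def\<close>)

lemma strong_data_uinverse:
  assumes "strong_data T A U B M t" "j \<in> \<J>"
  obtains s where "uinverse V C (FO A j) (FO B j) (t j) s"
  using assms unfolding strong_data_def by blast

lemma strong_data_id:
  assumes T [simp]: "is_theory V \<J> T" and A [simp]: "is_algebra V \<J> C T A"
  shows "strong_data T A T A (vfun_id V T) (\<lambda>j\<in>\<J>. VId C (FO A j))"
proof -
  note [simp] = algebra_V[OF T A]
  show ?thesis unfolding strong_data_def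
    using vfunctor_vfun_id[OF theory_V(1)[OF T]] by (auto intro!: exI uinverse_id[OF C])
qed

lemma strong_data_comp:
  assumes [simp]: "is_theory V \<J> T" "is_theory V \<J> U" "is_theory V \<J> W"
    "is_algebra V \<J> C T A" "is_algebra V \<J> C U B" "is_algebra V \<J> C W E"
    and f: "strong_data T A U B M t" and g: "strong_data U B W E N u"
  shows "strong_data T A W E (vfun_comp V \<J> N M) (\<lambda>j\<in>\<J>. lact C (FO A j) (FO B j) (FO E j) (u j) (t j))"
proof -
  note [simp] = strong_data_V(2-7)[OF f] strong_data_V(2-7)[OF g]
    vfunctor_arr[OF strong_data_V(1)[OF f], simplified] vfunctor_arr[OF strong_data_V(1)[OF g], simplified]
    algebra_V[OF assms(1,4)] algebra_V[OF assms(2,5)] algebra_V[OF assms(3,6)]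
  have 1: "\<exists>s. uinverse V C (FO A j) (FO E j) (lact C (FO A j) (FO B j) (FO E j) (u j) (t j)) s" if j [simp]: "j \<in> \<J>" for j
  proof -
    obtain s where s: "uinverse V C (FO A j) (FO B j) (t j) s" by (rule strong_data_uinverse[OF f j])
    obtain s' where s': "uinverse V C (FO B j) (FO E j) (u j) s'" by (rule strong_data_uinverse[OF g j])
    from uinverse_comp[OF C s s'] show ?thesis by auto
  qed
  have 2: "ract C (FO A j) (FO E j) (FO E k) (FA E j k \<cdot> FA N j k \<cdot> FA M j k) (lact C (FO A j) (FO B j) (FO E j) (u j) (t j))
      = lact C (FO A j) (FO A k) (FO E k) (lact C (FO A k) (FO B k) (FO E k) (u k) (t k)) (FA A j k)"
    if [simp]: "j \<in> \<J>" "k \<in> \<J>" for j k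
  proof -
    have "ract C (FO A j) (FO E j) (FO E k) (FA E j k \<cdot> FA N j k \<cdot> FA M j k) (lact C (FO A j) (FO B j) (FO E j) (u j) (t j))
        = ract C (FO A j) (FO B j) (FO E k) (ract C (FO B j) (FO E j) (FO E k) ((FA E j k \<cdot> FA N j k) \<cdot> FA M j k) (u j)) (t j)"
      by (subst ract_ract[OF C]) (simp_all add: ract_eq_lact)
    also have "\<dots> = ract C (FO A j) (FO B j) (FO E k) (lact C (FO B j) (FO B k) (FO E k) (u k) (FA B j k \<cdot> FA M j k)) (t j)"
      using strong_data_V(8)[OF g that] by (simp add: ract_reindex lact_reindex del: comp_assoc)
    also have "\<dots> = lact C (FO A j) (FO B k) (FO E k) (u k) (lact C (FO A j) (FO A k) (FO B k) (t k) (FA A j k))"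
      using strong_data_V(8)[OF f that] by (simp add: lact_ract[symmetric])
    also have "\<dots> = lact C (FO A j) (FO A k) (FO E k) (lact C (FO A k) (FO B k) (FO E k) (u k) (t k)) (FA A j k)"
      by (subst lact_lact) auto
    finally show ?thesis .
  qed
  show ?thesis unfolding strong_data_def
    using vfunctor_comp[OF _ _ _ strong_data_V(1)[OF f] strong_data_V(1)[OF g]] strong_data_V(3)[OF f] strong_data_V(3)[OF g] 1 2
    by simp
qed

lemma Alg_s_V:
  "Obj \<A> = algebras V \<J> C" "f \<in> Arr \<A> \<longleftrightarrow> strong_morphism V \<J> C f" "Dom \<A> = Src" "Cod \<A> = Tgt"
  by (simp_all add: Alg_s_def)

lemma id_Alg_s:
  assumes "X \<in> algebras V \<J> C"
  shows "Id \<A> X \<in> hom \<A> X X" "under V (Id \<A> X) = VId C (car X)"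
proof -
  show "Id \<A> X \<in> hom \<A> X X"
    using assms strong_data_id[of "fst X" "snd X"] unfolding hom_Alg_s algebras_iff by (simp add: Alg_s_def)
  show "under V (Id \<A> X) = VId C (car X)"
    by (simp add: Alg_s_def under_def alg_carrier_def)
qed

lemma comp_Alg_s:
  assumes f: "f \<in> hom \<A> X Y" and g: "g \<in> hom \<A> Y Z"
  shows "Src (g \<cdot>\<^bsub>\<A>\<^esub> f) = X" "Tgt (g \<cdot>\<^bsub>\<A>\<^esub> f) = Z" "MFun (g \<cdot>\<^bsub>\<A>\<^esub> f) = vfun_comp V \<J> (MFun g) (MFun f)"
    "MNat (g \<cdot>\<^bsub>\<A>\<^esub> f) = (\<lambda>j\<in>\<J>. lact C (FO (snd X) j) (FO (snd Y) j) (FO (snd Z) j) (MNat g j) (MNat f j))"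
proof -
  have f': "Src f = X" "Tgt f = Y" "strong_data (fst X) (snd X) (fst Y) (snd Y) (MFun f) (MNat f)"
    and g': "Src g = Y" "Tgt g = Z" "strong_data (fst Y) (snd Y) (fst Z) (snd Z) (MFun g) (MNat g)"
    and [simp]: "is_theory V \<J> (fst X)" "is_theory V \<J> (fst Y)" "is_theory V \<J> (fst Z)"
      "is_algebra V \<J> C (fst X) (snd X)" "is_algebra V \<J> C (fst Y) (snd Y)" "is_algebra V \<J> C (fst Z) (snd Z)"
    using f g unfolding hom_Alg_s algebras_iff by auto
  note [simp] = strong_data_V[OF f'(3)] strong_data_V[OF g'(3)] algebra_V(1)[of "fst X" "snd X"]
    algebra_V(1)[of "fst Y" "snd Y"] algebra_V(1)[of "fst Z" "snd Z"]
  show "Src (g \<cdot>\<^bsub>\<A>\<^esub> f) = X" "Tgt (g \<cdot>\<^bsub>\<A>\<^esub> f) = Z" "MFun (g \<cdot>\<^bsub>\<A>\<^esub> f) = vfun_comp V \<J> (MFun g) (MFun f)"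
    using f' g' by (simp_all add: Alg_s_def)
  show "MNat (g \<cdot>\<^bsub>\<A>\<^esub> f) = (\<lambda>j\<in>\<J>. lact C (FO (snd X) j) (FO (snd Y) j) (FO (snd Z) j) (MNat g j) (MNat f j))"
    using f' g' by (auto simp: Alg_s_def ucomp_lact fun_eq_iff)
qed

lemma comp_Alg_s_hom:
  assumes f: "f \<in> hom \<A> X Y" and g: "g \<in> hom \<A> Y Z"
  shows "g \<cdot>\<^bsub>\<A>\<^esub> f \<in> hom \<A> X Z"
    "under V (g \<cdot>\<^bsub>\<A>\<^esub> f) = lact C (car X) (car Y) (car Z) (under V g) (under V f)"
proof -
  show "g \<cdot>\<^bsub>\<A>\<^esub> f \<in> hom \<A> X Z"
    using f g strong_data_comp[of "fst X" "fst Y" "fst Z" "snd X" "snd Y" "snd Z" "MFun f" "MNat f" "MFun g" "MNat g"]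
    by (simp add: hom_Alg_s[of _ X Z] comp_Alg_s[OF f g]) (simp add: hom_Alg_s algebras_iff)
  show "under V (g \<cdot>\<^bsub>\<A>\<^esub> f) = lact C (car X) (car Y) (car Z) (under V g) (under V f)"
    by (simp add: comp_Alg_s[OF f g] under_def alg_carrier_def)
qed

lemma under_V:
  assumes "f \<in> hom \<A> X Y"
  shows "car X \<in> VObj C" "car Y \<in> VObj C" "under V f \<in> Arr V" "Dom V (under V f) = Unit V"
    "Cod V (under V f) = VHom C (car X) (car Y)" "\<exists>s. uinverse V C (car X) (car Y) (under V f) s"
proof -
  have *: "strong_data (fst X) (snd X) (fst Y) (snd Y) (MFun f) (MNat f)"
    "is_theory V \<J> (fst X)" "is_theory V \<J> (fst Y)"
    "is_algebra V \<J> C (fst X) (snd X)" "is_algebra V \<J> C (fst Y) (snd Y)"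
    using assms unfolding hom_Alg_s algebras_iff by auto
  show "car X \<in> VObj C" "car Y \<in> VObj C"
    using algebra_V(1)[OF *(2,4)] algebra_V(1)[OF *(3,5)] by (simp_all add: alg_carrier_def)
  show "under V f \<in> Arr V" "Dom V (under V f) = Unit V" "Cod V (under V f) = VHom C (car X) (car Y)"
    using strong_data_V(5-7)[OF *(1), of "Unit V"] by (simp_all add: under_def alg_carrier_def)
  show "\<exists>s. uinverse V C (car X) (car Y) (under V f) s"
    by (rule strong_data_uinverse[OF *(1) arities_V(2)]) (auto simp: under_def alg_carrier_def)
qed

text \<open>As \<open>B\<close> preserves \<open>j = [j, I]\<close>, the component at
  \<open>I\<close> forces the component at \<open>j\<close>. Since components are invertible,
  naturality then determines \<open>FA B j k \<cdot> FA M j k\<close>, and \<open>faithful\<close>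
  determines the theory morphism \<open>M\<close>.\<close>

lemma Alg_s_eqI:
  fixes f g :: "('o, 'c, 'm) strong"
  assumes f: "f \<in> hom \<A> X Y" and g: "g \<in> hom \<A> X Y" and eq: "under V f = under V g"
    and faithful: "\<And>j k. j \<in> \<J> \<Longrightarrow> k \<in> \<J> \<Longrightarrow> FA (snd Y) j k \<cdot> FA (MFun f) j k = FA (snd Y) j k \<cdot> FA (MFun g) j k \<Longrightarrow>
      FA (MFun f) j k = FA (MFun g) j k"
  shows "f = g"
proof -
  obtain T A U B where X: "X = (T, A)" and Y: "Y = (U, B)" by (meson surj_pair)
  have F: "strong_data T A U B (MFun f) (MNat f)" and G: "strong_data T A U B (MFun g) (MNat g)"
    and [simp]: "is_theory V \<J> T" "is_theory V \<J> U" "is_algebra V \<J> C T A" "is_algebra V \<J> C U B"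
    using f g unfolding hom_Alg_s algebras_iff X Y by auto
  note [simp] = strong_data_V(2-7)[OF F] strong_data_V(2-7)[OF G] algebra_V[of T A] algebra_V[of U B]
    vfunctor_arr[OF strong_data_V(1)[OF F], simplified] vfunctor_arr[OF strong_data_V(1)[OF G], simplified]
  have nat: "MNat f j = MNat g j" if [simp]: "j \<in> \<J>" for j
  proof (rule univ_ract_inj[OF C univ_algebra[of U B j]])
    \<comment> \<open>Naturality at \<open>\<tau> T j\<close>, which \<open>MFun h\<close> carries
      to \<open>\<tau> U j\<close>: the right-hand side sees \<open>MNat h\<close> only at
      \<open>I\<close>.\<close>
    have *: "ract C (FO A j) (FO B j) (FO B (Unit V)) (FA B j (Unit V) \<cdot> \<tau> U j) (MNat h j) =
       lact C (FO A j) (FO A (Unit V)) (FO B (Unit V)) (MNat h (Unit V)) (FA A j (Unit V) \<cdot> \<tau> T j)"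
      if H: "strong_data T A U B (MFun h) (MNat h)" for h
    proof -
      note [simp] = strong_data_V(2-7)[OF H] vfunctor_arr[OF strong_data_V(1)[OF H], simplified]
      have "ract C (FO A j) (FO B j) (FO B (Unit V)) (FA B j (Unit V) \<cdot> \<tau> U j) (MNat h j) =
        ract C (FO A j) (FO B j) (FO B (Unit V)) (FA B j (Unit V) \<cdot> FA (MFun h) j (Unit V) \<cdot> \<tau> T j) (MNat h j)"
        by simp
      also have "\<dots> = ract C (FO A j) (FO B j) (FO B (Unit V)) ((FA B j (Unit V) \<cdot> FA (MFun h) j (Unit V)) \<cdot> \<tau> T j) (MNat h j)"
        by (subst comp_assoc) auto
      also have "\<dots> = lact C (FO A j) (FO A (Unit V)) (FO B (Unit V)) (MNat h (Unit V)) (FA A j (Unit V) \<cdot> \<tau> T j)"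
        by (subst ract_reindex) (auto simp: strong_data_V(8)[OF H] lact_reindex)
      finally show ?thesis .
    qed
    show "ract C (FO A j) (FO B j) (FO B (Unit V)) (FA B j (Unit V) \<cdot> \<tau> U j) (MNat f j) =
        ract C (FO A j) (FO B j) (FO B (Unit V)) (FA B j (Unit V) \<cdot> \<tau> U j) (MNat g j)"
      using *[OF F] *[OF G] eq by (simp add: under_def)
  qed auto
  have "MNat f = MNat g"
    by (rule extensionalityI[of _ \<J>]) (auto simp: nat)
  moreover have "MFun f = MFun g"
  proof (rule vfun_eqI[where S = \<J>])
    fix j k assume [simp]: "j \<in> \<J>" "k \<in> \<J>"
    obtain s where "uinverse V C (FO A j) (FO B j) (MNat f j) s"
      by (rule strong_data_uinverse[OF F \<open>j \<in> \<J>\<close>])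
    hence "FA B j k \<cdot> FA (MFun f) j k = FA B j k \<cdot> FA (MFun g) j k"
    proof (rule uinverse_ract_inj[OF C])
      show "ract C (FO A j) (FO B j) (FO B k) (FA B j k \<cdot> FA (MFun f) j k) (MNat f j) =
          ract C (FO A j) (FO B j) (FO B k) (FA B j k \<cdot> FA (MFun g) j k) (MNat f j)"
        using strong_data_V(8)[OF F, of j k] strong_data_V(8)[OF G, of j k] by (simp add: nat)
    qed auto
    thus "FA (MFun f) j k = FA (MFun g) j k" using faithful[of j k] by (simp add: Y)
  qed (use vfunctor_ext[OF strong_data_V(1)[OF F]] vfunctor_ext[OF strong_data_V(1)[OF G]] in simp_all)
  ultimately show ?thesis using f g unfolding hom_Alg_s by (intro strong.equality) simp_all
qed

lemma commutant_eqI: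
  assumes f: "f \<in> hom \<A> X (com Y)" and g: "g \<in> hom \<A> X (com Y)" and eq: "under V f = under V g"
    and Y: "Y \<in> algebras V \<J> C"
  shows "f = g"
proof (rule Alg_s_eqI[OF f g eq])
  obtain U B where Y': "Y = (U, B)" and [simp]: "is_theory V \<J> U" "is_algebra V \<J> C U B"
    using Y by (cases Y) (auto simp: algebras_iff)
  have F: "vfunctor V (fst X) (fst (com Y)) (MFun f)" "vfunctor V (fst X) (fst (com Y)) (MFun g)"
    "\<And>j. j \<in> \<J> \<Longrightarrow> FO (MFun f) j = j" "\<And>j. j \<in> \<J> \<Longrightarrow> FO (MFun g) j = j" "is_theory V \<J> (fst X)"
    using f g unfolding hom_Alg_s algebras_iff strong_data_def by auto
  fix j k assume [simp]: "j \<in> \<J>" "k \<in> \<J>"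
  note [simp] = vfunctor_arr[OF F(1), simplified theory_V[OF F(5)]] vfunctor_arr[OF F(2), simplified theory_V[OF F(5)]] F
  assume "FA (snd (com Y)) j k \<cdot> FA (MFun f) j k = FA (snd (com Y)) j k \<cdot> FA (MFun g) j k"
  thus "FA (MFun f) j k = FA (MFun g) j k"
    unfolding Y'
    by - (rule end_inj_unit[of U "alg_cot V \<J> C j B" "alg_cot V \<J> C k B" _ _ "VHom (fst X) j k"],
      simp_all add: alg_cot_algebra Y'[symmetric], simp_all add: Y')
qed

text \<open>The target of a strong morphism may be any algebra, where the underlying isomorphism
  need not determine the theory morphism. The laws are therefore verified on both components of the
  record.\<close>

lemma category_Alg_s: "category \<A>"
  unfolding category_def
proof (intro conjI ballI allI impI)
  fix f assume "f \<in> Arr \<A>"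
  thus "Dom \<A> f \<in> Obj \<A>" "Cod \<A> f \<in> Obj \<A>" by (simp_all add: Alg_s_V strong_morphism_iff)
next
  fix X assume "X \<in> Obj \<A>" thus "Id \<A> X \<in> hom \<A> X X" by (simp add: Alg_s_V id_Alg_s)
next
  fix X Y Z f g assume "f \<in> hom \<A> X Y" "g \<in> hom \<A> Y Z"
  thus "g \<cdot>\<^bsub>\<A>\<^esub> f \<in> hom \<A> X Z" by (rule comp_Alg_s_hom)
next
  fix X Y f assume f: "f \<in> hom \<A> X Y"
  have o: "X \<in> algebras V \<J> C" "Y \<in> algebras V \<J> C" and F: "strong_data (fst X) (snd X) (fst Y) (snd Y) (MFun f) (MNat f)"
    and [simp]: "is_theory V \<J> (fst X)" "is_theory V \<J> (fst Y)"
      "is_algebra V \<J> C (fst X) (snd X)" "is_algebra V \<J> C (fst Y) (snd Y)"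
    using f unfolding hom_Alg_s algebras_iff by auto
  note c = comp_Alg_s[OF id_Alg_s(1)[OF o(1)] f] comp_Alg_s[OF f id_Alg_s(1)[OF o(2)]]
  note [simp] = strong_data_V(2-7)[OF F] algebra_V(1)[of "fst X" "snd X"] algebra_V(1)[of "fst Y" "snd Y"]
    vfunctor_arr[OF strong_data_V(1)[OF F], simplified]
  note ext = vfunctor_ext[OF strong_data_V(1)[OF F], simplified]
  have m: "MFun (Id \<A> X) = vfun_id V (fst X)" "MNat (Id \<A> X) = (\<lambda>j\<in>\<J>. VId C (FO (snd X) j))" for X
    by (simp_all add: Alg_s_def)
  have e: "h = f" if "Src h = X" "Tgt h = Y" "MFun h = MFun f" "MNat h = MNat f" for h :: "('o, 'c, 'm) strong"
    using that f by (intro strong.equality) (simp_all add: hom_Alg_s)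
  show "f \<cdot>\<^bsub>\<A>\<^esub> Id \<A> X = f"
  proof (rule e)
    show "MFun (f \<cdot>\<^bsub>\<A>\<^esub> Id \<A> X) = MFun f"
      unfolding c m by (rule vfun_eqI[where S = \<J>]) (auto simp: ext)
    show "MNat (f \<cdot>\<^bsub>\<A>\<^esub> Id \<A> X) = MNat f"
      unfolding c m by (rule extensionalityI[of _ \<J>]) auto
  qed (simp_all add: c)
  show "Id \<A> Y \<cdot>\<^bsub>\<A>\<^esub> f = f"
  proof (rule e)
    show "MFun (Id \<A> Y \<cdot>\<^bsub>\<A>\<^esub> f) = MFun f"
      unfolding c m by (rule vfun_eqI[where S = \<J>]) (auto simp: ext)
    show "MNat (Id \<A> Y \<cdot>\<^bsub>\<A>\<^esub> f) = MNat f"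
      unfolding c m by (rule extensionalityI[of _ \<J>]) auto
  qed (simp_all add: c)
next
  fix W X Y Z f g h assume f: "f \<in> hom \<A> W X" and g: "g \<in> hom \<A> X Y" and h: "h \<in> hom \<A> Y Z"
  have F: "strong_data (fst W) (snd W) (fst X) (snd X) (MFun f) (MNat f)"
    and G: "strong_data (fst X) (snd X) (fst Y) (snd Y) (MFun g) (MNat g)"
    and H: "strong_data (fst Y) (snd Y) (fst Z) (snd Z) (MFun h) (MNat h)"
    and [simp]: "is_theory V \<J> (fst W)" "is_theory V \<J> (fst X)" "is_theory V \<J> (fst Y)" "is_theory V \<J> (fst Z)"
      "is_algebra V \<J> C (fst W) (snd W)" "is_algebra V \<J> C (fst X) (snd X)" "is_algebra V \<J> C (fst Y) (snd Y)"
      "is_algebra V \<J> C (fst Z) (snd Z)"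
    using f g h unfolding hom_Alg_s algebras_iff by auto
  note [simp] = strong_data_V(2-7)[OF F] strong_data_V(2-7)[OF G] strong_data_V(2-7)[OF H]
    algebra_V(1)[of "fst W" "snd W"] algebra_V(1)[of "fst X" "snd X"] algebra_V(1)[of "fst Y" "snd Y"] algebra_V(1)[of "fst Z" "snd Z"]
    vfunctor_arr[OF strong_data_V(1)[OF F], simplified] vfunctor_arr[OF strong_data_V(1)[OF G], simplified]
    vfunctor_arr[OF strong_data_V(1)[OF H], simplified]
  note c = comp_Alg_s[OF comp_Alg_s_hom(1)[OF f g] h] comp_Alg_s[OF f comp_Alg_s_hom(1)[OF g h]]
    comp_Alg_s[OF f g] comp_Alg_s[OF g h]
  show "h \<cdot>\<^bsub>\<A>\<^esub> (g \<cdot>\<^bsub>\<A>\<^esub> f) = (h \<cdot>\<^bsub>\<A>\<^esub> g) \<cdot>\<^bsub>\<A>\<^esub> f"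
  proof (rule strong.equality)
    show "MFun (h \<cdot>\<^bsub>\<A>\<^esub> (g \<cdot>\<^bsub>\<A>\<^esub> f)) = MFun ((h \<cdot>\<^bsub>\<A>\<^esub> g) \<cdot>\<^bsub>\<A>\<^esub> f)"
      unfolding c by (rule vfun_eqI[where S = \<J>]) auto
    show "MNat (h \<cdot>\<^bsub>\<A>\<^esub> (g \<cdot>\<^bsub>\<A>\<^esub> f)) = MNat ((h \<cdot>\<^bsub>\<A>\<^esub> g) \<cdot>\<^bsub>\<A>\<^esub> f)"
      unfolding c by (rule extensionalityI[of _ \<J>]) (auto simp: lact_lact)
  qed (simp_all add: c)
qed

end

section \<open>Symmetry of commutation\<close>

context smcc
begin

definition conjugate :: "('c, 'o, 'm, 'z) vcat_scheme \<Rightarrow> 'c \<Rightarrow> 'c \<Rightarrow> 'c \<Rightarrow> 'c \<Rightarrow> 'm \<Rightarrow> 'm \<Rightarrow> 'm \<Rightarrow> 'm" where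
  "conjugate C a b c d t x s = lact C a c d t (ract C a b c x s)"

context
  fixes C :: "('c, 'o, 'm, 'z) vcat_scheme"
  assumes C [simp]: "vcategory V C"
begin

text \<open>A naturality square is a square of grade \<open>I\<close> by \<open>sq_unit\<close>; it
  is pasted on, and the extra factor \<open>I\<close> of the grade is removed by a unit
  constraint.\<close>

lemma sq_lact:
  assumes "sq C X Y p0 p1 q0 q1 x0 x1 yp yq" "p2 \<in> VObj C" "q2 \<in> VObj C" "x2 \<in> hom V X (VHom C p2 q2)"
    "s \<in> hom V (Unit V) (VHom C p1 p2)" "t \<in> hom V (Unit V) (VHom C q1 q2)"
    and eq: "ract C p1 p2 q2 x2 s = lact C p1 q1 q2 t x1"
  shows "sq C X Y p0 p2 q0 q2 x0 x2 (lact C p0 p1 p2 s yp) (lact C q0 q1 q2 t yq)"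
proof -
  have o: "X \<in> Obj V" "Y \<in> Obj V"
    using assms(1) unfolding sq_def hom_V by (metis dom_cod_obj(1))+
  have "sq C X (Unit V) p1 p2 q1 q2 x1 x2 s t"
    using assms by (subst sq_unit[OF C]) (auto simp: sq_def)
  from sq_reindex[OF C sq_paste[OF C this assms(1)], of "Id V X" X "inv_arr V (LUnit V Y)" Y]
  show ?thesis using assms o unfolding lact_def sq_def by auto
qed

lemma sq_ract:
  assumes "sq C X Y p1 p2 q1 q2 x1 x2 yp yq" "p0 \<in> VObj C" "q0 \<in> VObj C" "x0 \<in> hom V X (VHom C p0 q0)"
    "s \<in> hom V (Unit V) (VHom C p0 p1)" "t \<in> hom V (Unit V) (VHom C q0 q1)"
    and eq: "ract C p0 p1 q1 x1 s = lact C p0 q0 q1 t x0"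
  shows "sq C X Y p0 p2 q0 q2 x0 x2 (ract C p0 p1 p2 yp s) (ract C q0 q1 q2 yq t)"
proof -
  have o: "X \<in> Obj V" "Y \<in> Obj V"
    using assms(1) unfolding sq_def hom_V by (metis dom_cod_obj(1))+
  have "sq C X (Unit V) p0 p1 q0 q1 x0 x1 s t"
    using assms by (subst sq_unit[OF C]) (auto simp: sq_def)
  from sq_reindex[OF C sq_paste[OF C assms(1) this], of "Id V X" X "inv_arr V (RUnit V Y)" Y]
  show ?thesis using assms o unfolding ract_def sq_def by auto
qed

lemma conjugate_gc:
  assumes t: "uinverse V C b b' t s" and [simp]: "a \<in> VObj C" "a' \<in> VObj C" "b \<in> VObj C" "b' \<in> VObj C" "c \<in> VObj C" "c' \<in> VObj C"
    and [simp]: "r \<in> Arr V" "Dom V r = Unit V" "Cod V r = VHom C a' a" "u \<in> Arr V" "Dom V u = Unit V" "Cod V u = VHom C c c'"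
      "x \<in> Arr V" "Cod V x = VHom C a b" "y \<in> Arr V" "Cod V y = VHom C b c"
  shows "gc C a' b' c' (conjugate C b' b c c' u y s) (conjugate C a' a b b' t x r) = conjugate C a' a c c' u (gc C a b c y x) r"
proof -
  note [simp] = uinverse_V[OF t]
  have "gc C a' b' c' (conjugate C b' b c c' u y s) (conjugate C a' a b b' t x r) =
      lact C a' c c' u (gc C a' b' c (ract C b' b c y s) (lact C a' b b' t (ract C a' a b x r)))"
    unfolding conjugate_def by (subst lact_gc) auto
  also have "\<dots> = lact C a' c c' u (gc C a' b c y (lact C a' b' b s (lact C a' b b' t (ract C a' a b x r))))"
    by (subst gc_ract_lact) auto
  also have "\<dots> = lact C a' c c' u (gc C a' b c y (ract C a' a b x r))"
    by (subst uinverse_lact[OF C t]) auto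
  also have "\<dots> = conjugate C a' a c c' u (gc C a b c y x) r"
    unfolding conjugate_def by (subst ract_gc) auto
  finally show ?thesis .
qed

end

end

context admissible_cat
begin

text \<open>
  The square for \<open>n\<close> and \<open>j\<close> gives an isomorphism \<open>\<theta> j n : [j, B n] \<rightarrow> [n, A j]\<close>, natural in \<open>j\<close> because \<open>M\<close> takes
  values in homomorphisms of \<open>U\<close>-algebras. Conjugating \<open>[j, B -]\<close> with \<open>\<theta> j\<close> makes \<open>U\<close> act on the
  \<open>T\<close>-algebras \<open>[n, A]\<close>, and \<open>\<theta> I\<close> is the isomorphism of \<open>U\<close>-algebras from \<open>B\<close> to the commutant of \<open>A\<close>.
\<close>

lemma commutant_symmetric_data:
  assumes T [simp]: "is_theory V \<J> T" and A [simp]: "is_algebra V \<J> C T A"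
    and U [simp]: "is_theory V \<J> U" and B [simp]: "is_algebra V \<J> C U B"
    and f: "strong_data T A (fst (com (U, B))) (snd (com (U, B))) M t"
    and s0: "uinverse V C (FO A (Unit V)) (FO B (Unit V)) (t (Unit V)) s0"
  obtains N u where "strong_data U B (fst (com (T, A))) (snd (com (T, A))) N u" "u (Unit V) = s0"
proof -
  let ?I = "Unit V"
  let ?b = "FO B (Unit V)" and ?U = "fst (com (U, B))" and ?B = "snd (com (U, B))"
  let ?T = "fst (com (T, A))" and ?A = "snd (com (T, A))"
  let ?c = "alg_cot V \<J> C"
  note [simp] = algebra_V[OF T A] algebra_V[OF U B] alg_cot_algebra[OF T A] alg_cot_algebra[OF U B]
    alg_cot_unit[OF T A] alg_cot_unit[OF U B]
    algebra_V[OF T alg_cot_algebra[OF T A]] algebra_V[OF U alg_cot_algebra[OF U B]] strong_data_V(2-7)[OF f]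
    vfunctor_arr[OF strong_data_V(1)[OF f], simplified] end_V[OF U] end_V[OF T] commutant_V[OF U B] commutant_V[OF T A]
  \<comment> \<open>The action of the operations in \<open>VHom T j k\<close> on \<open>B n\<close>
    that \<open>M\<close> provides: the component at \<open>n\<close> of a homomorphism from
    \<open>[j, B]\<close> to \<open>[k, B]\<close>.\<close>
  define m where "m j k n = end_proj V U C (?c j B) (?c k B) n \<cdot> FA M j k" for j k n
  have m [simp]: "m j k n \<in> Arr V" "Dom V (m j k n) = VHom T j k" "Cod V (m j k n) = VHom C (cot j (FO B n)) (cot k (FO B n))"
    if "j \<in> \<J>" "k \<in> \<J>" "n \<in> \<J>" for j k n
    using that by (simp_all add: m_def)
  \<comment> \<open>The wedge condition with the gradings exchanged: read from the side of
    \<open>U\<close>, it says that the operations of \<open>U\<close> act by maps compatible with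
    \<open>T\<close>.\<close>
  have m_sq: "sq C (VHom T j k) X (cot j (FO B n)) (cot j (FO B l)) (cot k (FO B n)) (cot k (FO B l)) (m j k n) (m j k l)
      (cota j (FO B n) (FO B l) \<cdot> FA B n l \<cdot> x) (cota k (FO B n) (FO B l) \<cdot> FA B n l \<cdot> x)"
    if [simp]: "j \<in> \<J>" "k \<in> \<J>" "n \<in> \<J>" "l \<in> \<J>" "x \<in> Arr V" "Dom V x = X" "Cod V x = VHom U n l" for j k n l x X
  proof -
    have w: "hom_wedge V U C (?c j B) (?c k B) (VHom T j k) (m j k)"
      unfolding m_def by (rule hom_wedge_reindex[OF U end_wedge[OF U]]) auto
    show ?thesis
      using sq_flip[OF C hom_wedge_sq[OF U w, of n l x X]] by simp
  qed
  have nat_t: "ract C (FO A j) (cot j ?b) (cot k ?b) (m j k ?I) (t j) = lact C (FO A j) (FO A k) (cot k ?b) (t k) (FA A j k)"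
    if "j \<in> \<J>" "k \<in> \<J>" for j k
    using strong_data_V(8)[OF f that] that by (simp add: m_def)
  have "\<exists>s. uinverse V C (FO A j) (cot j ?b) (t j) s" if "j \<in> \<J>" for j
    by (rule strong_data_uinverse[OF f that]) (use that in auto)
  then obtain s where s: "\<And>j. j \<in> \<J> \<Longrightarrow> uinverse V C (FO A j) (cot j ?b) (t j) (s j)" by metis
  note [simp] = uinverse_V(4-6)[OF s]
  have nat_s: "ract C (cot j ?b) (FO A j) (FO A k) (FA A j k) (s j) = lact C (cot j ?b) (cot k ?b) (FO A k) (s k) (m j k ?I)"
    if "j \<in> \<J>" "k \<in> \<J>" for j k
    by (rule natural_inverse[OF C s s]) (use that nat_t in auto)
  have s_unit: "s ?I = s0"
    by (rule uinverse_unique[OF C s]) (use s0 in auto)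
  define \<kappa> where "\<kappa> n = FA B n ?I \<cdot> \<tau> U n" for n
  have \<kappa>: "univ C n ?b (FO B n) (\<kappa> n)" if "n \<in> \<J>" for n
    unfolding \<kappa>_def by (rule univ_algebra[OF U B that])
  have \<kappa>_unit: "\<kappa> ?I = VId C ?b"
    using vfunctor_id[OF algebra_functor[OF U B], of ?I] by (simp add: \<kappa>_def \<tau>_unit)
  note [simp] = univ_V[OF \<kappa>]
  \<comment> \<open>As \<open>[j, -]\<close> preserves the cotensor \<open>B n = [n, B I]\<close>,
    the object \<open>[j, B n]\<close> is \<open>[n, [j, B I]]\<close>, which \<open>s j\<close>
    identifies with a cotensor \<open>[n, A j]\<close>. Its counit is \<open>\<rho> j n\<close>, and
    \<open>\<theta> j n\<close> compares it with the designated one.\<close>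
  define \<rho> where "\<rho> j n = lact C (cot j (FO B n)) (cot j ?b) (FO A j) (s j) (cota j (FO B n) ?b \<cdot> \<kappa> n)" for j n
  have \<rho>: "univ C n (FO A j) (cot j (FO B n)) (\<rho> j n)" if [simp]: "j \<in> \<J>" "n \<in> \<J>" for j n
    unfolding \<rho>_def by (rule univ_lact[OF C univ_cota uinverse_sym[OF s]]) (auto simp: \<kappa>)
  note [simp] = univ_V[OF \<rho>]
  have "\<exists>\<theta> \<theta>'. uinverse V C (cot j (FO B n)) (cot n (FO A j)) \<theta> \<theta>' \<and>
      ract C (cot j (FO B n)) (cot n (FO A j)) (FO A j) (cnt n (FO A j)) \<theta> = \<rho> j n" if j: "j \<in> \<J>" "n \<in> \<J>" for j n
    by (rule univ_unique[OF C univ_cnt[OF j(2)] \<rho>[OF j]]) (use j in auto)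
  then obtain \<theta> \<theta>' where \<theta>: "\<And>j n. j \<in> \<J> \<Longrightarrow> n \<in> \<J> \<Longrightarrow> uinverse V C (cot j (FO B n)) (cot n (FO A j)) (\<theta> j n) (\<theta>' j n)"
    "\<And>j n. j \<in> \<J> \<Longrightarrow> n \<in> \<J> \<Longrightarrow> ract C (cot j (FO B n)) (cot n (FO A j)) (FO A j) (cnt n (FO A j)) (\<theta> j n) = \<rho> j n"
    by metis
  note [simp] = uinverse_V[OF \<theta>(1)]
  have \<theta>_unit: "\<theta> j ?I = s j" if [simp]: "j \<in> \<J>" for j
  proof -
    have "\<theta> j ?I = ract C (cot j ?b) (FO A j) (FO A j) (VId C (FO A j)) (\<theta> j ?I)"
      using uinverse_V[OF \<theta>(1)[OF that arities_V(2)]] by (simp add: ract_eq_lact)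
    also have "\<dots> = \<rho> j ?I" using \<theta>(2)[OF that arities_V(2)] by simp
    also have "\<dots> = s j" by (simp add: \<rho>_def \<kappa>_unit cota_id)
    finally show ?thesis .
  qed
  have nat_\<theta>: "ract C (cot j (FO B n)) (cot n (FO A j)) (cot n (FO A k)) (cota n (FO A j) (FO A k) \<cdot> FA A j k) (\<theta> j n)
      = lact C (cot j (FO B n)) (cot k (FO B n)) (cot n (FO A k)) (\<theta> k n) (m j k n)"
    if [simp]: "j \<in> \<J>" "k \<in> \<J>" "n \<in> \<J>" for j k n
  proof -
    have 1: "sq C (VHom T j k) n (cot j (FO B n)) (cot j ?b) (cot k (FO B n)) (cot k ?b) (m j k n) (m j k ?I)
       (cota j (FO B n) ?b \<cdot> \<kappa> n) (cota k (FO B n) ?b \<cdot> \<kappa> n)"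
      using m_sq[of j k n ?I "\<tau> U n" n] by (simp add: \<kappa>_def)
    have 2: "sq C (VHom T j k) n (cot j (FO B n)) (FO A j) (cot k (FO B n)) (FO A k) (m j k n) (FA A j k) (\<rho> j n) (\<rho> k n)"
      unfolding \<rho>_def by (rule sq_lact[OF C 1]) (auto simp: nat_s)
    have r: "gc C (cot j (FO B n)) (cot n (FO A j)) (FO A j) (cnt n (FO A j)) (\<theta> j n) = \<rho> j n \<cdot> RUnit V n"
      if [simp]: "j \<in> \<J>" for j
      by (simp add: \<theta>(2)[symmetric] ract_def)
    \<comment> \<open>\<open>sq_cancel\<close> expects a product grade, so the square for
      \<open>\<rho>\<close> is reindexed along \<open>RUnit\<close> to grade
      \<open>n \<otimes> I\<close>; there \<open>\<rho>\<close> splits as a counit composed with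
      \<open>\<theta>\<close>.\<close>
    have 3: "sq C (VHom T j k) (n \<otimes> ?I) (cot j (FO B n)) (FO A j) (cot k (FO B n)) (FO A k) (m j k n) (FA A j k)
        (gc C (cot j (FO B n)) (cot n (FO A j)) (FO A j) (cnt n (FO A j)) (\<theta> j n))
        (gc C (cot k (FO B n)) (cot n (FO A k)) (FO A k) (cnt n (FO A k)) (\<theta> k n))"
      using sq_reindex[OF C 2, of "Id V (VHom T j k)" "VHom T j k" "RUnit V n" "n \<otimes> ?I"] by (simp add: r)
    have 4: "sq C (VHom T j k) n (cot n (FO A j)) (FO A j) (cot n (FO A k)) (FO A k)
        (cota n (FO A j) (FO A k) \<cdot> FA A j k) (FA A j k) (cnt n (FO A j)) (cnt n (FO A k))"
      by (rule sq_flip[OF C cota_sq]) auto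
    have "sq C (VHom T j k) ?I (cot j (FO B n)) (cot n (FO A j)) (cot k (FO B n)) (cot n (FO A k)) (m j k n)
        (cota n (FO A j) (FO A k) \<cdot> FA A j k) (\<theta> j n) (\<theta> k n)"
      by (rule sq_cancel[OF C 4 3], simp, simp, rule univ_inj[OF univ_cnt[of n "FO A k"]]) auto
    thus ?thesis by (subst (asm) sq_unit[OF C]) auto
  qed
  have nat_\<theta>': "ract C (cot n (FO A j)) (cot j (FO B n)) (cot k (FO B n)) (m j k n) (\<theta>' j n) =
     lact C (cot n (FO A j)) (cot n (FO A k)) (cot k (FO B n)) (\<theta>' k n) (cota n (FO A j) (FO A k) \<cdot> FA A j k)"
    if [simp]: "j \<in> \<J>" "k \<in> \<J>" "n \<in> \<J>" for j k n
    by (rule natural_inverse[OF C \<theta>(1) \<theta>(1)]) (auto simp: nat_\<theta>)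
  \<comment> \<open>The operations of \<open>U\<close> act on \<open>[j, B -]\<close>; conjugation
    by \<open>\<theta>\<close> transports this action to the objects
    \<open>[-, A j]\<close>.\<close>
  define q where "q n l j = conjugate C (cot n (FO A j)) (cot j (FO B n)) (cot j (FO B l)) (cot l (FO A j)) (\<theta> j l)
      (cota j (FO B n) (FO B l) \<cdot> FA B n l) (\<theta>' j n)" for n l j
  have q [simp]: "q n l j \<in> Arr V" "Dom V (q n l j) = VHom U n l" "Cod V (q n l j) = VHom C (cot n (FO A j)) (cot l (FO A j))"
    if "n \<in> \<J>" "l \<in> \<J>" "j \<in> \<J>" for n l j
    using that by (simp_all add: q_def conjugate_def)
  have q_comp: "q n l j \<cdot> x = conjugate C (cot n (FO A j)) (cot j (FO B n)) (cot j (FO B l)) (cot l (FO A j)) (\<theta> j l)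
      (cota j (FO B n) (FO B l) \<cdot> FA B n l \<cdot> x) (\<theta>' j n)"
    if [simp]: "n \<in> \<J>" "l \<in> \<J>" "j \<in> \<J>" "x \<in> Arr V" "Cod V x = VHom U n l" for n l j x
    by (simp add: q_def conjugate_def lact_reindex[symmetric] ract_reindex[symmetric])
  have wedge: "hom_wedge V T C (?c n A) (?c l A) (VHom U n l) (q n l)" if [simp]: "n \<in> \<J>" "l \<in> \<J>" for n l
    unfolding hom_wedge_iff[OF T alg_cot_algebra[OF T A that(1)] alg_cot_algebra[OF T A that(2)]]
  proof (intro conjI ballI)
    fix j k assume [simp]: "j \<in> \<J>" "k \<in> \<J>"
    \<comment> \<open>Commutation in \<open>m_sq\<close> survives the conjugation because
      \<open>\<theta>\<close> and its inverse are natural in \<open>j\<close>, so each operation of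
      \<open>U\<close> becomes a homomorphism of \<open>T\<close>-algebras.\<close>
    have "sq C (VHom T j k) (VHom U n l) (cot n (FO A j)) (cot l (FO A j)) (cot n (FO A k)) (cot l (FO A k))
        (cota n (FO A j) (FO A k) \<cdot> FA A j k) (cota l (FO A j) (FO A k) \<cdot> FA A j k) (q n l j) (q n l k)"
      unfolding q_def conjugate_def
      by (rule sq_lact[OF C sq_ract[OF C]], rule m_sq[of j k n l "Id V (VHom U n l)", simplified])
        (auto simp: nat_\<theta> nat_\<theta>')
    thus "sq C (VHom T j k) (VHom U n l) (FO (?c n A) j) (FO (?c l A) j) (FO (?c n A) k) (FO (?c l A) k)
        (FA (?c n A) j k) (FA (?c l A) j k) (q n l j) (q n l k)" by simp
  qed auto
  define N where "N = \<lparr>FO = (\<lambda>j\<in>\<J>. j),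
     FA = ext2 \<J> (\<lambda>n l. end_lift V T C (?c n A) (?c l A) (VHom U n l) (q n l))\<rparr>"
  have FON [simp]: "FO N j = j" if "j \<in> \<J>" for j using that by (simp add: N_def)
  have N [simp]: "FA N n l \<in> Arr V" "Dom V (FA N n l) = VHom U n l"
    "Cod V (FA N n l) = end_obj V T C (?c n A) (?c l A)" if "n \<in> \<J>" "l \<in> \<J>" for n l
    using that end_lift(1-3)[OF T _ _ wedge[OF that]] by (simp_all add: N_def)
  have epN: "end_proj V T C (?c n A) (?c l A) j \<cdot> FA N n l = q n l j" if "n \<in> \<J>" "l \<in> \<J>" "j \<in> \<J>" for n l j
    using that end_lift(4)[OF T _ _ wedge[OF that(1,2)] that(3)] by (simp add: N_def)
  have epNx: "end_proj V T C (?c n A) (?c l A) j \<cdot> FA N n l \<cdot> x = q n l j \<cdot> x"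
    if "n \<in> \<J>" "l \<in> \<J>" "j \<in> \<J>" "x \<in> Arr V" "Cod V x = VHom U n l" for n l j x
    using that by (simp add: comp_ext[OF epN])
  let ?D = "TAlg V \<J> C T"
  have "vfunctor V U ?T N"
  proof (rule vfunctorI)
    fix n assume "n \<in> VObj U"
    hence n [simp]: "n \<in> \<J>" by simp
    have "FA N n n \<cdot> VId U n = VId ?D (?c n A)"
    proof (rule end_inj[OF T, of "?c n A" "?c n A"])
      fix j assume [simp]: "j \<in> \<J>"
      have "end_proj V T C (?c n A) (?c n A) j \<cdot> FA N n n \<cdot> VId U n = q n n j \<cdot> VId U n"
        by (rule epNx) auto
      also have "\<dots> = conjugate C (cot n (FO A j)) (cot j (FO B n)) (cot j (FO B n)) (cot n (FO A j)) (\<theta> j n)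
          (VId C (cot j (FO B n))) (\<theta>' j n)"
        using vfunctor_id[OF algebra_functor[OF U B], of n] by (simp add: q_comp cota_id)
      also have "\<dots> = VId C (cot n (FO A j))"
        using \<theta>(1)[of j n] uinverse_iff[OF C, of "cot j (FO B n)" "cot n (FO A j)"] by (simp add: conjugate_def ract_eq_lact)
      also have "\<dots> = end_proj V T C (?c n A) (?c n A) j \<cdot> VId ?D (?c n A)"
        by (simp add: VId_TAlg(2)[OF T])
      finally show "end_proj V T C (?c n A) (?c n A) j \<cdot> FA N n n \<cdot> VId U n =
          end_proj V T C (?c n A) (?c n A) j \<cdot> VId ?D (?c n A)" .
    qed (use VId_TAlg(1)[OF T, of "?c n A"] in auto)
    thus "FA N n n \<cdot> VId U n = VId ?T (FO N n)" by (simp add: gc_commutant[OF T A])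
  next
    fix a b c assume "a \<in> VObj U" "b \<in> VObj U" "c \<in> VObj U"
    hence ab [simp]: "a \<in> \<J>" "b \<in> \<J>" "c \<in> \<J>" by simp_all
    have g: "gc ?D (?c a A) (?c b A) (?c c A) (FA N b c) (FA N a b) \<in> hom V (VHom U b c \<otimes> VHom U a b) (end_obj V T C (?c a A) (?c c A))"
      using gc_V[OF vcategory_TAlg[OF T], of "?c a A" "?c b A" "?c c A" "FA N b c" "FA N a b"] by (simp add: TAlg_V[OF T])
    have "FA N a c \<cdot> VComp U a b c = gc ?D (?c a A) (?c b A) (?c c A) (FA N b c) (FA N a b)"
    proof (rule end_inj[OF T, of "?c a A" "?c c A"])
      fix j assume [simp]: "j \<in> \<J>"
      have "end_proj V T C (?c a A) (?c c A) j \<cdot> FA N a c \<cdot> VComp U a b c = q a c j \<cdot> VComp U a b c"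
        by (rule epNx) auto
      also have "\<dots> = conjugate C (cot a (FO A j)) (cot j (FO B a)) (cot j (FO B c)) (cot c (FO A j)) (\<theta> j c)
           (gc C (cot j (FO B a)) (cot j (FO B b)) (cot j (FO B c)) (cota j (FO B b) (FO B c) \<cdot> FA B b c)
             (cota j (FO B a) (FO B b) \<cdot> FA B a b)) (\<theta>' j a)"
        by (simp add: q_comp vfunctor_VComp[OF algebra_functor[OF U B]] cota_gc)
      also have "\<dots> = gc C (cot a (FO A j)) (cot b (FO A j)) (cot c (FO A j)) (q b c j) (q a b j)"
        unfolding q_def by (subst conjugate_gc[OF C \<theta>(1)]) auto
      also have "\<dots> = end_proj V T C (?c a A) (?c c A) j \<cdot> gc ?D (?c a A) (?c b A) (?c c A) (FA N b c) (FA N a b)"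
        by (simp add: ep_gc[OF T] epN)
      finally show "end_proj V T C (?c a A) (?c c A) j \<cdot> FA N a c \<cdot> VComp U a b c =
        end_proj V T C (?c a A) (?c c A) j \<cdot> gc ?D (?c a A) (?c b A) (?c c A) (FA N b c) (FA N a b)" .
    qed (use g in auto)
    thus "FA N a c \<cdot> VComp U a b c = gc ?T (FO N a) (FO N b) (FO N c) (FA N b c) (FA N a b)"
      by (simp add: gc_commutant[OF T A])
  next
    show "FO N \<in> extensional (VObj U)" "ext2 (VObj U) (FA N) = FA N"
      by (simp_all add: N_def)
  qed (use commutant_theory[OF T A] in auto)
  moreover have "FA N n ?I \<cdot> \<tau> U n = \<tau> ?T n" if [simp]: "n \<in> \<J>" for n
  proof -
    have "FA N n ?I \<cdot> \<tau> U n = Cnt ?D n A"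
    proof (rule end_inj[OF T, of "?c n A" A])
      fix j assume j [simp]: "j \<in> \<J>"
      have "end_proj V T C (?c n A) A j \<cdot> FA N n ?I \<cdot> \<tau> U n = q n ?I j \<cdot> \<tau> U n"
        using epNx[of n ?I j "\<tau> U n"] by simp
      also have "\<dots> = lact C (cot n (FO A j)) (cot j ?b) (FO A j) (s j)
          (ract C (cot n (FO A j)) (cot j (FO B n)) (cot j ?b) (cota j (FO B n) ?b \<cdot> \<kappa> n) (\<theta>' j n))"
        by (simp add: q_comp conjugate_def \<kappa>_def \<theta>_unit)
      also have "\<dots> = ract C (cot n (FO A j)) (cot j (FO B n)) (FO A j) (\<rho> j n) (\<theta>' j n)"
        unfolding \<rho>_def by (subst lact_ract) auto
      \<comment> \<open>\<open>\<theta> j n\<close> was chosen to turn the designated counit into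
        \<open>\<rho> j n\<close>; its inverse undoes this.\<close>
      also have "\<dots> = cnt n (FO A j)"
        unfolding \<theta>(2)[OF j that, symmetric] by (rule uinverse_ract[OF C uinverse_sym[OF \<theta>(1)]]) auto
      also have "\<dots> = end_proj V T C (?c n A) A j \<cdot> Cnt ?D n A"
        by (simp add: Cnt_TAlg(2)[OF T A])
      finally show "end_proj V T C (?c n A) A j \<cdot> FA N n ?I \<cdot> \<tau> U n = end_proj V T C (?c n A) A j \<cdot> Cnt ?D n A" .
    qed (use N[of n ?I] Cnt_TAlg(1)[OF T A, of n] in auto)
    thus ?thesis by (simp add: \<tau>_commutant[OF T A])
  qed
  moreover have "ract C (FO B n) (cot n (FO A ?I)) (cot l (FO A ?I)) (FA ?A n l \<cdot> FA N n l) (\<theta> ?I n) =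
      lact C (FO B n) (FO B l) (cot l (FO A ?I)) (\<theta> ?I l) (FA B n l)" if [simp]: "n \<in> \<J>" "l \<in> \<J>" for n l
  proof -
    have "FA ?A n l \<cdot> FA N n l = q n l ?I" by (simp add: epN)
    \<comment> \<open>At \<open>j = I\<close> the functor \<open>[j, -]\<close> is the identity, so
      the formula for \<open>q\<close> says that \<open>\<theta> I\<close> intertwines
      \<open>B\<close> with the commutant of \<open>A\<close>.\<close>
    also have "\<dots> = lact C (cot n (FO A ?I)) (FO B l) (cot l (FO A ?I)) (\<theta> ?I l)
        (ract C (cot n (FO A ?I)) (FO B n) (FO B l) (FA B n l) (\<theta>' ?I n))"
      by (simp add: q_def conjugate_def cota_unit)
    finally have e: "FA ?A n l \<cdot> FA N n l = lact C (cot n (FO A ?I)) (FO B l) (cot l (FO A ?I)) (\<theta> ?I l)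
        (ract C (cot n (FO A ?I)) (FO B n) (FO B l) (FA B n l) (\<theta>' ?I n))" .
    have t: "uinverse V C (FO B n) (cot n (FO A ?I)) (\<theta> ?I n) (\<theta>' ?I n)"
      "uinverse V C (FO B l) (cot l (FO A ?I)) (\<theta> ?I l) (\<theta>' ?I l)"
      using \<theta>(1)[of ?I n] \<theta>(1)[of ?I l] by simp_all
    note [simp] = uinverse_V[OF t(1)] uinverse_V[OF t(2)]
    have "ract C (FO B n) (cot n (FO A ?I)) (cot l (FO A ?I)) (FA ?A n l \<cdot> FA N n l) (\<theta> ?I n) =
       lact C (FO B n) (FO B l) (cot l (FO A ?I)) (\<theta> ?I l)
        (ract C (FO B n) (cot n (FO A ?I)) (FO B l) (ract C (cot n (FO A ?I)) (FO B n) (FO B l) (FA B n l) (\<theta>' ?I n)) (\<theta> ?I n))"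
      unfolding e by (subst lact_ract) auto
    also have "\<dots> = lact C (FO B n) (FO B l) (cot l (FO A ?I)) (\<theta> ?I l) (FA B n l)"
      by (subst uinverse_ract[OF C t(1)]) auto
    finally show ?thesis .
  qed
  moreover have "\<exists>s. uinverse V C (FO B n) (cot n (FO A ?I)) (\<theta> ?I n) s" if "n \<in> \<J>" for n
    using \<theta>(1)[of ?I n] that by auto
  ultimately have "strong_data U B ?T ?A N (\<lambda>n\<in>\<J>. \<theta> ?I n)"
    unfolding strong_data_def by simp
  moreover have "(\<lambda>n\<in>\<J>. \<theta> ?I n) ?I = s0" by (simp add: \<theta>_unit s_unit)
  ultimately show thesis by (rule that)
qed

lemma commutant_symmetric:
  assumes f: "f \<in> hom \<A> X (com Y)" and Y: "Y \<in> algebras V \<J> C"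
    and s: "uinverse V C (car X) (car Y) (under V f) s"
  obtains g where "g \<in> hom \<A> Y (com X)" "under V g = s"
proof -
  obtain T A U B where X': "X = (T, A)" and Y': "Y = (U, B)" by (meson surj_pair)
  have X: "X \<in> algebras V \<J> C" and
    1: "is_theory V \<J> T" "is_algebra V \<J> C T A" "is_theory V \<J> U" "is_algebra V \<J> C U B" and
    2: "strong_data T A (fst (com (U, B))) (snd (com (U, B))) (MFun f) (MNat f)"
    using f Y unfolding X' Y' hom_Alg_s algebras_iff by auto
  obtain N u where "strong_data U B (fst (com (T, A))) (snd (com (T, A))) N u" "u (Unit V) = s"
    by (rule commutant_symmetric_data[OF 1 2]) (use s in \<open>auto simp: X' Y' alg_carrier_def under_def\<close>)
  hence "\<lparr>Src = Y, Tgt = com X, MFun = N, MNat = u\<rparr> \<in> hom \<A> Y (com X)"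
    "under V \<lparr>Src = Y, Tgt = com X, MFun = N, MNat = u\<rparr> = s"
    using Y commutant_algebras[OF X] by (simp_all add: hom_Alg_s X' Y' under_def)
  thus thesis by (rule that)
qed

end

section \<open>Full subcategories and opposites\<close>

lemma hom_op [simp]: "hom (op_cat X) a b = hom X b a"
  by (auto simp: hom_def op_cat_def)

lemma op_cat_simps [simp]:
  "Obj (op_cat X) = Obj X" "Arr (op_cat X) = Arr X" "Dom (op_cat X) = Cod X" "Cod (op_cat X) = Dom X"
  "Id (op_cat X) = Id X" "g \<cdot>\<^bsub>op_cat X\<^esub> f = f \<cdot>\<^bsub>X\<^esub> g"
  by (simp_all add: op_cat_def)

lemma category_op: "category X \<Longrightarrow> category (op_cat X)"
  unfolding category_def by simp

lemma iso_op: "iso (op_cat X) f \<longleftrightarrow> iso X f"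
  unfolding iso_def inverse_arrows_def by auto

lemma full_subcat_simps [simp]:
  "Obj (full_subcat X P) = {a \<in> Obj X. P a}" "Id (full_subcat X P) = Id X" "Comp (full_subcat X P) = Comp X"
  "Dom (full_subcat X P) = Dom X" "Cod (full_subcat X P) = Cod X"
  by (simp_all add: full_subcat_def)

lemma hom_full_subcat [simp]: "f \<in> hom (full_subcat X P) a b \<longleftrightarrow> f \<in> hom X a b \<and> P a \<and> P b"
  by (auto simp: hom_def full_subcat_def)

lemma op_full_subcat: "op_cat (full_subcat X P) = full_subcat (op_cat X) P"
  by (auto simp: op_cat_def full_subcat_def)

lemma category_full_subcat:
  assumes "category X"
  shows "category (full_subcat X P)"
proof -
  have "f \<in> Arr (full_subcat X P) \<longleftrightarrow> f \<in> Arr X \<and> P (Dom X f) \<and> P (Cod X f)" for f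
    by (auto simp: full_subcat_def)
  thus ?thesis using assms unfolding category_def by simp blast
qed

lemma iso_full_subcat:
  assumes "iso X f" "f \<in> hom X a b" "P a" "P b"
  shows "iso (full_subcat X P) f"
  using assms unfolding iso_def inverse_arrows_def by (auto simp: hom_def full_subcat_def)

lemma functor_full_subcat:
  assumes F: "is_functor X Y F" and P: "\<And>a. a \<in> Obj X \<Longrightarrow> P a \<Longrightarrow> Q (OFO F a)"
  shows "is_functor (full_subcat X P) (full_subcat Y Q) F"
proof -
  have X: "category X" and Y: "category Y" and obj: "\<And>a. a \<in> Obj X \<Longrightarrow> OFO F a \<in> Obj Y"
    and arr: "\<And>a b f. f \<in> hom X a b \<Longrightarrow> OFA F f \<in> hom Y (OFO F a) (OFO F b)"
    and id: "\<And>a. a \<in> Obj X \<Longrightarrow> OFA F (Id X a) = Id Y (OFO F a)"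
    and comp: "\<And>a b c f g. f \<in> hom X a b \<Longrightarrow> g \<in> hom X b c \<Longrightarrow> OFA F (g \<cdot>\<^bsub>X\<^esub> f) = OFA F g \<cdot>\<^bsub>Y\<^esub> OFA F f"
    using F unfolding is_functor_def by blast+
  have o: "a \<in> Obj X \<and> b \<in> Obj X" if "f \<in> hom X a b" for f a b
    using X that unfolding category_def hom_def by auto
  show ?thesis
    unfolding is_functor_def
  proof (intro conjI ballI allI)
    show "OFA F f \<in> hom (full_subcat Y Q) (OFO F a) (OFO F b)" if "f \<in> hom (full_subcat X P) a b" for f a b
      using that arr[of f a b] o[of f a b] P by simp
    show "OFA F (g \<cdot>\<^bsub>full_subcat X P\<^esub> f) = OFA F g \<cdot>\<^bsub>full_subcat Y Q\<^esub> OFA F f"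
      if "f \<in> hom (full_subcat X P) a b" "g \<in> hom (full_subcat X P) b c" for f g a b c
      using that comp[of f a b g c] by simp
  qed (use category_full_subcat X Y obj id P in auto)
qed

text \<open>Units and counits have their ends in the subcategories as soon as both functors
  restrict, and by fullness they then belong to them. The equations are unchanged.\<close>

lemma adjunction_full_subcat:
  assumes "adjunction X Y F G \<eta> \<epsilon>"
    and P: "\<And>a. a \<in> Obj X \<Longrightarrow> P a \<Longrightarrow> Q (OFO F a)" and Q: "\<And>y. y \<in> Obj Y \<Longrightarrow> Q y \<Longrightarrow> P (OFO G y)"
  shows "adjunction (full_subcat X P) (full_subcat Y Q) F G \<eta> \<epsilon>"
proof -
  have F: "is_functor X Y F" and G: "is_functor Y X G" using assms(1) by (auto simp: adjunction_def)
  have "OFO F a \<in> Obj Y" if "a \<in> Obj X" for a using F that by (simp add: is_functor_def)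
  moreover have "OFO G y \<in> Obj X" if "y \<in> Obj Y" for y using G that by (simp add: is_functor_def)
  moreover note functor_full_subcat[OF F, of P Q] functor_full_subcat[OF G, of Q P]
  ultimately show ?thesis
    using assms(1) P Q unfolding adjunction_def Ball_def by simp
qed

section \<open>The adjunction\<close>

context admissible_cat
begin

lemma hom_Alg_on: "f \<in> hom (Alg_on V \<J> C c) X Y \<longleftrightarrow> f \<in> hom \<A> X Y \<and> car X = c \<and> car Y = c \<and> under V f = VId C c"
  by (auto simp: hom_def Alg_on_def Alg_s_def)

lemma hom_algebras: "f \<in> hom \<A> X Y \<Longrightarrow> X \<in> algebras V \<J> C" "f \<in> hom \<A> X Y \<Longrightarrow> Y \<in> algebras V \<J> C"
  by (simp_all add: hom_Alg_s)

lemma car_obj: "X \<in> algebras V \<J> C \<Longrightarrow> car X \<in> VObj C"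
  using under_V(1)[OF id_Alg_s(1)] .

abbreviation unit where "unit \<equiv> com_unit V \<J> C"

lemma unit_hom:
  assumes X: "X \<in> algebras V \<J> C"
  shows "unit X \<in> hom \<A> X (com (com X))" "under V (unit X) = VId C (car X)"
proof -
  note Y = commutant_algebras[OF X]
  have "uinverse V C (car (com X)) (car X) (under V (Id \<A> (com X))) (VId C (car X))"
    using uinverse_id[OF C car_obj[OF X]] by (simp add: id_Alg_s[OF Y] carrier_commutant[OF X])
  then obtain u where "u \<in> hom \<A> X (com (com X))" "under V u = VId C (car X)"
    by (rule commutant_symmetric[OF id_Alg_s(1)[OF Y] X])
  hence u: "u \<in> hom (Alg_on V \<J> C (car X)) X (com (com X))"
    by (simp add: hom_Alg_on carrier_commutant X Y)
  have "unit X \<in> hom (Alg_on V \<J> C (car X)) X (com (com X))"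
    unfolding com_unit_def
  proof (rule theI[of "\<lambda>u. u \<in> hom (Alg_on V \<J> C (car X)) X (com (com X))", OF u])
    fix v assume "v \<in> hom (Alg_on V \<J> C (car X)) X (com (com X))"
    thus "v = u" using u by (intro commutant_eqI[where X = X, OF _ _ _ Y]) (simp_all add: hom_Alg_on)
  qed
  thus "unit X \<in> hom \<A> X (com (com X))" "under V (unit X) = VId C (car X)" by (simp_all add: hom_Alg_on)
qed

abbreviation coma where "coma \<equiv> OFA (Com V \<J> C)"

lemma Com_arr:
  assumes f: "f \<in> hom \<A> X Y"
  shows "coma f \<in> hom \<A> (com Y) (com X)" "uinverse V C (car X) (car Y) (under V f) (under V (coma f))"
proof -
  note X = hom_algebras(1)[OF f] and Y = hom_algebras(2)[OF f]
  note [simp] = under_V[OF f]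
  obtain s where s: "uinverse V C (car X) (car Y) (under V f) s" using under_V(6)[OF f] by blast
  note h = comp_Alg_s_hom[OF f unit_hom(1)[OF Y]]
  have "under V (unit Y \<cdot>\<^bsub>\<A>\<^esub> f) = under V f"
    unfolding h(2) unit_hom(2)[OF Y] carrier_commutant[OF commutant_algebras[OF Y]] carrier_commutant[OF Y] by simp
  hence "uinverse V C (car X) (car (com Y)) (under V (unit Y \<cdot>\<^bsub>\<A>\<^esub> f)) s"
    using s by (simp add: carrier_commutant[OF Y])
  then obtain g where g: "g \<in> hom \<A> (com Y) (com X)" "under V g = s"
    by (rule commutant_symmetric[OF h(1) commutant_algebras[OF Y]])
  have "coma f = (THE g. g \<in> hom \<A> (com Y) (com X) \<and> uinverse V C (car X) (car Y) (under V f) (under V g))"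
    using f by (simp add: Com_def hom_Alg_s)
  also have "\<dots> = g"
  proof (rule the_equality)
    fix h assume h: "h \<in> hom \<A> (com Y) (com X) \<and> uinverse V C (car X) (car Y) (under V f) (under V h)"
    hence "under V h = under V g" using uinverse_unique[OF C _ s] g(2) by simp
    thus "h = g" using h g(1) by (intro commutant_eqI[where X = "com Y", OF _ _ _ X]) simp_all
  qed (use g s in simp)
  finally show "coma f \<in> hom \<A> (com Y) (com X)" "uinverse V C (car X) (car Y) (under V f) (under V (coma f))"
    using g s by simp_all
qed

lemma under_Com:
  assumes "f \<in> hom \<A> X Y" "uinverse V C (car X) (car Y) (under V f) s"
  shows "under V (coma f) = s"
  by (rule uinverse_unique[OF C Com_arr(2)[OF assms(1)] assms(2)]) (use under_V[OF assms(1)] in auto)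

lemma Com_id:
  assumes X: "X \<in> algebras V \<J> C"
  shows "coma (Id \<A> X) = Id \<A> (com X)"
proof (rule commutant_eqI[OF Com_arr(1)[OF id_Alg_s(1)[OF X]] id_Alg_s(1)[OF commutant_algebras[OF X]] _ X])
  show "under V (coma (Id \<A> X)) = under V (Id \<A> (com X))"
    by (rule under_Com[OF id_Alg_s(1)[OF X]])
      (simp add: id_Alg_s(2)[OF X] id_Alg_s(2)[OF commutant_algebras[OF X]] carrier_commutant X uinverse_id car_obj)
qed

lemma Com_comp:
  assumes f: "f \<in> hom \<A> X Y" and g: "g \<in> hom \<A> Y Z"
  shows "coma (g \<cdot>\<^bsub>\<A>\<^esub> f) = coma f \<cdot>\<^bsub>\<A>\<^esub> coma g"
proof (rule commutant_eqI[OF Com_arr(1)[OF comp_Alg_s_hom(1)[OF f g]]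
      comp_Alg_s_hom(1)[OF Com_arr(1)[OF g] Com_arr(1)[OF f]] _ hom_algebras(1)[OF f]])
  have "uinverse V C (car X) (car Z) (under V (g \<cdot>\<^bsub>\<A>\<^esub> f)) (under V (coma f \<cdot>\<^bsub>\<A>\<^esub> coma g))"
    unfolding comp_Alg_s_hom(2)[OF f g] comp_Alg_s_hom(2)[OF Com_arr(1)[OF g] Com_arr(1)[OF f]]
    using uinverse_comp[OF C Com_arr(2)[OF f] Com_arr(2)[OF g]] under_V[OF f] under_V[OF g]
    by (simp add: carrier_commutant hom_algebras[OF f] hom_algebras[OF g])
  thus "under V (coma (g \<cdot>\<^bsub>\<A>\<^esub> f)) = under V (coma f \<cdot>\<^bsub>\<A>\<^esub> coma g)"
    by (rule under_Com[OF comp_Alg_s_hom(1)[OF f g]])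
qed

text \<open>Two applications of the commutant functor invert the underlying isomorphism twice, so
  both sides lie over that of \<open>f\<close>.\<close>

lemma unit_natural:
  assumes f: "f \<in> hom \<A> X Y"
  shows "unit Y \<cdot>\<^bsub>\<A>\<^esub> f = coma (coma f) \<cdot>\<^bsub>\<A>\<^esub> unit X"
proof -
  note X = hom_algebras(1)[OF f] and Y = hom_algebras(2)[OF f]
  note [simp] = under_V[OF f] carrier_commutant[OF X] carrier_commutant[OF Y]
    carrier_commutant[OF commutant_algebras[OF X]] carrier_commutant[OF commutant_algebras[OF Y]]
  note l = comp_Alg_s_hom[OF f unit_hom(1)[OF Y]]
  note r = comp_Alg_s_hom[OF unit_hom(1)[OF X] Com_arr(1)[OF Com_arr(1)[OF f]]]
  have "under V (coma (coma f)) = under V f"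
    by (rule under_Com[OF Com_arr(1)[OF f]]) (use uinverse_sym[OF Com_arr(2)[OF f]] in simp)
  hence "under V (unit Y \<cdot>\<^bsub>\<A>\<^esub> f) = under V (coma (coma f) \<cdot>\<^bsub>\<A>\<^esub> unit X)"
    by (simp add: l(2) r(2) unit_hom(2)[OF X] unit_hom(2)[OF Y])
  thus ?thesis by (rule commutant_eqI[OF l(1) r(1) _ commutant_algebras[OF Y]])
qed

lemma under_Com_unit:
  assumes X: "X \<in> algebras V \<J> C"
  shows "under V (coma (unit X)) = VId C (car X)"
  by (rule under_Com[OF unit_hom(1)[OF X]])
    (simp add: unit_hom(2)[OF X] carrier_commutant X commutant_algebras uinverse_id car_obj)

text \<open>All these arrows lie over the identity of the carrier and end in commutants. The first
  equation is a triangle identity; with the second, the unit becomes invertible on commutants, which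
  is the idempotency.\<close>

lemma Com_unit_inverse:
  assumes X: "X \<in> algebras V \<J> C"
  shows "coma (unit X) \<cdot>\<^bsub>\<A>\<^esub> unit (com X) = Id \<A> (com X)"
    "unit (com X) \<cdot>\<^bsub>\<A>\<^esub> coma (unit X) = Id \<A> (com (com (com X)))"
proof -
  note Y = commutant_algebras[OF X] note Z = commutant_algebras[OF Y] note W = commutant_algebras[OF Z]
  note [simp] = carrier_commutant[OF X] carrier_commutant[OF Y] carrier_commutant[OF Z] car_obj[OF X]
  note u = unit_hom[OF Y] and c = Com_arr(1)[OF unit_hom(1)[OF X]]
  show "coma (unit X) \<cdot>\<^bsub>\<A>\<^esub> unit (com X) = Id \<A> (com X)"
    by (rule commutant_eqI[OF comp_Alg_s_hom(1)[OF u(1) c] id_Alg_s(1)[OF Y] _ X])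
      (simp add: comp_Alg_s_hom(2)[OF u(1) c] id_Alg_s(2)[OF Y] u(2) under_Com_unit[OF X])
  show "unit (com X) \<cdot>\<^bsub>\<A>\<^esub> coma (unit X) = Id \<A> (com (com (com X)))"
    by (rule commutant_eqI[OF comp_Alg_s_hom(1)[OF c u(1)] id_Alg_s(1)[OF W] _ Z])
      (simp add: comp_Alg_s_hom(2)[OF c u(1)] id_Alg_s(2)[OF W] u(2) under_Com_unit[OF X])
qed

lemma iso_unit_commutant:
  assumes X: "X \<in> algebras V \<J> C"
  shows "iso \<A> (unit (com X))" "iso \<A> (coma (unit X))"
proof -
  note u = unit_hom(1)[OF commutant_algebras[OF X]] and c = Com_arr(1)[OF unit_hom(1)[OF X]]
  have "inverse_arrows \<A> (unit (com X)) (coma (unit X))" "inverse_arrows \<A> (coma (unit X)) (unit (com X))"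
    using u c Com_unit_inverse[OF X] unfolding inverse_arrows_def hom_def by auto
  thus "iso \<A> (unit (com X))" "iso \<A> (coma (unit X))" unfolding iso_def by blast+
qed

abbreviation "\<C> \<equiv> Com V \<J> C"

lemma OFO_Com [simp]: "OFO \<C> = com"
  by (simp add: Com_def)

lemma functor_Com: "is_functor \<A> (op_cat \<A>) \<C>" "is_functor (op_cat \<A>) \<A> \<C>"
  unfolding is_functor_def
  using category_Alg_s category_op[OF category_Alg_s] commutant_algebras Com_arr(1) Com_id Com_comp
  by (simp_all add: Alg_s_V)

text \<open>The functor is its own adjoint up to reversal: read in the opposite category, naturality
  of the counit is that of the unit, and both triangle identities are the first equation of
  \<open>Com_unit_inverse\<close>.\<close>

lemma adjunction_Com: "adjunction \<A> (op_cat \<A>) \<C> \<C> unit unit"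
  unfolding adjunction_def
  using functor_Com unit_hom(1) unit_natural Com_unit_inverse(1) by (simp add: Alg_s_V)

subsection \<open>Commutative and saturated algebras\<close>

lemma commutative_iff:
  "commutative V \<J> C X \<longleftrightarrow> X \<in> algebras V \<J> C \<and> (\<exists>f\<in>hom \<A> X (com X). under V f = VId C (car X))"
  unfolding commutative_def commutes_with_def hom_Alg_on
  by (auto simp: Alg_on_def carrier_commutant)

text \<open>If \<open>f\<close> goes from \<open>X\<close> to \<open>com X\<close> over the
  identity, then \<open>coma f\<close> goes from \<open>com (com X)\<close> to \<open>com X\<close>.
  Followed by the unit it reaches \<open>com (com (com X))\<close>, which makes
  \<open>com (com X)\<close> commute with itself.\<close>

lemma contracommutative_commutant:
  assumes "commutative V \<J> C X"
  shows "contracommutative V \<J> C (com X)"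
proof -
  obtain f where X: "X \<in> algebras V \<J> C" and f: "f \<in> hom \<A> X (com X)" "under V f = VId C (car X)"
    using assms commutative_iff by blast
  note Y = commutant_algebras[OF X] note Z = commutant_algebras[OF Y]
  note [simp] = carrier_commutant[OF X] carrier_commutant[OF Y] carrier_commutant[OF Z] car_obj[OF X]
  have "under V (coma f) = VId C (car X)"
    by (rule under_Com[OF f(1)]) (simp add: f(2) uinverse_id)
  hence "under V (unit (com X) \<cdot>\<^bsub>\<A>\<^esub> coma f) = VId C (car X)"
    by (simp add: comp_Alg_s_hom(2)[OF Com_arr(1)[OF f(1)] unit_hom(1)[OF Y]] unit_hom(2)[OF Y])
  hence "commutative V \<J> C (com (com X))"
    using comp_Alg_s_hom(1)[OF Com_arr(1)[OF f(1)] unit_hom(1)[OF Y]] Z by (auto simp: commutative_iff)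
  thus ?thesis by (simp add: contracommutative_def)
qed

text \<open>Idempotency in terms of objects. It makes both functors restrict to saturated
  algebras.\<close>

lemma saturated_commutant: "X \<in> algebras V \<J> C \<Longrightarrow> saturated V \<J> C (com X)"
  by (simp add: saturated_def iso_unit_commutant)

theorem commutant_adjunctions:
  "idempotent_adjunction \<A> (op_cat \<A>) \<C> \<C> unit unit"
  "idempotent_adjunction (CAlg_s V \<J> C) (op_cat (CoCAlg_s V \<J> C)) \<C> \<C> unit unit"
  "adjoint_equivalence (SatCAlg_s V \<J> C) (op_cat (SatCoCAlg_s V \<J> C)) \<C> \<C> unit unit"
proof -
  let ?c = "commutative V \<J> C" and ?d = "contracommutative V \<J> C" and ?s = "saturated V \<J> C"
  show "idempotent_adjunction \<A> (op_cat \<A>) \<C> \<C> unit unit"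
    unfolding idempotent_adjunction_def using adjunction_Com iso_unit_commutant(2) by (simp add: iso_op Alg_s_V)
  have "adjunction (full_subcat \<A> ?c) (full_subcat (op_cat \<A>) ?d) \<C> \<C> unit unit"
    by (rule adjunction_full_subcat[OF adjunction_Com])
      (simp add: contracommutative_commutant, simp add: contracommutative_def)
  \<comment> \<open>The arrow runs from \<open>com (com (com X))\<close> to \<open>com X\<close>.
    Both ends are commutants of commutative algebras, so by fullness its inverse in the whole
    category stays in the subcategory.\<close>
  moreover have "iso (full_subcat \<A> ?d) (coma (unit X))" if "X \<in> algebras V \<J> C" "?c X" for X
  proof (rule iso_full_subcat[OF iso_unit_commutant(2)[OF that(1)] Com_arr(1)[OF unit_hom(1)[OF that(1)]]])
    show "?d (com X)" by (rule contracommutative_commutant[OF that(2)])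
    hence "?c (com (com X))" by (simp add: contracommutative_def)
    thus "?d (com (com (com X)))" by (rule contracommutative_commutant)
  qed
  ultimately show "idempotent_adjunction (CAlg_s V \<J> C) (op_cat (CoCAlg_s V \<J> C)) \<C> \<C> unit unit"
    unfolding idempotent_adjunction_def CAlg_s_def CoCAlg_s_def by (simp add: iso_op op_full_subcat[symmetric] Alg_s_V)
  have "adjunction (full_subcat \<A> (\<lambda>X. ?s X \<and> ?c X)) (full_subcat (op_cat \<A>) (\<lambda>X. ?s X \<and> ?d X)) \<C> \<C> unit unit"
    by (rule adjunction_full_subcat[OF adjunction_Com])
      (simp add: contracommutative_commutant saturated_commutant Alg_s_V,
        simp add: contracommutative_def saturated_commutant Alg_s_V)
  \<comment> \<open>Saturation is the invertibility of the unit. Its target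
    \<open>com (com X)\<close> is again saturated and commutative, so the inverse lies in the
    subcategory.\<close>
  moreover have "iso (full_subcat \<A> (\<lambda>X. ?s X \<and> ?c X)) (unit X)" if "X \<in> algebras V \<J> C" "?s X" "?c X" for X
    by (rule iso_full_subcat[OF that(2)[unfolded saturated_def] unit_hom(1)[OF that(1)]])
      (use that contracommutative_commutant[OF that(3)] in
        \<open>simp_all add: contracommutative_def saturated_commutant commutant_algebras\<close>)
  moreover have "iso (full_subcat \<A> (\<lambda>X. ?s X \<and> ?d X)) (unit X)" if "X \<in> algebras V \<J> C" "?s X" "?d X" for X
    by (rule iso_full_subcat[OF that(2)[unfolded saturated_def] unit_hom(1)[OF that(1)]])
      (use that contracommutative_commutant[of "com X"] in
        \<open>simp_all add: contracommutative_def saturated_commutant commutant_algebras\<close>)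
  ultimately show "adjoint_equivalence (SatCAlg_s V \<J> C) (op_cat (SatCoCAlg_s V \<J> C)) \<C> \<C> unit unit"
    unfolding adjoint_equivalence_def SatCAlg_s_def SatCoCAlg_s_def
    by (simp add: iso_op op_full_subcat[symmetric] Alg_s_V)
qed

end

theorem corollary13p9:
  fixes V :: "('o, 'm) smc" and \<J> :: "'o set" and C :: "('c, 'o, 'm) cvcat"
  assumes "symmetric_monoidal_closed V"
    and "has_pullbacks V"
    and "system_of_arities V \<J>"
    and "vcategory V C"
    and "admissible V \<J> C"
  shows "idempotent_adjunction (Alg_s V \<J> C) (op_cat (Alg_s V \<J> C))
           (Com V \<J> C) (Com V \<J> C) (com_unit V \<J> C) (com_unit V \<J> C)
       \<and> idempotent_adjunction (CAlg_s V \<J> C) (op_cat (CoCAlg_s V \<J> C))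
           (Com V \<J> C) (Com V \<J> C) (com_unit V \<J> C) (com_unit V \<J> C)
       \<and> adjoint_equivalence (SatCAlg_s V \<J> C) (op_cat (SatCoCAlg_s V \<J> C))
           (Com V \<J> C) (Com V \<J> C) (com_unit V \<J> C) (com_unit V \<J> C)"
proof -
  interpret admissible_cat V \<J> C
    by unfold_locales (use assms in auto)
  show ?thesis using commutant_adjunctions by blast
qed

end
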